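(* Let $d\ge1$ and let $X^{(i)}(\boldsymbol{u})$, $\boldsymbol{u}\in\mathbb{R}^{d+1}$, $i\in\mathbb{N}_0$, be independent identically distributed homogeneous isotropic Gaussian random fields with zero mean, variance $s^2>0$ and covariance function $r(\|\boldsymbol{u}_1-\boldsymbol{u}_2\|)=EX^{(i)}(\boldsymbol{u}_1)X^{(i)}(\boldsymbol{u}_2)$. Let $b>1$ and $$\Lambda^{(i)}(\boldsymbol{\theta})=\frac{e^{X^{(i)}(b^i,\boldsymbol{\theta})}}{Ee^{X^{(i)}(b^i,\boldsymbol{\theta})}},\qquad \boldsymbol{\theta}\in\mathbb{S}^d,\ i\in\mathbb{N}_0 .$$ Suppose that $r(\cdot)$ is non-increasing and that for an integer $p\ge2$ $$b>\exp\left(\frac{p(p-1)s^2}{2d}\right),\qquad\sum_{i=0}^\infty r(b^i)<\infty,\qquad \sum_{i=0}^\infty\big(s^2-r(b^{-i})\big)<\infty,$$ so that the limiting measure $\mu$ exists with $\mu(B)\in L_p$ and $\mu$ is non-degenerate. Then $\mu$ possesses the Rényi function $$\tau_\mu(q)=-\frac{s^2}{2d\ln b}\,q^2+\left(\frac{s^2}{2d\ln b}+1\right)q-1,\qquad q\in[0,p].$$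
   Context: All random objects live on a fixed probability space; random fields are assumed jointly measurable in the spatial variable and $\omega$. $\mathbb{N}_0=\{0,1,\dots\}$; $\|\cdot\|$ is the Euclidean norm. $\mathbb{S}^d$ is the unit sphere centred at the origin in $\mathbb{R}^{d+1}$ with Borel $\sigma$-algebra $\mathcal{B}(\mathbb{S}^d)$, surface (Lebesgue) measure $\sigma$ and angular distance $d_{\mathbb{S}^d}$; $B_u(\boldsymbol{\theta})=\{\boldsymbol{\theta}_1\in\mathbb{S}^d:d_{\mathbb{S}^d}(\boldsymbol{\theta}_1,\boldsymbol{\theta})\le u\}$. For $\eta\ge0$ and $\boldsymbol{\theta}\in\mathbb{S}^d$, $(\eta,\boldsymbol{\theta})$ denotes the point of $\mathbb{R}^{d+1}$ with radial coordinate $\eta$ and direction $\boldsymbol{\theta}$, i.e. $\eta\boldsymbol{\theta}$. Put $\mu_n(B)=\int_B\prod_{i=0}^n\Lambda^{(i)}(\boldsymbol{\theta})\,\sigma(d\boldsymbol{\theta})$, $B\in\mathcal{B}(\mathbb{S}^d)$. The limiting measure $\mu$ is the random measure with $\mu_n(B)\to\mu(B)$ as $n\to\infty$ with probability 1 and in $L_p$ for each Borel set $B$ under consideration. "Non-degenerate" means not almost surely the zero measure. Rényi function: for a random measure $\mu$ on $\mathbb{S}^d$, $$\tau_\mu(q)=\liminf_{l\to\infty}\frac{\log\Big(\sum_{\Delta_l^{(m)}\in\Delta_l}E\mu^q(\Delta_l^{(m)})\Big)}{\log|\Delta_l^{(0)}|},\qquad q\ge0,$$ with $\mu^q(B)=(\mu(B))^q$,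 where $\Delta_l=\{\Delta_l^{(m)}\}_m$ is the mesh formed by the $l$-level dyadic decomposition of $\mathbb{S}^d$: nested finite partitions of $\mathbb{S}^d$ into Borel cells such that, for constants $c,C>0$ independent of $l,m$, each cell contains a point $\boldsymbol{\theta}_l^{(m)}$ with $B_{c2^{-l}}(\boldsymbol{\theta}_l^{(m)})\subset\Delta_l^{(m)}\subset B_{C2^{-l}}(\boldsymbol{\theta}_l^{(m)})$; $|\cdot|$ denotes the Lebesgue measure $\sigma$. *)

theory Defs
  imports "HOL-Probability.Probability"
begin

(* The surface measure of a Borel set B of the unit sphere is DIM('a) times the Lebesgue measure
   of the cone {t *\<^sub>R x | 0 < t \<le> 1, x \<in> B} (integration in polar coordinates). *)
definition sphere_measure :: "'a::euclidean_space measure" where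
  "sphere_measure = scale_measure (of_nat DIM('a))
     (distr (restrict_space lborel (cball 0 1 - {0})) (restrict_space borel (sphere 0 1))
        (\<lambda>x. x /\<^sub>R norm x))"

lemma space_sphere_measure [simp]:
  "space (sphere_measure :: 'a::euclidean_space measure) = sphere 0 1"
  by (simp add: sphere_measure_def space_scale_measure space_restrict_space)

lemma sets_sphere_measure [simp, measurable_cong]:
  "sets (sphere_measure :: 'a::euclidean_space measure) = sets (restrict_space borel (sphere 0 1))"
  by (simp add: sphere_measure_def)

lemma emeasure_sphere_measure:
  assumes "B \<in> sets (borel :: 'a::euclidean_space measure)" "B \<subseteq> sphere 0 1"
  shows "emeasure sphere_measure B =
    of_nat DIM('a) * emeasure lborel {x \<in> cball 0 1 - {0}. x /\<^sub>R norm x \<in> B}"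
proof -
  let ?L = "restrict_space lborel (cball 0 1 - {0 :: 'a})"
  have "(\<lambda>x :: 'a. x /\<^sub>R norm x) \<in> ?L \<rightarrow>\<^sub>M borel"
    by (rule measurable_restrict_space1) measurable
  then have f: "(\<lambda>x :: 'a. x /\<^sub>R norm x) \<in> ?L \<rightarrow>\<^sub>M restrict_space borel (sphere 0 1)"
    by (intro measurable_restrict_space2) (auto simp: space_restrict_space)
  have B: "B \<in> sets (restrict_space borel (sphere 0 1))"
    using assms by (auto simp: sets_restrict_space)
  have *: "(\<lambda>x. x /\<^sub>R norm x) -` B \<inter> space ?L = {x \<in> cball 0 1 - {0}. x /\<^sub>R norm x \<in> B}"
    by (auto simp: space_restrict_space)
  show ?thesis
    unfolding sphere_measure_def emeasure_scale_measure emeasure_distr[OF f B] *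
    by (subst emeasure_restrict_space) auto
qed

definition angular_dist :: "'a::euclidean_space \<Rightarrow> 'a \<Rightarrow> real" where
  "angular_dist x y = arccos (x \<bullet> y)"

definition sphere_ball :: "real \<Rightarrow> 'a::euclidean_space \<Rightarrow> 'a set" where
  "sphere_ball u x = {y \<in> sphere 0 1. angular_dist y x \<le> u}"

(* Constants count as (degenerate) normal variables. *)
definition gaussian_rv :: "'w measure \<Rightarrow> ('w \<Rightarrow> real) \<Rightarrow> bool" where
  "gaussian_rv M Y \<longleftrightarrow> Y \<in> borel_measurable M \<and>
     ((\<exists>m v. 0 < v \<and> distributed M lborel Y (\<lambda>x. ennreal (normal_density m v x))) \<or>
      (\<exists>m. AE \<omega> in M. Y \<omega> = m))"

definition gaussian_field :: "'w measure \<Rightarrow> ('u \<Rightarrow> 'w \<Rightarrow> real) \<Rightarrow> bool" where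
  "gaussian_field M X \<longleftrightarrow>
     (\<forall>F a. finite F \<longrightarrow> gaussian_rv M (\<lambda>\<omega>. \<Sum>u\<in>F. a u * X u \<omega>))"

(* Wide-sense homogeneity and isotropy; for Gaussian fields this is the same as invariance of
   all finite-dimensional distributions under rigid motions. *)
definition homogeneous_isotropic ::
  "'w measure \<Rightarrow> ('u::euclidean_space \<Rightarrow> 'w \<Rightarrow> real) \<Rightarrow> bool" where
  "homogeneous_isotropic M X \<longleftrightarrow>
     (\<forall>u. integrable M (\<lambda>\<omega>. (X u \<omega>)\<^sup>2)) \<and>
     (\<exists>m. \<forall>u. prob_space.expectation M (X u) = m) \<and>
     (\<exists>\<rho>. \<forall>u v. prob_space.expectation M
        (\<lambda>\<omega>. (X u \<omega> - prob_space.expectation M (X u)) * (X v \<omega> - prob_space.expectation M (X v)))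
          = \<rho> (norm (u - v)))"

definition iid_fields :: "'w measure \<Rightarrow> (nat \<Rightarrow> 'u \<Rightarrow> 'w \<Rightarrow> real) \<Rightarrow> bool" where
  "iid_fields M X \<longleftrightarrow>
     prob_space.indep_vars M (\<lambda>_. Pi\<^sub>M UNIV (\<lambda>_. borel)) (\<lambda>i \<omega> u. X i u \<omega>) UNIV \<and>
     (\<forall>i j. distr M (Pi\<^sub>M UNIV (\<lambda>_. borel)) (\<lambda>\<omega> u. X i u \<omega>) =
            distr M (Pi\<^sub>M UNIV (\<lambda>_. borel)) (\<lambda>\<omega> u. X j u \<omega>))"

definition Lambda ::
  "'w measure \<Rightarrow> real \<Rightarrow> (nat \<Rightarrow> 'u::euclidean_space \<Rightarrow> 'w \<Rightarrow> real) \<Rightarrow> nat \<Rightarrow> 'u \<Rightarrow> 'w \<Rightarrow> real" where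
  "Lambda M b X i \<theta> \<omega> =
     exp (X i (b ^ i *\<^sub>R \<theta>) \<omega>) / prob_space.expectation M (\<lambda>\<omega>'. exp (X i (b ^ i *\<^sub>R \<theta>) \<omega>'))"

definition approx_measure ::
  "'w measure \<Rightarrow> real \<Rightarrow> (nat \<Rightarrow> 'u::euclidean_space \<Rightarrow> 'w \<Rightarrow> real) \<Rightarrow> nat \<Rightarrow> 'w \<Rightarrow> 'u measure" where
  "approx_measure M b X n \<omega> =
     density sphere_measure (\<lambda>\<theta>. ennreal (\<Prod>i\<le>n. Lambda M b X i \<theta> \<omega>))"

definition random_measure :: "'w measure \<Rightarrow> ('w \<Rightarrow> 'u::euclidean_space measure) \<Rightarrow> bool" where
  "random_measure M \<mu> \<longleftrightarrow>
     (\<forall>\<omega>\<in>space M. sets (\<mu> \<omega>) = sets sphere_measure \<and> finite_measure (\<mu> \<omega>)) \<and>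
     (\<forall>B\<in>sets sphere_measure. (\<lambda>\<omega>. measure (\<mu> \<omega>) B) \<in> borel_measurable M)"

definition limiting_measure ::
  "'w measure \<Rightarrow> real \<Rightarrow> (nat \<Rightarrow> 'u::euclidean_space \<Rightarrow> 'w \<Rightarrow> real) \<Rightarrow> nat \<Rightarrow>
     ('w \<Rightarrow> 'u measure) \<Rightarrow> bool" where
  "limiting_measure M b X p \<mu> \<longleftrightarrow> random_measure M \<mu> \<and>
     (\<forall>B\<in>sets sphere_measure.
        (AE \<omega> in M. (\<lambda>n. measure (approx_measure M b X n \<omega>) B) \<longlonglongrightarrow> measure (\<mu> \<omega>) B) \<and>
        (\<lambda>n. \<integral>\<^sup>+\<omega>. ennreal (\<bar>measure (approx_measure M b X n \<omega>) B - measure (\<mu> \<omega>) B\<bar> ^ p) \<partial>M)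
          \<longlonglongrightarrow> 0)"

definition nondegenerate :: "'w measure \<Rightarrow> ('w \<Rightarrow> 'u measure) \<Rightarrow> bool" where
  "nondegenerate M \<mu> \<longleftrightarrow> \<not> (AE \<omega> in M. \<mu> \<omega> = null_measure (\<mu> \<omega>))"

(* Level l consists of the cells \<Delta> l m with m < N l. *)
definition dyadic_mesh :: "(nat \<Rightarrow> nat) \<Rightarrow> (nat \<Rightarrow> nat \<Rightarrow> 'u::euclidean_space set) \<Rightarrow> bool" where
  "dyadic_mesh N \<Delta> \<longleftrightarrow>
     (\<forall>l. (\<Union>m<N l. \<Delta> l m) = sphere 0 1 \<and> disjoint_family_on (\<Delta> l) {..<N l}) \<and>
     (\<forall>l. \<forall>m<N l. \<Delta> l m \<in> sets borel) \<and>
     (\<forall>l. \<forall>m<N (Suc l). \<exists>k<N l. \<Delta> (Suc l) m \<subseteq> \<Delta> l k) \<and>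
     (\<exists>c>0. \<exists>C>0. \<forall>l. \<forall>m<N l. \<exists>\<theta>\<in>\<Delta> l m.
        sphere_ball (c / 2 ^ l) \<theta> \<subseteq> \<Delta> l m \<and> \<Delta> l m \<subseteq> sphere_ball (C / 2 ^ l) \<theta>)"

(* Unlike powr, with the convention 0^0 = 1. *)
definition nonneg_power :: "real \<Rightarrow> real \<Rightarrow> real" where
  "nonneg_power x q = (if q = 0 then 1 else x powr q)"

definition renyi_function ::
  "'w measure \<Rightarrow> (nat \<Rightarrow> nat) \<Rightarrow> (nat \<Rightarrow> nat \<Rightarrow> 'u::euclidean_space set) \<Rightarrow>
     ('w \<Rightarrow> 'u measure) \<Rightarrow> real \<Rightarrow> ereal" where
  "renyi_function M N \<Delta> \<mu> q = liminf (\<lambda>l. ereal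
     (ln (\<Sum>m<N l. prob_space.expectation M (\<lambda>\<omega>. nonneg_power (measure (\<mu> \<omega>) (\<Delta> l m)) q))
       / ln (measure sphere_measure (\<Delta> l 0))))"

end

theory Submission
  imports Defs
begin

text \<open>
  Write \<gamma> = s^2 / ln b, let mu_N be the measure with density the product of the Lambda^(i) for
  i \<le> N, and let r be the common covariance function.

  Integer moments. The k-th moment of mu_N(B) is an integral over k points of B of the mean of the
  exponential of a Gaussian variable. By independence of the levels this mean is the exponential of
  the sum, over pairs of points and levels i, of r (b^i t), where t is the distance of the pair. A
  level contributes nearly s^2 while b^i t is small, and the levels with b^i t > 1 contribute a
  convergent series, so each pair has the kernel t^(-\<gamma>) up to constants (fine_cov_shell). There
  are k (k - 1) / 2 pairs, and the hypothesis on b says that the kernel to the power p (p - 1) / 2 is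
  integrable on the d-dimensional sphere (kernel_integral). Hence moments up to order p are bounded
  in N.

  Existence. The masses mu_N(B) form a martingale bounded in L_p, which converges almost surely and
  in L_p (Lp_martingale_convergence). The null sets depend on B, but the limits are almost surely
  additive and have the surface measure as mean, and such a family is almost surely
  given by a random measure (regular_version): the set functions are transported to the real line
  and replaced by a distribution function.

  Renyi function. Consider a cell of diameter 2^(-l) around \<theta>, and n with b^n about 2^l. On the
  cell the first n levels are nearly constant, because the defects s^2 - r (b^(-j)) are
  summable. So the mass of the cell is exp (A - n s^2 / 2) b^(-n d) z, where A is the sum of the
  first n fields at \<theta> and z comes from a copy of the cascade at scale 1 and is of order one. As A
  has variance n s^2, the moment of order q should be of the order of

    b^(- n d q) exp (n (q^2 - q) s^2 / 2) = b^(- n (d q - \<gamma> (q^2 - q) / 2)).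

  To make this precise for real q, weight the probability by exp (q A). The weighted moments of z
  of orders 0, 1, 2 and p are again explicit Gaussian integrals (moment_upper, moment_lower), and
  they bound the weighted moment of order q from above and below (tilted_moment_bounds). There are
  about 2^(l d) cells, each of measure about 2^(-l d), and taking logarithms gives the formula.
\<close>

section \<open>Spherical caps\<close>

text \<open>
  The surface measure of a cap is, up to the factor d + 1, the volume of the cone over it. The
  cone lies within distance u of the axis, so about 1 / u balls of radius 2 u centred on the axis
  cover it, with total volume of order u^(d+1) / u.
\<close>

lemma emeasure_sphere_measure_cap_le:
  fixes x :: "'a::euclidean_space"
  assumes d: "DIM('a) = Suc d" and x: "norm x = 1" and u: "u > 0"
  shows "emeasure sphere_measure {y \<in> sphere 0 1. norm (y - x) \<le> u}
    \<le> ennreal (real (Suc d) * unit_ball_vol (Suc d) * 2 ^ (d + 2) * u ^ d)"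
proof -
  let ?V = "unit_ball_vol (real (Suc d))"
  let ?B = "{y \<in> sphere 0 1. norm (y - x) \<le> u}"
  let ?K = "{z \<in> cball 0 1 - {0}. z /\<^sub>R norm z \<in> ?B}"
  have V: "?V > 0" by (rule unit_ball_vol_pos) simp
  have B: "?B \<in> sets borel" by measurable
  have "emeasure lborel ?K \<le> ennreal (?V * 2 ^ (d + 2) * u ^ d)"
  proof (cases "u \<le> 1")
    case True
    define k where "k = nat \<lfloor>1 / u\<rfloor>"
    have k: "real k \<le> 1 / u" using u by (simp add: k_def)
    have sub: "?K \<subseteq> (\<Union>j\<le>k. cball ((real j * u) *\<^sub>R x) (2 * u))"
    proof
      fix z assume z: "z \<in> ?K"
      define t where "t = norm z"
      define j where "j = nat \<lfloor>t / u\<rfloor>"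
      have t: "0 < t" "t \<le> 1" and nz: "norm (z /\<^sub>R t - x) \<le> u" using z by (auto simp: t_def)
      have "t / u \<le> 1 / u" using t u by (simp add: divide_right_mono)
      then have jk: "j \<le> k" unfolding j_def k_def by (intro nat_mono floor_mono)
      have j: "real j \<le> t / u" "t / u < real j + 1" using t u unfolding j_def by (simp_all add: floor_less_iff le_floor_iff)
      have j': "real j * u \<le> t" "t < real j * u + u" using j u by (simp_all add: field_simps)
      have "norm (z - t *\<^sub>R x) = t * norm (z /\<^sub>R t - x)"
      proof -
        have "z - t *\<^sub>R x = t *\<^sub>R (z /\<^sub>R t - x)" using t by (simp add: algebra_simps)
        then show ?thesis using t by simp
      qed
      also have "\<dots> \<le> 1 * u" using t nz u by (intro mult_mono) auto
      finally have 1: "norm (z - t *\<^sub>R x) \<le> u" by simp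
      have "norm (t *\<^sub>R x - (real j * u) *\<^sub>R x) = \<bar>t - real j * u\<bar>"
        by (simp add: x scaleR_diff_left[symmetric])
      then have 2: "norm (t *\<^sub>R x - (real j * u) *\<^sub>R x) \<le> u" using j' by simp
      have "norm (z - (real j * u) *\<^sub>R x) \<le> 2 * u"
        using norm_triangle_ineq[of "z - t *\<^sub>R x" "t *\<^sub>R x - (real j * u) *\<^sub>R x"] 1 2 by simp
      then show "z \<in> (\<Union>j\<le>k. cball ((real j * u) *\<^sub>R x) (2 * u))"
        using jk by (auto simp: dist_norm norm_minus_commute)
    qed
    have "emeasure lborel ?K \<le> emeasure lborel (\<Union>j\<le>k. cball ((real j * u) *\<^sub>R x) (2 * u))"
      by (rule emeasure_mono[OF sub]) auto
    also have "\<dots> \<le> (\<Sum>j\<le>k. emeasure lborel (cball ((real j * u) *\<^sub>R x) (2 * u)))"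
      by (rule emeasure_subadditive_finite) auto
    also have "\<dots> = ennreal (real (Suc k) * (?V * (2 * u) ^ Suc d))"
      using u d V by (simp add: emeasure_cball ennreal_of_nat_eq_real_of_nat ennreal_mult'[symmetric] del: of_nat_Suc)
    \<comment> \<open>At most 2 / u balls are used, because u is at most 1.\<close>
    also have "\<dots> \<le> ennreal (?V * 2 ^ (d + 2) * u ^ d)"
    proof (rule ennreal_leI)
      have "1 \<le> 1 / u" using u True by simp
      then have "real (Suc k) \<le> 2 / u" using k by simp
      then have "real (Suc k) * (?V * (2 * u) ^ Suc d) \<le> 2 / u * (?V * (2 * u) ^ Suc d)"
        using u V by (intro mult_right_mono) auto
      also have "\<dots> = ?V * 2 ^ (d + 2) * u ^ d"
        using u by (simp add: power_mult_distrib)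
      finally show "real (Suc k) * (?V * (2 * u) ^ Suc d) \<le> ?V * 2 ^ (d + 2) * u ^ d" .
    qed
    finally show ?thesis .
  next
    case False
    \<comment> \<open>For u > 1 the whole unit ball is a good enough bound, as u^d exceeds 1.\<close>
    have "emeasure lborel ?K \<le> emeasure lborel (cball (0::'a) 1)"
      by (rule emeasure_mono) auto
    also have "\<dots> = ennreal (?V * 1)" by (simp add: emeasure_cball d)
    also have "\<dots> \<le> ennreal (?V * (2 ^ (d + 2) * u ^ d))"
    proof (intro ennreal_leI mult_left_mono)
      have "1 * 1 \<le> (2::real) ^ (d + 2) * u ^ d"
        using False by (intro mult_mono one_le_power) auto
      then show "1 \<le> (2::real) ^ (d + 2) * u ^ d" by simp
    qed (use V in auto)
    finally show ?thesis by (simp add: mult.assoc)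
  qed
  then have "of_nat (Suc d) * emeasure lborel ?K \<le> of_nat (Suc d) * ennreal (?V * 2 ^ (d + 2) * u ^ d)"
    by (rule mult_left_mono) simp
  also have "\<dots> = ennreal (real (Suc d) * (?V * 2 ^ (d + 2) * u ^ d))"
    by (subst ennreal_mult) (use V u in \<open>simp_all add: ennreal_of_nat_eq_real_of_nat del: of_nat_Suc\<close>)
  finally show ?thesis
    by (subst emeasure_sphere_measure) (use B d in \<open>auto simp: mult.assoc\<close>)
qed

text \<open>
  If the points enclose the angle 2 \<alpha> then their chord is 2 sin \<alpha>, and sin \<alpha> lies between
  \<alpha> / 2 and \<alpha> for \<alpha> up to pi / 2. So caps may be measured by chords, in which the
  covariances are expressed.
\<close>

lemma norm_diff_le_angular_dist:
  fixes x y :: "'a::euclidean_space"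
  assumes "norm x = 1" "norm y = 1"
  shows "norm (y - x) \<le> angular_dist y x" "angular_dist y x \<le> 2 * norm (y - x)"
proof -
  define \<alpha> where "\<alpha> = angular_dist y x / 2"
  have c: "\<bar>y \<bullet> x\<bar> \<le> 1" using Cauchy_Schwarz_ineq2[of y x] assms by simp
  have a: "0 \<le> \<alpha>" "\<alpha> \<le> pi / 2" unfolding \<alpha>_def angular_dist_def
    using c arccos_lbound[of "y \<bullet> x"] arccos_ubound[of "y \<bullet> x"] by (auto simp: abs_le_iff)
  have "cos (2 * \<alpha>) = y \<bullet> x" unfolding \<alpha>_def angular_dist_def using c by (simp add: cos_arccos_abs)
  then have yx: "y \<bullet> x = 1 - 2 * (sin \<alpha>)\<^sup>2" by (simp add: cos_double_sin)
  have "(norm (y - x))\<^sup>2 = (norm y)\<^sup>2 + (norm x)\<^sup>2 - 2 * (y \<bullet> x)"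
    by (simp add: power2_norm_eq_inner inner_diff inner_commute)
  also have "\<dots> = (2 * sin \<alpha>)\<^sup>2" using assms yx by (simp add: power2_eq_square)
  finally have n: "norm (y - x) = 2 * sin \<alpha>"
    proof (rule power2_eq_imp_eq)
    show "0 \<le> 2 * sin \<alpha>" using a sin_ge_zero[of \<alpha>] by simp
  qed auto
  show "norm (y - x) \<le> angular_dist y x"
    using n sin_x_le_x[of \<alpha>] a unfolding \<alpha>_def by simp
  have "\<bar>sin \<alpha> - \<alpha>\<bar> \<le> \<alpha> ^ 3 / 6"
  proof -
    have "(\<Sum>m<3. sin_coeff m * \<alpha> ^ m) = \<alpha>"
      by (simp add: numeral_3_eq_3 sin_coeff_def)
    moreover have "inverse (fact 3) = 1 / (6::real)" by (simp add: fact_numeral)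
    moreover have "\<bar>\<alpha>\<bar> = \<alpha>" using a by simp
    ultimately show ?thesis using Maclaurin_sin_bound[of \<alpha> 3] by (metis mult_1 times_divide_eq_left)
  qed
  then have s: "\<alpha> - \<alpha> ^ 3 / 6 \<le> sin \<alpha>" by linarith
  have "\<alpha> \<le> 1.6" using a pi_approx by simp
  then have "\<alpha> * \<alpha> \<le> 1.6 * 1.6" using a by (intro mult_mono) auto
  then have "\<alpha> * (\<alpha> * \<alpha>) \<le> \<alpha> * 3" using a by (intro mult_left_mono) auto
  then have "\<alpha> / 2 \<le> sin \<alpha>" using s by (simp add: power3_eq_cube)
  then show "angular_dist y x \<le> 2 * norm (y - x)" using n unfolding \<alpha>_def by simp
qed

text \<open>
  The cone over the cap contains disjoint balls of radius u / 8 strung along the part of its axis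
  between radii 1 / 2 and 3 / 4; there are about 1 / u of them.
\<close>

lemma emeasure_sphere_measure_cap_ge:
  fixes x :: "'a::euclidean_space"
  assumes d: "DIM('a) = Suc d" and x: "norm x = 1" and u: "0 < u" "u \<le> 1"
  shows "ennreal (unit_ball_vol (Suc d) / 8 ^ Suc d * u ^ d)
    \<le> emeasure sphere_measure {y \<in> sphere 0 1. norm (y - x) \<le> u}"
proof -
  let ?V = "unit_ball_vol (real (Suc d))"
  let ?B = "{y \<in> sphere 0 1. norm (y - x) \<le> u}"
  let ?K = "{z \<in> cball 0 1 - {0}. z /\<^sub>R norm z \<in> ?B}"
  have V: "?V > 0" by (rule unit_ball_vol_pos) simp
  have B: "?B \<in> sets borel" by measurable
  define \<rho> where "\<rho> = u / 8"
  define k where "k = nat \<lceil>1 / u\<rceil>"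
  define f where "f = (\<lambda>j. (1/2 + 2 * \<rho> * real j) *\<^sub>R x)"
  have \<rho>: "0 < \<rho>" "\<rho> \<le> 1/8" using u by (auto simp: \<rho>_def)
  have k1: "1 / u \<le> real k" unfolding k_def by linarith
  have k2: "real k < 1 / u + 1" unfolding k_def using u by (simp, linarith)
  have sub: "(\<Union>j<k. ball (f j) \<rho>) \<subseteq> ?K"
  proof
    fix z assume "z \<in> (\<Union>j<k. ball (f j) \<rho>)"
    then obtain j where j: "j < k" and "z \<in> ball (f j) \<rho>" by blast
    define t where "t = 1/2 + 2 * \<rho> * real j"
    have z: "norm (z - t *\<^sub>R x) < \<rho>" using \<open>z \<in> ball (f j) \<rho>\<close>
      by (simp add: f_def t_def dist_norm norm_minus_commute)
    have "real j < 1 / u" using j k2 by linarith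
    then have "2 * \<rho> * real j < 2 * \<rho> * (1 / u)" using \<rho> by (intro mult_strict_left_mono) auto
    also have "\<dots> = 1 / 4" using u by (simp add: \<rho>_def)
    finally have t: "1/2 \<le> t" "t \<le> 3/4" using \<rho> by (auto simp: t_def)
    have nt: "norm (t *\<^sub>R x) = t" using t x by simp
    have tz: "\<bar>norm z - t\<bar> \<le> norm (z - t *\<^sub>R x)" using norm_triangle_ineq3[of z "t *\<^sub>R x"] nt by simp
    have nz: "3/8 \<le> norm z" "norm z \<le> 7/8" using tz z \<rho> t by linarith+
    have z0: "z \<noteq> 0" using nz by auto
    \<comment> \<open>Projecting a ball radially onto the sphere expands distances by at most 1 / norm z.\<close>
    have "norm (z /\<^sub>R norm z - x) = norm (z - norm z *\<^sub>R x) / norm z"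
    proof -
      have "z /\<^sub>R norm z - x = (z - norm z *\<^sub>R x) /\<^sub>R norm z"
        using z0 by (simp add: algebra_simps)
      then show ?thesis by (simp add: divide_inverse mult.commute)
    qed
    also have "norm (z - norm z *\<^sub>R x) \<le> norm (z - t *\<^sub>R x) + norm (t *\<^sub>R x - norm z *\<^sub>R x)"
      using norm_triangle_ineq[of "z - t *\<^sub>R x" "t *\<^sub>R x - norm z *\<^sub>R x"] by simp
    also have "norm (t *\<^sub>R x - norm z *\<^sub>R x) = \<bar>norm z - t\<bar>"
      using x by (simp add: abs_minus_commute scaleR_diff_left[symmetric])
    also have "norm (z - t *\<^sub>R x) + \<bar>norm z - t\<bar> \<le> 2 * \<rho>" using tz z by simp
    finally have "norm (z /\<^sub>R norm z - x) \<le> 2 * \<rho> / norm z"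
      using nz by (simp add: divide_right_mono)
    also have "\<dots> \<le> 2 * \<rho> / (1/4)" using nz \<rho> by (intro divide_left_mono) auto
    also have "\<dots> = u" by (simp add: \<rho>_def)
    finally have zu: "norm (z /\<^sub>R norm z - x) \<le> u" .
    have "norm (z /\<^sub>R norm z) = 1" using z0 by simp
    then show "z \<in> ?K" using z0 nz(2) zu unfolding mem_Collect_eq mem_sphere_0 Diff_iff mem_cball_0 singleton_iff by linarith
  qed
  have disj: "disjoint_family_on (\<lambda>j. ball (f j) \<rho>) {..<k}"
  unfolding disjoint_family_on_def
  proof (intro ballI impI)
    fix i j :: nat assume "i \<noteq> j"
    have "f i - f j = (2 * \<rho> * (real i - real j)) *\<^sub>R x"
      by (simp add: f_def scaleR_diff_left[symmetric] right_diff_distrib)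
    then have "dist (f i) (f j) = 2 * \<rho> * \<bar>real i - real j\<bar>"
      using x \<rho> by (simp add: dist_norm abs_mult)
    also have "\<dots> \<ge> 2 * \<rho> * 1" using \<open>i \<noteq> j\<close> \<rho> by (intro mult_left_mono) auto
    finally have ge: "dist (f i) (f j) \<ge> 2 * \<rho>" by simp
    show "ball (f i) \<rho> \<inter> ball (f j) \<rho> = {}"
    proof (rule ccontr)
      assume "ball (f i) \<rho> \<inter> ball (f j) \<rho> \<noteq> {}"
      then obtain z where "dist (f i) z < \<rho>" "dist (f j) z < \<rho>" by auto
      then show False using ge dist_triangle2[of "f i" "f j" z] by linarith
    qed
  qed
  have "?V / 8 ^ Suc d * u ^ d = 1 / u * (?V * \<rho> ^ Suc d)"
    using u by (simp add: \<rho>_def field_simps power_divide)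
  also have "\<dots> \<le> real k * (?V * \<rho> ^ Suc d)"
    using k1 V \<rho> by (intro mult_right_mono) auto
  finally have "ennreal (?V / 8 ^ Suc d * u ^ d) \<le> ennreal (real k * (?V * \<rho> ^ Suc d))"
    by (rule ennreal_leI)
  also have "\<dots> = (\<Sum>j<k. emeasure lborel (ball (f j) \<rho>))"
    using \<rho> d V by (simp add: emeasure_ball ennreal_mult' ennreal_of_nat_eq_real_of_nat)
  also have "\<dots> = emeasure lborel (\<Union>j<k. ball (f j) \<rho>)"
    by (rule sum_emeasure) (use disj in auto)
  also have "\<dots> \<le> emeasure lborel ?K"
    by (rule emeasure_mono[OF sub]) (simp, measurable)
  also have "\<dots> \<le> of_nat (Suc d) * emeasure lborel ?K"
    using mult_right_mono[of "1::ennreal" "of_nat (Suc d)" "emeasure lborel ?K"] by simp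
  also have "\<dots> = emeasure sphere_measure ?B"
    by (subst emeasure_sphere_measure) (use B d in auto)
  finally show ?thesis .
qed

lemma finite_measure_sphere_measure: "finite_measure (sphere_measure :: 'a::euclidean_space measure)"
proof
  have "emeasure (sphere_measure :: 'a measure) (sphere 0 1) =
    of_nat DIM('a) * emeasure lborel {x::'a \<in> cball 0 1 - {0}. x /\<^sub>R norm x \<in> sphere 0 1}"
    by (rule emeasure_sphere_measure) auto
  also have "\<dots> \<le> of_nat DIM('a) * emeasure lborel (cball (0::'a) 1)"
    by (intro mult_left_mono emeasure_mono) auto
  also have "\<dots> < \<infinity>" by (simp add: emeasure_cball ennreal_mult_less_top of_nat_less_top)
  finally show "emeasure (sphere_measure :: 'a measure) (space sphere_measure) \<noteq> \<infinity>" by simp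
qed

lemma sphere_ball_subset_cap:
  fixes x :: "'a::euclidean_space"
  assumes "norm x = 1"
  shows "sphere_ball u x \<subseteq> {y \<in> sphere 0 1. norm (y - x) \<le> u}"
  using norm_diff_le_angular_dist(1)[OF assms] by (fastforce simp: sphere_ball_def)

lemma cap_subset_sphere_ball:
  fixes x :: "'a::euclidean_space"
  assumes "norm x = 1"
  shows "{y \<in> sphere 0 1. norm (y - x) \<le> u / 2} \<subseteq> sphere_ball u x"
  using norm_diff_le_angular_dist(2)[OF assms] by (fastforce simp: sphere_ball_def)

section \<open>Random measures from almost surely additive set functions\<close>

text \<open>
  The expansion in base 3 with digits 0 and 1. Unlike a binary expansion it determines its digits:
  its value is at least 1 or at most 1 / 2 according to the first digit.
\<close>

definition tern_code :: "(nat \<Rightarrow> bool) \<Rightarrow> real" where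
  "tern_code e = (\<Sum>j. of_bool (e j) / 3 ^ j)"

text \<open>
  Deletes the leading digit of an expansion in base 3.
\<close>

definition tern_shift :: "real \<Rightarrow> real" where
  "tern_shift x = 3 * (x - of_bool (1 \<le> x))"

lemma summable_tern_code: "summable (\<lambda>j. of_bool (e j) / 3 ^ j :: real)"
proof (rule summable_comparison_test')
  show "summable (\<lambda>j. (1/3) ^ j :: real)" by (rule summable_geometric) simp
qed (auto simp: power_divide)

lemma tern_code_bounds: "0 \<le> tern_code e" "tern_code e \<le> 3 / 2"
proof -
  show "0 \<le> tern_code e" unfolding tern_code_def by (intro suminf_nonneg summable_tern_code) auto
  have "tern_code e \<le> (\<Sum>j. (1/3) ^ j)" unfolding tern_code_def
    by (intro suminf_le summable_tern_code summable_geometric) (auto simp: power_divide)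
  then show "tern_code e \<le> 3 / 2" by (simp add: suminf_geometric)
qed

lemma tern_code_rec: "tern_code e = of_bool (e 0) + tern_code (\<lambda>j. e (Suc j)) / 3"
proof -
  have "tern_code e = of_bool (e 0) + (\<Sum>j. of_bool (e (Suc j)) / 3 ^ Suc j)"
    unfolding tern_code_def using suminf_split_head[OF summable_tern_code, of e] by simp
  also have "(\<Sum>j. of_bool (e (Suc j)) / 3 ^ Suc j) = tern_code (\<lambda>j. e (Suc j)) / 3"
    unfolding tern_code_def using suminf_divide[OF summable_tern_code, of "\<lambda>j. e (Suc j)" 3] by (simp add: mult.commute)
  finally show ?thesis .
qed

lemma tern_code_ge_1_iff: "1 \<le> tern_code e \<longleftrightarrow> e 0"
  using tern_code_rec[of e] tern_code_bounds[of "\<lambda>j. e (Suc j)"] by (cases "e 0") auto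

lemma tern_shift_code: "tern_shift (tern_code e) = tern_code (\<lambda>j. e (Suc j))"
  unfolding tern_shift_def tern_code_ge_1_iff by (subst tern_code_rec) simp

lemma tern_digit: "1 \<le> (tern_shift ^^ j) (tern_code e) \<longleftrightarrow> e j"
proof -
  have "(tern_shift ^^ j) (tern_code e) = tern_code (\<lambda>i. e (i + j))" for e
    by (induction j arbitrary: e) (simp_all add: tern_shift_code funpow_swap1)
  then show ?thesis by (simp add: tern_code_ge_1_iff)
qed

text \<open>
  A point x is recovered from the countably many answers to "is x in the ball of radius 1 / 2^m
  around c i?", where c runs through a dense sequence. These answers are the digits of \<phi> x, and
  \<psi> picks for each m the first centre that the digits declare close enough, and passes to the
  limit. Hence statements about measures on the real line transfer to more general spaces.
\<close>

lemma borel_embedding_real: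
  obtains \<phi> :: "'a::{banach, second_countable_topology} \<Rightarrow> real" and \<psi> :: "real \<Rightarrow> 'a"
  where "\<phi> \<in> borel_measurable borel" "\<psi> \<in> borel_measurable borel"
    "\<And>x. \<psi> (\<phi> x) = x" "\<And>x. \<phi> x \<in> {0..3/2}"
proof -
  obtain C :: "'a set" where C: "countable C" "\<And>X. open X \<Longrightarrow> X \<noteq> {} \<Longrightarrow> \<exists>d\<in>C. d \<in> X"
    by (rule countable_dense_setE) blast
  have "C \<noteq> {}" using C(2)[of UNIV] by auto
  define c where "c = from_nat_into C"
  have dense: "\<exists>i. dist x (c i) < e" if "e > 0" for x e
  proof -
    have "\<exists>y\<in>C. y \<in> ball x e" by (rule C(2)) (use that in auto)
    then obtain y where "y \<in> C" "y \<in> ball x e" by blast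
    moreover obtain i where "c i = y"
      using from_nat_into_surj[OF C(1) \<open>y \<in> C\<close>] by (auto simp: c_def)
    ultimately show ?thesis by auto
  qed
  define E where "E = (\<lambda>x j. dist x (c (fst (prod_decode j))) < 1 / 2 ^ snd (prod_decode j))"
  define \<phi> where "\<phi> = (\<lambda>x. tern_code (E x))"
  define \<psi> where "\<psi> = (\<lambda>z. lim (\<lambda>m. c (LEAST i. 1 \<le> (tern_shift ^^ prod_encode (i, m)) z)))"
  have [measurable]: "tern_shift \<in> borel_measurable borel"
    unfolding tern_shift_def of_bool_def by measurable
  have [measurable]: "(tern_shift ^^ j) \<in> borel_measurable borel" for j
    by (induction j) (auto simp: id_def)
  have 1: "\<phi> \<in> borel_measurable borel"
    unfolding \<phi>_def tern_code_def E_def of_bool_def by measurable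
  have 2: "\<psi> \<in> borel_measurable borel" unfolding \<psi>_def by measurable
  have 3: "\<psi> (\<phi> x) = x" for x
  proof -
    define i where "i m = (LEAST i. dist x (c i) < 1 / 2 ^ m)" for m :: nat
    have i: "dist x (c (i m)) < 1 / 2 ^ m" for m
      unfolding i_def by (rule LeastI_ex) (use dense[of "1 / 2 ^ m"] in auto)
    have "\<psi> (\<phi> x) = lim (\<lambda>m. c (i m))"
      unfolding \<psi>_def \<phi>_def tern_digit i_def E_def by simp
    moreover have "(\<lambda>m. c (i m)) \<longlonglongrightarrow> x"
    proof (rule metric_tendsto_imp_tendsto)
      show "(\<lambda>m. (1/2) ^ m :: real) \<longlonglongrightarrow> 0" by (rule LIMSEQ_realpow_zero) auto
      show "\<forall>\<^sub>F m in sequentially. dist (c (i m)) x \<le> dist ((1 / 2) ^ m :: real) 0"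
        using i by (auto simp: dist_commute power_divide intro!: always_eventually less_imp_le)
    qed
    ultimately show ?thesis by (simp add: limI)
  qed
  have 4: "\<phi> x \<in> {0..3/2}" for x using tern_code_bounds[of "E x"] by (simp add: \<phi>_def)
  show ?thesis by (rule that[OF 1 2 3 4])
qed

text \<open>
  Almost sure identities between random variables are obtained below from an inequality in one
  direction and the equality of the means.
\<close>

lemma AE_eq_of_nn_integral_le:
  assumes [measurable]: "f \<in> borel_measurable M" "g \<in> borel_measurable M"
    and le: "AE x in M. g x \<le> f x" and int: "(\<integral>\<^sup>+x. f x \<partial>M) \<le> (\<integral>\<^sup>+x. g x \<partial>M)"
    and fin: "(\<integral>\<^sup>+x. g x \<partial>M) \<noteq> \<infinity>"
  shows "AE x in M. f x = (g x :: ennreal)"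
proof -
  have "(\<integral>\<^sup>+x. f x - g x \<partial>M) = (\<integral>\<^sup>+x. f x \<partial>M) - (\<integral>\<^sup>+x. g x \<partial>M)"
    by (rule nn_integral_diff) (use le fin in auto)
  also have "\<dots> = 0" using int fin le_less_trans[OF int] by (simp add: diff_eq_0_iff_ennreal less_top)
  finally have "AE x in M. f x - g x = 0" by (subst (asm) nn_integral_0_iff_AE) auto
  with le show ?thesis
    by eventually_elim (auto simp: diff_eq_0_iff_ennreal)
qed

text \<open>
  For each Borel set separately, a martingale limit is determined only up to a null set that
  depends on the set. Additivity then holds almost surely for each fixed pair of sets, which is
  what this locale records.
\<close>

locale random_set_function = prob_space M for M :: "'w measure" +
  fixes N :: "'a measure" and Y :: "'a set \<Rightarrow> 'w \<Rightarrow> real"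
  assumes finite_N: "finite_measure N"
    and Y_meas [measurable]: "A \<in> sets N \<Longrightarrow> Y A \<in> borel_measurable M"
    and Y_nonneg: "A \<in> sets N \<Longrightarrow> AE \<omega> in M. 0 \<le> Y A \<omega>"
    and Y_add: "A \<in> sets N \<Longrightarrow> B \<in> sets N \<Longrightarrow> A \<inter> B = {} \<Longrightarrow>
      AE \<omega> in M. Y (A \<union> B) \<omega> = Y A \<omega> + Y B \<omega>"
    and Y_mean: "A \<in> sets N \<Longrightarrow> (\<integral>\<^sup>+\<omega>. Y A \<omega> \<partial>M) = emeasure N A"
begin

lemma Y_null:
  assumes [measurable]: "A \<in> sets N" and "emeasure N A = 0"
  shows "AE \<omega> in M. Y A \<omega> = 0"
proof -
  have "(\<integral>\<^sup>+\<omega>. Y A \<omega> \<partial>M) = 0" using assms Y_mean by simp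
  then have "AE \<omega> in M. ennreal (Y A \<omega>) = 0" by (subst (asm) nn_integral_0_iff_AE) auto
  with Y_nonneg[OF assms(1)] show ?thesis by eventually_elim auto
qed

lemma Y_mono:
  assumes "A \<in> sets N" "B \<in> sets N" "A \<subseteq> B"
  shows "AE \<omega> in M. Y A \<omega> \<le> Y B \<omega>"
proof -
  have "A \<union> (B - A) = B" using assms by auto
  then show ?thesis
    using Y_add[of A "B - A"] Y_nonneg[of "B - A"] assms by auto
qed

text \<open>
  Finite additivity bounds every partial sum by the value at the union; both sides have the same
  mean because N is countably additive, so the inequality is an equality.
\<close>

lemma Y_suminf:
  assumes A: "\<And>i::nat. A i \<in> sets N" and disj: "disjoint_family A"
  shows "AE \<omega> in M. ennreal (Y (\<Union>i. A i) \<omega>) = (\<Sum>i. ennreal (Y (A i) \<omega>))"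
proof (rule AE_eq_of_nn_integral_le)
  note [measurable] = A
  show "(\<lambda>\<omega>. ennreal (Y (\<Union>i. A i) \<omega>)) \<in> borel_measurable M" by measurable
  show "(\<lambda>\<omega>. \<Sum>i. ennreal (Y (A i) \<omega>)) \<in> borel_measurable M" by measurable
  have U: "(\<Union>i. A i) \<in> sets N" by measurable
  have int: "(\<integral>\<^sup>+\<omega>. (\<Sum>i. ennreal (Y (A i) \<omega>)) \<partial>M) = emeasure N (\<Union>i. A i)"
    by (subst nn_integral_suminf) (use A disj in \<open>auto simp: Y_mean suminf_emeasure intro!: suminf_emeasure\<close>)
  then show "(\<integral>\<^sup>+\<omega>. ennreal (Y (\<Union>i. A i) \<omega>) \<partial>M) \<le> (\<integral>\<^sup>+\<omega>. (\<Sum>i. ennreal (Y (A i) \<omega>)) \<partial>M)"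
    using Y_mean[OF U] by simp
  show "(\<integral>\<^sup>+\<omega>. (\<Sum>i. ennreal (Y (A i) \<omega>)) \<partial>M) \<noteq> \<infinity>"
    unfolding int using finite_measure.emeasure_finite[OF finite_N] by simp
  have fin: "AE \<omega> in M. Y (\<Union>i<n. A i) \<omega> = (\<Sum>i<n. Y (A i) \<omega>)" for n
  proof (induction n)
    case 0
    then show ?case using Y_null[of "{}"] by simp
  next
    case (Suc n)
    have eq: "(\<Union>i<Suc n. A i) = (\<Union>i<n. A i) \<union> A n" by (auto simp: less_Suc_eq)
    have "(\<Union>i<n. A i) \<inter> A n = {}" 
      using disj unfolding disjoint_family_on_def by (auto simp: set_eq_iff dest!: less_imp_neq)
    then have "AE \<omega> in M. Y ((\<Union>i<n. A i) \<union> A n) \<omega> = Y (\<Union>i<n. A i) \<omega> + Y (A n) \<omega>"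
      by (intro Y_add) auto
    with Suc show ?case unfolding eq by eventually_elim simp
  qed
  have nn: "AE \<omega> in M. \<forall>i. 0 \<le> Y (A i) \<omega>" using Y_nonneg[OF A] by (simp add: AE_all_countable)
  have "AE \<omega> in M. \<forall>n. Y (\<Union>i<n. A i) \<omega> \<le> Y (\<Union>i. A i) \<omega>"
    unfolding AE_all_countable by (intro allI Y_mono) auto
  moreover have "AE \<omega> in M. \<forall>n. Y (\<Union>i<n. A i) \<omega> = (\<Sum>i<n. Y (A i) \<omega>)"
    using fin by (simp add: AE_all_countable)
  ultimately show "AE \<omega> in M. (\<Sum>i. ennreal (Y (A i) \<omega>)) \<le> ennreal (Y (\<Union>i. A i) \<omega>)"
    using nn
  proof eventually_elim
    case (elim \<omega>)
    show ?case
    proof (rule suminf_le_const)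
      fix n
      have "(\<Sum>i<n. ennreal (Y (A i) \<omega>)) = ennreal (\<Sum>i<n. Y (A i) \<omega>)"
        using elim by (simp add: sum_ennreal)
      also have "\<dots> \<le> ennreal (Y (\<Union>i. A i) \<omega>)" using elim by (intro ennreal_leI) metis
      finally show "(\<Sum>i<n. ennreal (Y (A i) \<omega>)) \<le> ennreal (Y (\<Union>i. A i) \<omega>)" .
    qed simp
  qed
qed

end

text \<open>
  On the real line a measure is a distribution function. The values on the countably many half-lines
  with rational end points are simultaneously monotone outside one null set; their right-continuous
  envelope F is the distribution function of \<nu>. The means show that no mass is lost in
  passing to the envelope, first on half-lines and then, by Dynkin's argument, on all Borel sets.
\<close>

lemma regular_version_real:
  fixes N :: "real measure" and Y :: "real set \<Rightarrow> 'w \<Rightarrow> real"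
  assumes "random_set_function M N Y"
    and setsN: "sets N = sets borel" and conc: "emeasure N (- {0..2}) = 0"
  obtains \<nu> where "\<And>\<omega>. sets (\<nu> \<omega>) = sets borel" "\<And>\<omega>. finite_measure (\<nu> \<omega>)"
    "\<And>A. A \<in> sets borel \<Longrightarrow> (\<lambda>\<omega>. measure (\<nu> \<omega>) A) \<in> borel_measurable M"
    "\<And>A. A \<in> sets borel \<Longrightarrow> AE \<omega> in M. measure (\<nu> \<omega>) A = Y A \<omega>"
proof -
  interpret random_set_function M N Y by fact
  interpret N: finite_measure N by (rule finite_N)
  have spN: "space N = UNIV" using sets_eq_imp_space_eq[OF setsN] by simp
  have null: "emeasure N A = 0" if "A \<in> sets borel" "A \<inter> {0..2} = {}" for A
  proof -
    have "emeasure N A \<le> emeasure N (- {0..2})" by (rule emeasure_mono) (use that in \<open>auto simp: setsN\<close>)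
    then show ?thesis using conc by simp
  qed
  have [measurable]: "Y {..x} \<in> borel_measurable M" for x by (intro Y_meas) (simp add: setsN)
  define good where "good = (\<lambda>\<omega>. \<forall>q q'::rat. (q \<le> q' \<longrightarrow> Y {..of_rat q} \<omega> \<le> Y {..of_rat q'} \<omega>) \<and>
    (q < 0 \<longrightarrow> Y {..of_rat q} \<omega> = 0) \<and> (2 \<le> q \<longrightarrow> Y {..of_rat q} \<omega> = Y {..2} \<omega>))"
  have [measurable]: "Measurable.pred M good" unfolding good_def by measurable
  \<comment> \<open>Off the good event the measure is set to 0, which keeps everything measurable.\<close>
  define G where "G = (\<lambda>\<omega> q. if good \<omega> then Y {..of_rat q} \<omega> else 0)"
  have G_meas [measurable]: "(\<lambda>\<omega>. G \<omega> q) \<in> borel_measurable M" for q unfolding G_def by measurable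
  have good: "AE \<omega> in M. good \<omega>"
    unfolding good_def AE_all_countable
  proof (intro allI AE_conjI AE_impI)
    fix q q' :: rat
    show "AE \<omega> in M. Y {..of_rat q} \<omega> \<le> Y {..of_rat q'} \<omega>" if "q \<le> q'"
      by (rule Y_mono) (use that in \<open>auto simp: setsN of_rat_less_eq intro: order_trans\<close>)
    show "AE \<omega> in M. Y {..of_rat q} \<omega> = 0" if "q < 0"
    proof (rule Y_null)
      have "(of_rat q :: real) < 0" using that by simp
      then show "emeasure N {..of_rat q} = 0"
        by (intro null) (auto simp del: of_rat_less_0_iff)
    qed (simp add: setsN)
    show "AE \<omega> in M. Y {..of_rat q} \<omega> = Y {..2} \<omega>" if "2 \<le> q"
    proof -
      have q2: "(2::real) \<le> of_rat q" using that of_rat_less_eq[of 2 q, where 'a=real] by simp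
      have "emeasure N {2<..of_rat q} = 0"
        by (intro null) auto
      then have "AE \<omega> in M. Y {2<..of_rat q} \<omega> = 0" by (intro Y_null) (simp add: setsN)
      moreover have "AE \<omega> in M. Y ({..2} \<union> {2<..of_rat q}) \<omega> = Y {..2} \<omega> + Y {2<..of_rat q} \<omega>"
        by (rule Y_add) (auto simp: setsN)
      moreover have "{..2} \<union> {2<..of_rat q} = {..of_rat q :: real}" using q2 by auto
      ultimately show ?thesis by auto
    qed
  qed
  have G_mono: "G \<omega> q \<le> G \<omega> q'" if "q \<le> q'" for \<omega> q q' using that by (auto simp: G_def good_def)
  have G_neg: "G \<omega> q = 0" if "q < 0" for \<omega> q using that by (auto simp: G_def good_def)
  have G_top: "G \<omega> q = G \<omega> 2" if "2 \<le> q" for \<omega> q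
    using that by (auto simp: G_def good_def)
  have G_nonneg: "0 \<le> G \<omega> q" for \<omega> q
    using G_mono[of "min q (-1)" q \<omega>] G_neg[of "min q (-1)" \<omega>] by simp
  define F where "F = (\<lambda>\<omega> (x::real). INF q\<in>{q::rat. x < of_rat q}. G \<omega> q)"
  have ne: "{q::rat. x < of_rat q} \<noteq> {}" for x :: real
    using of_rat_dense[of x "x + 1"] by auto
  have bdd: "bdd_below (G \<omega> ` S)" for \<omega> S by (rule bdd_belowI2[where m=0]) (rule G_nonneg)
  have F_less: "F \<omega> x < a \<longleftrightarrow> (\<exists>q. x < of_rat q \<and> G \<omega> q < a)" for \<omega> x a
    unfolding F_def using cInf_less_iff[OF _ bdd[of \<omega> "{q. x < of_rat q}"], of a] ne[of x] by auto
  have F_le: "F \<omega> x \<le> G \<omega> q" if "x < of_rat q" for \<omega> x q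
    unfolding F_def by (rule cINF_lower[OF bdd]) (use that in auto)
  have F_ge: "a \<le> F \<omega> x" if "\<And>q. x < of_rat q \<Longrightarrow> a \<le> G \<omega> q" for \<omega> x a
    unfolding F_def by (rule cINF_greatest[OF ne]) (use that in auto)
  have F_nonneg: "0 \<le> F \<omega> x" for \<omega> x by (rule F_ge) (rule G_nonneg)
  have F_mono: "F \<omega> x \<le> F \<omega> y" if "x \<le> y" for \<omega> x y
    by (rule F_ge) (use that F_le in fastforce)
  have F_cont: "continuous (at_right x) (F \<omega>)" for \<omega> x
  proof (subst continuous_at_right_real_increasing)
    show "\<forall>\<epsilon>>0. \<exists>\<delta>>0. F \<omega> (x + \<delta>) - F \<omega> x < \<epsilon>"
    proof (intro allI impI)
      fix \<epsilon> :: real assume "0 < \<epsilon>"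
      then have "F \<omega> x < F \<omega> x + \<epsilon>" by simp
      then obtain q where q: "x < of_rat q" "G \<omega> q < F \<omega> x + \<epsilon>" unfolding F_less by blast
      define \<delta> where "\<delta> = (of_rat q - x) / 2"
      have "F \<omega> (x + \<delta>) \<le> G \<omega> q" by (rule F_le) (use q in \<open>simp add: \<delta>_def field_simps\<close>)
      then show "\<exists>\<delta>>0. F \<omega> (x + \<delta>) - F \<omega> x < \<epsilon>"
        using q by (intro exI[of _ \<delta>]) (auto simp: \<delta>_def)
    qed
  qed (rule F_mono)
  have F_bot: "(F \<omega> \<longlongrightarrow> 0) at_bot" for \<omega>
  proof (rule tendsto_eventually)
    have "F \<omega> x = 0" if "x \<le> -1" for x
    proof -
      have "F \<omega> x \<le> G \<omega> (-1/2)" by (rule F_le) (use that in \<open>simp add: of_rat_minus of_rat_divide\<close>)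
      then show ?thesis using F_nonneg[of \<omega> x] G_neg[of "-1/2" \<omega>] by simp
    qed
    then show "\<forall>\<^sub>F x in at_bot. F \<omega> x = 0" unfolding eventually_at_bot_linorder by blast
  qed
  have F_eq_top: "F \<omega> x = G \<omega> 2" if "2 \<le> x" for \<omega> x
  proof (rule antisym)
    obtain q where q: "x < of_rat q" using ne[of x] by auto
    then have "(2::real) \<le> of_rat q" using that by simp
    then have "2 \<le> q" using of_rat_less_eq[of 2 q, where 'a=real] by simp
    then show "F \<omega> x \<le> G \<omega> 2" using F_le[OF q, of \<omega>] G_top[of q \<omega>] by simp
    show "G \<omega> 2 \<le> F \<omega> x"
    proof (rule F_ge)
      fix q :: rat assume "x < of_rat q"
      then have "(2::real) \<le> of_rat q" using that by simp
      then have "2 \<le> q" using of_rat_less_eq[of 2 q, where 'a=real] by simp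
      then show "G \<omega> 2 \<le> G \<omega> q" using G_top[of q \<omega>] by simp
    qed
  qed
  have F_top: "(F \<omega> \<longlongrightarrow> G \<omega> 2) at_top" for \<omega>
    by (rule tendsto_eventually) (use F_eq_top in \<open>auto simp: eventually_at_top_linorder\<close>)
  have F_meas [measurable]: "(\<lambda>\<omega>. F \<omega> x) \<in> borel_measurable M" for x
    unfolding borel_measurable_iff_less F_less by measurable
  \<comment> \<open>By monotonicity F is at least Y, and its mean is at most that of Y by continuity of N from above.\<close>
  have F_eq: "AE \<omega> in M. F \<omega> x = Y {..x} \<omega>" for x
  proof -
    have "AE \<omega> in M. ennreal (F \<omega> x) = ennreal (Y {..x} \<omega>)"
    proof (rule AE_eq_of_nn_integral_le)
      have "AE \<omega> in M. \<forall>q::rat. x < of_rat q \<longrightarrow> Y {..x} \<omega> \<le> Y {..of_rat q} \<omega>"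
        unfolding AE_all_countable
        by (intro allI AE_impI Y_mono) (auto simp: setsN)
      then show "AE \<omega> in M. ennreal (Y {..x} \<omega>) \<le> ennreal (F \<omega> x)"
        using good by eventually_elim (auto intro!: ennreal_leI F_ge simp: G_def)
      have bnd: "(\<integral>\<^sup>+\<omega>. ennreal (F \<omega> x) \<partial>M) \<le> emeasure N {..x + 1 / Suc n}" for n
      proof -
        obtain q where q: "x < of_rat q" "of_rat q < x + 1 / Suc n" using of_rat_dense[of x "x + 1 / Suc n"] by auto
        have "(\<integral>\<^sup>+\<omega>. ennreal (F \<omega> x) \<partial>M) \<le> (\<integral>\<^sup>+\<omega>. ennreal (Y {..of_rat q} \<omega>) \<partial>M)"
        proof (rule nn_integral_mono_AE, use good in eventually_elim)
          fix \<omega> assume "good \<omega>"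
          then show "ennreal (F \<omega> x) \<le> ennreal (Y {..of_rat q} \<omega>)"
            using F_le[OF q(1), of \<omega>] by (intro ennreal_leI) (simp add: G_def)
        qed
        also have "\<dots> = emeasure N {..of_rat q}" by (rule Y_mean) (simp add: setsN)
        also have "\<dots> \<le> emeasure N {..x + 1 / Suc n}" by (rule emeasure_mono) (use q in \<open>auto simp: setsN\<close>)
        finally show ?thesis .
      qed
      have lim: "(\<lambda>n. emeasure N {..x + 1 / Suc n}) \<longlonglongrightarrow> emeasure N (\<Inter>n. {..x + 1 / Suc n})"
      proof (rule Lim_emeasure_decseq)
        show "decseq (\<lambda>n. {..x + 1 / Suc n})"
          by (rule decseq_SucI) (auto simp: field_simps intro: order_trans)
      qed (auto simp: setsN N.emeasure_finite)
      have eq: "(\<Inter>n. {..x + 1 / Suc n}) = {..x}"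
      proof (auto simp: not_le[symmetric], rule ccontr)
        fix y assume *: "\<forall>n. y \<le> x + 1 / (1 + real n)" and "\<not> y \<le> x"
        then obtain n where "1 / real (Suc n) < y - x" using nat_approx_posE[of "y - x"] by auto
        then show False using *[rule_format, of n] by simp
      qed (auto intro: add_increasing2)
      have "(\<integral>\<^sup>+\<omega>. ennreal (F \<omega> x) \<partial>M) \<le> emeasure N {..x}"
        unfolding eq[symmetric] by (rule LIMSEQ_le_const[OF lim]) (use bnd in blast)
      then show "(\<integral>\<^sup>+\<omega>. ennreal (F \<omega> x) \<partial>M) \<le> (\<integral>\<^sup>+\<omega>. ennreal (Y {..x} \<omega>) \<partial>M)"
        by (subst Y_mean) (auto simp: setsN)
      show "(\<integral>\<^sup>+\<omega>. ennreal (Y {..x} \<omega>) \<partial>M) \<noteq> \<infinity>"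
        by (subst Y_mean) (auto simp: setsN N.emeasure_finite)
    qed auto
    moreover have "AE \<omega> in M. 0 \<le> Y {..x} \<omega>" by (rule Y_nonneg) (simp add: setsN)
    ultimately show ?thesis by eventually_elim (simp add: F_nonneg)
  qed
  define \<nu> where "\<nu> = (\<lambda>\<omega>. interval_measure (F \<omega>))"
  have sets_\<nu>: "sets (\<nu> \<omega>) = sets borel" for \<omega> by (simp add: \<nu>_def)
  have fin_\<nu>: "finite_measure (\<nu> \<omega>)" for \<omega>
    unfolding \<nu>_def using finite_borel_measure_interval_measure[OF F_mono F_cont F_bot F_top G_nonneg]
    by (simp add: finite_borel_measure_def)
  have \<nu>_Iic: "measure (\<nu> \<omega>) {..x} = F \<omega> x" for \<omega> x
    unfolding \<nu>_def by (rule measure_interval_measure_Iic[OF F_mono F_cont F_bot])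
  have \<nu>_UNIV: "measure (\<nu> \<omega>) UNIV = G \<omega> 2" for \<omega>
    unfolding \<nu>_def measure_def using interval_measure_UNIV[OF F_mono F_cont F_bot F_top G_nonneg] G_nonneg by simp
  have UNIV_eq: "AE \<omega> in M. measure (\<nu> \<omega>) UNIV = Y UNIV \<omega>"
  proof -
    have "emeasure N {2<..} = 0"
      by (intro null) auto
    then have "AE \<omega> in M. Y {2<..} \<omega> = 0" by (intro Y_null) (simp add: setsN)
    moreover have "AE \<omega> in M. Y ({..2} \<union> {2<..}) \<omega> = Y {..2} \<omega> + Y {2<..} \<omega>"
      by (rule Y_add) (auto simp: setsN)
    moreover have "{..2} \<union> {2<..} = (UNIV :: real set)" by auto
    ultimately show ?thesis using good by (auto simp: \<nu>_UNIV G_def)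
  qed
  have *: "(\<lambda>\<omega>. measure (\<nu> \<omega>) A) \<in> borel_measurable M \<and> (AE \<omega> in M. measure (\<nu> \<omega>) A = Y A \<omega>)"
    if "A \<in> sets borel" for A
  proof -
    have "Int_stable (range (\<lambda>a. {..a::real}))"
      by (auto simp: Int_stable_def intro: exI[of _ "min _ _"])
    moreover have "range (\<lambda>a. {..a::real}) \<subseteq> Pow UNIV" by simp
    moreover have "A \<in> sigma_sets UNIV (range (\<lambda>a. {..a::real}))"
      using that by (simp add: borel_eq_atMost)
    ultimately show ?thesis
    proof (induction rule: sigma_sets_induct_disjoint)
      case (basic A)
      then obtain x where "A = {..x}" by auto
      then show ?case using F_eq[of x] by (simp add: \<nu>_Iic)
    next
      case empty
      show ?case using Y_null[of "{}"] by simp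
    next
      case (compl A)
      then have A: "A \<in> sets borel" by (simp add: borel_eq_atMost)
      have eq: "measure (\<nu> \<omega>) (UNIV - A) = measure (\<nu> \<omega>) UNIV - measure (\<nu> \<omega>) A" for \<omega>
        using finite_measure.finite_measure_compl[OF fin_\<nu>, of A \<omega>] A sets_eq_imp_space_eq[OF sets_\<nu>[of \<omega>]]
        by (simp add: sets_\<nu>)
      have "AE \<omega> in M. Y (A \<union> (UNIV - A)) \<omega> = Y A \<omega> + Y (UNIV - A) \<omega>"
        using A by (intro Y_add) (auto simp: setsN)
      then have "AE \<omega> in M. measure (\<nu> \<omega>) (UNIV - A) = Y (UNIV - A) \<omega>"
        using compl.IH[THEN conjunct2] UNIV_eq by eventually_elim (simp add: eq)
      moreover have "(\<lambda>\<omega>. measure (\<nu> \<omega>) (UNIV - A)) \<in> borel_measurable M"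
        unfolding eq \<nu>_UNIV using compl.IH by (intro borel_measurable_diff G_meas) blast
      ultimately show ?case by simp
    next
      case (union A)
      then have A: "A i \<in> sets borel" for i by (auto simp: borel_eq_atMost)
      have sm: "(\<lambda>i. measure (\<nu> \<omega>) (A i)) sums measure (\<nu> \<omega>) (\<Union>i. A i)" for \<omega>
        by (rule finite_measure.finite_measure_UNION[OF fin_\<nu>]) (use A union in \<open>auto simp: sets_\<nu>\<close>)
      have eq: "measure (\<nu> \<omega>) (\<Union>i. A i) = (\<Sum>i. measure (\<nu> \<omega>) (A i))" for \<omega>
        using sm[of \<omega>] by (simp add: sums_iff)
      have "AE \<omega> in M. \<forall>i. measure (\<nu> \<omega>) (A i) = Y (A i) \<omega>"
        unfolding AE_all_countable using union.IH by blast
      moreover have "AE \<omega> in M. ennreal (Y (\<Union>i. A i) \<omega>) = (\<Sum>i. ennreal (Y (A i) \<omega>))"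
        by (rule Y_suminf) (use A union in \<open>auto simp: setsN\<close>)
      moreover have "AE \<omega> in M. 0 \<le> Y (\<Union>i. A i) \<omega>"
        by (rule Y_nonneg) (use A in \<open>auto simp: setsN\<close>)
      ultimately have "AE \<omega> in M. measure (\<nu> \<omega>) (\<Union>i. A i) = Y (\<Union>i. A i) \<omega>"
      proof eventually_elim
        case (elim \<omega>)
        have "ennreal (Y (\<Union>i. A i) \<omega>) = (\<Sum>i. ennreal (measure (\<nu> \<omega>) (A i)))" using elim by simp
        also have "\<dots> = ennreal (measure (\<nu> \<omega>) (\<Union>i. A i))"
          unfolding eq using sm[of \<omega>] by (intro suminf_ennreal2) (auto simp: sums_iff)
        finally show ?case using elim by simp
      qed
      moreover have "(\<lambda>\<omega>. measure (\<nu> \<omega>) (\<Union>i. A i)) \<in> borel_measurable M"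
        unfolding eq using union.IH by (intro borel_measurable_suminf) auto
      ultimately show ?case by blast
    qed
  qed
  show ?thesis by (rule that[of \<nu>]) (use sets_\<nu> fin_\<nu> * in auto)
qed

text \<open>
  Transport along an embedding \<phi> into the real line. Since \<psi> inverts \<phi>, the preimage under
  \<phi> of the \<psi>-preimage of a subset A of S is A again, so the image of \<nu> under \<psi>
  has the right values without any statement on where \<nu> is concentrated.
\<close>

lemma regular_version:
  fixes N :: "'a::{banach, second_countable_topology} measure" and Y :: "'a set \<Rightarrow> 'w \<Rightarrow> real"
  assumes "random_set_function M N Y"
    and setsN: "sets N = sets (restrict_space borel S)" and S: "S \<in> sets borel" "S \<noteq> {}"
  obtains \<mu> where "\<And>\<omega>. sets (\<mu> \<omega>) = sets N" "\<And>\<omega>. finite_measure (\<mu> \<omega>)"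
    "\<And>A. A \<in> sets N \<Longrightarrow> (\<lambda>\<omega>. measure (\<mu> \<omega>) A) \<in> borel_measurable M"
    "\<And>A. A \<in> sets N \<Longrightarrow> AE \<omega> in M. measure (\<mu> \<omega>) A = Y A \<omega>"
proof -
  interpret random_set_function M N Y by fact
  interpret N: finite_measure N by (rule finite_N)
  have spN: "space N = S" using sets_eq_imp_space_eq[OF setsN] by (simp add: space_restrict_space)
  obtain \<phi> :: "'a \<Rightarrow> real" and \<psi> :: "real \<Rightarrow> 'a" where
    [measurable]: "\<phi> \<in> borel_measurable borel" "\<psi> \<in> borel_measurable borel"
    and inv: "\<And>x. \<psi> (\<phi> x) = x" and rng: "\<And>x. \<phi> x \<in> {0..3/2}"
    by (rule borel_embedding_real) blast
  have \<phi>N [measurable]: "\<phi> \<in> borel_measurable N"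
    unfolding measurable_cong_sets[OF setsN refl] by (rule measurable_restrict_space1) simp
  define Z where "Z = (\<lambda>A. Y (\<phi> -` A \<inter> S))"
  have pre: "\<phi> -` A \<inter> S \<in> sets N" if "A \<in> sets borel" for A
    using measurable_sets[OF \<phi>N that] by (simp add: spN)
  have Z: "random_set_function M (distr N borel \<phi>) Z"
  proof (intro random_set_function.intro random_set_function_axioms.intro)
    show "prob_space M" by (rule prob_space_axioms)
    show "finite_measure (distr N borel \<phi>)" by (rule N.finite_measure_distr[OF \<phi>N])
    fix A assume "A \<in> sets (distr N borel \<phi>)"
    then have A: "A \<in> sets borel" by simp
    show "Z A \<in> borel_measurable M" unfolding Z_def using pre[OF A] by (rule Y_meas)
    show "AE \<omega> in M. 0 \<le> Z A \<omega>" unfolding Z_def using pre[OF A] by (rule Y_nonneg)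
    show "(\<integral>\<^sup>+\<omega>. ennreal (Z A \<omega>) \<partial>M) = emeasure (distr N borel \<phi>) A"
      unfolding Z_def using A pre[OF A] by (subst Y_mean) (auto simp: emeasure_distr spN)
    fix B assume "B \<in> sets (distr N borel \<phi>)" and AB: "A \<inter> B = {}"
    then have B: "B \<in> sets borel" by simp
    have "\<phi> -` (A \<union> B) \<inter> S = (\<phi> -` A \<inter> S) \<union> (\<phi> -` B \<inter> S)" by auto
    then show "AE \<omega> in M. Z (A \<union> B) \<omega> = Z A \<omega> + Z B \<omega>"
      unfolding Z_def using Y_add[OF pre[OF A] pre[OF B]] AB by auto
  qed
  have Z0: "emeasure (distr N borel \<phi>) (- {0..2}) = 0"
  proof -
    have "\<phi> -` (- {0..2}) \<inter> space N = {}" using rng by fastforce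
    then show ?thesis by (subst emeasure_distr) auto
  qed
  obtain \<nu> where \<nu>: "\<And>\<omega>. sets (\<nu> \<omega>) = sets borel" "\<And>\<omega>. finite_measure (\<nu> \<omega>)"
    "\<And>A. A \<in> sets borel \<Longrightarrow> (\<lambda>\<omega>. measure (\<nu> \<omega>) A) \<in> borel_measurable M"
    "\<And>A. A \<in> sets borel \<Longrightarrow> AE \<omega> in M. measure (\<nu> \<omega>) A = Z A \<omega>"
    by (rule regular_version_real[OF Z sets_distr Z0]) blast
  \<comment> \<open>A default value for the points that are mapped outside S.\<close>
  obtain e where e: "e \<in> S" using S by auto
  define \<pi> where "\<pi> = (\<lambda>z. if \<psi> z \<in> S then \<psi> z else e)"
  have \<pi>_meas: "\<pi> \<in> borel \<rightarrow>\<^sub>M N"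
    unfolding measurable_cong_sets[OF refl setsN]
  proof (rule measurable_restrict_space2)
    note [measurable] = S(1)
    show "\<pi> \<in> borel_measurable borel" unfolding \<pi>_def by measurable
  qed (use e in \<open>auto simp: \<pi>_def\<close>)
  have \<pi>_\<nu>: "\<pi> \<in> \<nu> \<omega> \<rightarrow>\<^sub>M N" for \<omega> using \<pi>_meas by (simp add: measurable_cong_sets[OF \<nu>(1) refl])
  define \<mu> where "\<mu> = (\<lambda>\<omega>. distr (\<nu> \<omega>) N \<pi>)"
  have \<mu>_eq: "measure (\<mu> \<omega>) A = measure (\<nu> \<omega>) (\<pi> -` A)" if "A \<in> sets N" for A \<omega>
    unfolding \<mu>_def using measure_distr[OF \<pi>_\<nu> that] sets_eq_imp_space_eq[OF \<nu>(1)[of \<omega>]] by simp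
  have \<pi>_pre: "\<pi> -` A \<in> sets borel" if "A \<in> sets N" for A
    using measurable_sets[OF \<pi>_meas that] by simp
  show ?thesis
  proof (rule that[of \<mu>])
    show "sets (\<mu> \<omega>) = sets N" for \<omega> by (simp add: \<mu>_def)
    show "finite_measure (\<mu> \<omega>)" for \<omega> unfolding \<mu>_def
      by (rule finite_measure.finite_measure_distr[OF \<nu>(2) \<pi>_\<nu>])
    fix A assume A: "A \<in> sets N"
    show "(\<lambda>\<omega>. measure (\<mu> \<omega>) A) \<in> borel_measurable M"
      unfolding \<mu>_eq[OF A] by (rule \<nu>(3)[OF \<pi>_pre[OF A]])
    have "A \<subseteq> S" using sets.sets_into_space[OF A] spN by simp
    then have "\<phi> -` (\<pi> -` A) \<inter> S = A" by (auto simp: \<pi>_def inv)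
    then show "AE \<omega> in M. measure (\<mu> \<omega>) A = Y A \<omega>"
      unfolding \<mu>_eq[OF A] using \<nu>(4)[OF \<pi>_pre[OF A]] by (simp add: Z_def)
  qed
qed

section \<open>Convergence of martingales bounded in L_p\<close>

lemma power_tangent_le:
  fixes a y :: real
  assumes "0 \<le> a" "0 \<le> y"
  shows "a ^ Suc k + real (Suc k) * a ^ k * (y - a) \<le> y ^ Suc k"
proof (induction k)
  case (Suc k)
  have "0 \<le> real (Suc k) * a ^ k * (y - a)\<^sup>2" using assms by simp
  then have "a ^ Suc (Suc k) + real (Suc (Suc k)) * a ^ Suc k * (y - a)
      \<le> y * (a ^ Suc k + real (Suc k) * a ^ k * (y - a))"
    by (simp add: algebra_simps power2_eq_square)
  also have "\<dots> \<le> y * y ^ Suc k" using Suc assms by (intro mult_left_mono) auto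
  finally show ?case by simp
qed simp

lemma power_add_ge_add_power:
  fixes x y :: real
  assumes "0 \<le> x" "0 \<le> y" "1 \<le> p"
  shows "x ^ p + y ^ p \<le> (x + y) ^ p"
  using \<open>1 \<le> p\<close>
proof (induction p rule: dec_induct)
  case (step p)
  have "x ^ Suc p + y ^ Suc p \<le> (x + y) * (x ^ p + y ^ p)"
    using assms by (simp add: algebra_simps)
  also have "\<dots> \<le> (x + y) * (x + y) ^ p" using step assms by (intro mult_left_mono) auto
  finally show ?case by simp
qed simp

text \<open>
  By superadditivity of the p-th power. It reduces convergence in L_p to convergence of the p-th
  powers in L_1.
\<close>

lemma abs_diff_power_le:
  fixes x y :: real
  assumes "0 \<le> x" "0 \<le> y" "1 \<le> p"
  shows "\<bar>x - y\<bar> ^ p \<le> \<bar>x ^ p - y ^ p\<bar>"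
proof -
  have *: "\<bar>x - y\<bar> ^ p \<le> \<bar>x ^ p - y ^ p\<bar>" if "0 \<le> y" "y \<le> x" for x y :: real
    using power_add_ge_add_power[of "x - y" y p] that assms(3) by simp
  show ?thesis
  proof (cases "y \<le> x")
    case False
    then show ?thesis using *[of x y] *[of y x] assms by (simp add: abs_minus_commute)
  qed (use * assms in simp)
qed

text \<open>
  A nonnegative martingale whose defining property is stated with integrals over events of the
  past, and whose p-th moments are bounded for some integer p \<ge> 2.
\<close>

locale Lp_martingale = prob_space M for M :: "'w measure" +
  fixes F :: "nat \<Rightarrow> 'w measure" and S :: "nat \<Rightarrow> 'w \<Rightarrow> real" and p :: nat and C :: real
  assumes subalg: "subalgebra M (F n)"
    and filtration: "m \<le> n \<Longrightarrow> sets (F m) \<subseteq> sets (F n)"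
    and adapted: "S n \<in> borel_measurable (F n)"
    and nonneg: "0 \<le> S n \<omega>"
    and martingale: "n \<le> m \<Longrightarrow> A \<in> sets (F n) \<Longrightarrow>
      (\<integral>\<^sup>+\<omega>. ennreal (S m \<omega>) * indicator A \<omega> \<partial>M) = (\<integral>\<^sup>+\<omega>. ennreal (S n \<omega>) * indicator A \<omega> \<partial>M)"
    and p: "2 \<le> p"
    and bounded: "(\<integral>\<^sup>+\<omega>. ennreal (S n \<omega> ^ p) \<partial>M) \<le> ennreal C"
begin

lemma S_meas [measurable]: "S n \<in> borel_measurable M"
  using measurable_from_subalg[OF subalg adapted] .

lemma power_le_1_plus: "0 \<le> x \<Longrightarrow> k \<le> p \<Longrightarrow> x ^ k \<le> 1 + x ^ p" for x :: real
proof (cases "x \<le> 1")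
  case True
  assume "0 \<le> x"
  then have "x ^ k \<le> 1" "0 \<le> x ^ p" using True by (auto simp: power_le_one)
  then show ?thesis by simp
next
  case False
  assume "k \<le> p"
  then have "x ^ k \<le> x ^ p" using False by (intro power_increasing) auto
  then show ?thesis by simp
qed

lemma mixed_power_le: "0 \<le> x \<Longrightarrow> 0 \<le> y \<Longrightarrow> x ^ (p - 1) * y \<le> x ^ p + y ^ p" for x y :: real
proof -
  assume *: "0 \<le> x" "0 \<le> y"
  define z where "z = max x y"
  have "x ^ (p - 1) * y \<le> z ^ (p - 1) * z" using * by (intro mult_mono power_mono) (auto simp: z_def)
  also have "\<dots> = z ^ p" using p by (cases p) (auto simp: mult.commute)
  also have "\<dots> \<le> x ^ p + y ^ p" using * by (auto simp: z_def max_def)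
  finally show ?thesis .
qed

lemma integrable_of_p:
  fixes Z :: "'w \<Rightarrow> real"
  assumes [measurable]: "Z \<in> borel_measurable M" and "\<And>\<omega>. 0 \<le> Z \<omega>"
    and "(\<integral>\<^sup>+\<omega>. ennreal (Z \<omega> ^ p) \<partial>M) \<le> ennreal C" and k: "k \<le> p"
  shows "integrable M (\<lambda>\<omega>. Z \<omega> ^ k)"
proof -
  have "integrable M (\<lambda>\<omega>. Z \<omega> ^ p)"
    by (rule integrableI_nonneg) (use assms in \<open>auto intro: le_less_trans\<close>)
  then have "integrable M (\<lambda>\<omega>. 1 + Z \<omega> ^ p)" by simp
  then show ?thesis
    by (rule Bochner_Integration.integrable_bound) (use assms power_le_1_plus in auto)
qed

lemma S_int: "k \<le> p \<Longrightarrow> integrable M (\<lambda>\<omega>. S n \<omega> ^ k)"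
  by (rule integrable_of_p[OF S_meas nonneg bounded])

lemma S_int1: "integrable M (S n)" using S_int[of 1] p by simp

lemma S_int_mult: "integrable M (\<lambda>\<omega>. S m \<omega> * S n \<omega>)"
proof (rule Bochner_Integration.integrable_bound)
  show "integrable M (\<lambda>\<omega>. S m \<omega> ^ 2 + S n \<omega> ^ 2)" using S_int p by simp
  have "x * y \<le> x\<^sup>2 + y\<^sup>2" if "0 \<le> x" "0 \<le> y" for x y :: real
    proof -
    have "0 \<le> x * y" using that by simp
    then show ?thesis using sum_squares_bound[of x y] by linarith
  qed
  then show "AE \<omega> in M. norm (S m \<omega> * S n \<omega>) \<le> norm (S m \<omega> ^ 2 + S n \<omega> ^ 2)"
    using nonneg by simp
qed measurable

lemma sf_subalg: "sigma_finite_subalgebra M (F n)"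
proof -
  have "finite_measure_subalgebra M (F n)"
    by (intro finite_measure_subalgebra.intro finite_measure_subalgebra_axioms.intro
        finite_measure_axioms subalg)
  then show ?thesis by (rule finite_measure_subalgebra_is_sigma_finite)
qed

text \<open>
  If T has the same integrals as S n over the events of F n, then S n is the conditional
  expectation of T, and integrals against any Z measurable with respect to F n agree. This is
  used with T a later value of the martingale and with T its limit.
\<close>

lemma integral_mult_adapted:
  fixes T Z :: "'w \<Rightarrow> real"
  assumes T: "integrable M T" "\<And>\<omega>. 0 \<le> T \<omega>"
    and eq: "\<And>A. A \<in> sets (F n) \<Longrightarrow>
      (\<integral>\<^sup>+\<omega>. ennreal (T \<omega>) * indicator A \<omega> \<partial>M) = (\<integral>\<^sup>+\<omega>. ennreal (S n \<omega>) * indicator A \<omega> \<partial>M)"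
    and Z: "Z \<in> borel_measurable (F n)" "integrable M (\<lambda>\<omega>. Z \<omega> * T \<omega>)"
  shows "integrable M (\<lambda>\<omega>. Z \<omega> * S n \<omega>)" "(\<integral>\<omega>. Z \<omega> * T \<omega> \<partial>M) = (\<integral>\<omega>. Z \<omega> * S n \<omega> \<partial>M)"
proof -
  interpret A: sigma_finite_subalgebra M "F n" by (rule sf_subalg)
  have [measurable]: "T \<in> borel_measurable M" using T by simp
  have ce: "AE \<omega> in M. real_cond_exp M (F n) T \<omega> = S n \<omega>"
  proof (rule A.real_cond_exp_charact)
    fix A assume A: "A \<in> sets (F n)"
    then have [measurable]: "A \<in> sets M" using subalg[of n] by (auto simp: subalgebra_def)
    have *: "(\<integral>\<omega>. f \<omega> * indicator A \<omega> \<partial>M) = enn2real (\<integral>\<^sup>+\<omega>. ennreal (f \<omega>) * indicator A \<omega> \<partial>M)"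
      if [measurable]: "f \<in> borel_measurable M" and "\<And>\<omega>. 0 \<le> f \<omega>" for f
      by (subst integral_eq_nn_integral) (use that in \<open>auto simp: ennreal_mult ennreal_indicator\<close>)
    show "(\<integral>\<omega>\<in>A. T \<omega> \<partial>M) = (\<integral>\<omega>\<in>A. S n \<omega> \<partial>M)"
      unfolding set_lebesgue_integral_def using *[of T] *[of "S n"] eq[OF A] T nonneg
      by (simp add: mult.commute)
  qed (use T S_int1 adapted in auto)
  note int = A.real_cond_exp_intg[OF Z(2,1)]
  have [measurable]: "Z \<in> borel_measurable M" using measurable_from_subalg[OF subalg Z(1)] .
  have ae: "AE \<omega> in M. Z \<omega> * real_cond_exp M (F n) T \<omega> = Z \<omega> * S n \<omega>"
    using ce by eventually_elim simp
  show "integrable M (\<lambda>\<omega>. Z \<omega> * S n \<omega>)"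
    by (rule integrable_cong_AE[THEN iffD1, OF _ _ ae int(1)]) measurable
  have "(\<integral>\<omega>. Z \<omega> * real_cond_exp M (F n) T \<omega> \<partial>M) = (\<integral>\<omega>. Z \<omega> * S n \<omega> \<partial>M)"
    by (rule integral_cong_AE) (use ae in auto)
  then show "(\<integral>\<omega>. Z \<omega> * T \<omega> \<partial>M) = (\<integral>\<omega>. Z \<omega> * S n \<omega> \<partial>M)" using int(2) by simp
qed

lemma integral_mult_martingale:
  fixes Z :: "'w \<Rightarrow> real"
  assumes "n \<le> m" "Z \<in> borel_measurable (F n)" "integrable M (\<lambda>\<omega>. Z \<omega> * S m \<omega>)"
  shows "integrable M (\<lambda>\<omega>. Z \<omega> * S n \<omega>)" "(\<integral>\<omega>. Z \<omega> * S m \<omega> \<partial>M) = (\<integral>\<omega>. Z \<omega> * S n \<omega> \<partial>M)"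
  using integral_mult_adapted[OF S_int1[of m] nonneg martingale[OF assms(1)] assms(2,3)] by auto

text \<open>
  Increments of the martingale are orthogonal, so distances in L_2 are differences of energies.
\<close>

definition energy :: "nat \<Rightarrow> real" where "energy n = (\<integral>\<omega>. (S n \<omega>)\<^sup>2 \<partial>M)"

lemma diff_sq_int: "integrable M (\<lambda>\<omega>. (S m \<omega> - S n \<omega>)\<^sup>2)"
proof -
  have "integrable M (\<lambda>\<omega>. (S m \<omega>)\<^sup>2 + (S n \<omega>)\<^sup>2 - 2 * (S m \<omega> * S n \<omega>))"
    using S_int[of 2] S_int_mult[of m n] p by simp
  then show ?thesis by (simp add: power2_diff mult.assoc)
qed

lemma energy_diff:
  assumes "n \<le> m"
  shows "(\<integral>\<omega>. (S m \<omega> - S n \<omega>)\<^sup>2 \<partial>M) = energy m - energy n"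
proof -
  have "(\<integral>\<omega>. S n \<omega> * S m \<omega> \<partial>M) = energy n"
    using integral_mult_martingale(2)[OF assms adapted S_int_mult]
    by (simp add: energy_def power2_eq_square)
  moreover have "(\<integral>\<omega>. (S m \<omega> - S n \<omega>)\<^sup>2 \<partial>M) = (\<integral>\<omega>. (S m \<omega>)\<^sup>2 + (S n \<omega>)\<^sup>2 - 2 * (S n \<omega> * S m \<omega>) \<partial>M)"
    by (simp add: power2_diff algebra_simps)
  ultimately show ?thesis
    using S_int[of 2] S_int_mult[of n m] p by (simp add: energy_def)
qed

lemma energy_mono: "n \<le> m \<Longrightarrow> energy n \<le> energy m"
  using energy_diff[of n m] by (smt (verit) integral_nonneg_AE AE_I2 zero_le_power2)

lemma energy_bounded: "energy n \<le> 1 + enn2real (ennreal C)"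
proof -
  have "energy n \<le> (\<integral>\<omega>. 1 + S n \<omega> ^ p \<partial>M)"
    unfolding energy_def using S_int p power_le_1_plus nonneg by (intro integral_mono) auto
  also have "\<dots> = 1 + (\<integral>\<omega>. S n \<omega> ^ p \<partial>M)" using S_int[of p] by (simp add: prob_space)
  also have "(\<integral>\<omega>. S n \<omega> ^ p \<partial>M) \<le> enn2real (ennreal C)"
    by (subst integral_eq_nn_integral) (use nonneg in \<open>auto intro!: enn2real_mono bounded\<close>)
  finally show ?thesis by simp
qed

lemma energy_limit:
  obtains L where "energy \<longlonglongrightarrow> L" "\<And>n. energy n \<le> L"
  using incseq_convergent[of energy "1 + enn2real (ennreal C)"] energy_mono energy_bounded
  by (auto simp: incseq_def)

text \<open>
  Kolmogorov's inequality. On the event A k that the deviation reaches \<epsilon> first at time k, the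
  increment from k to N is orthogonal to the deviation at time k, so continuing until N can only
  increase the mean square.
\<close>

lemma maximal_inequality:
  assumes "0 < \<epsilon>" "n \<le> N"
  shows "prob {\<omega> \<in> space M. \<exists>k\<in>{n..N}. \<epsilon> \<le> \<bar>S k \<omega> - S n \<omega>\<bar>} * \<epsilon>\<^sup>2 \<le> energy N - energy n"
proof -
  define A where "A k = {\<omega> \<in> space M. \<epsilon> \<le> \<bar>S k \<omega> - S n \<omega>\<bar> \<and> (\<forall>j\<in>{n..<k}. \<bar>S j \<omega> - S n \<omega>\<bar> < \<epsilon>)}" for k
  have AF: "A k \<in> sets (F k)" if "n \<le> k" for k
  proof -
    have sp: "space M = space (F k)" using subalg[of k] by (simp add: subalgebra_def)
    have [measurable]: "S j \<in> borel_measurable (F k)" if "j \<le> k" for j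
      using adapted[of j] filtration[OF that] subalg[of j] subalg[of k]
      by (auto simp: measurable_def subalgebra_def)
    have [measurable]: "S n \<in> borel_measurable (F k)" "S k \<in> borel_measurable (F k)" using that by auto
    have "{\<omega> \<in> space (F k). \<forall>j\<in>{n..<k}. \<bar>S j \<omega> - S n \<omega>\<bar> < \<epsilon>} \<in> sets (F k)"
    proof (rule sets.sets_Collect_finite_All)
      fix j assume "j \<in> {n..<k}"
      then have [measurable]: "S j \<in> borel_measurable (F k)" by simp
      show "{\<omega> \<in> space (F k). \<bar>S j \<omega> - S n \<omega>\<bar> < \<epsilon>} \<in> sets (F k)" by measurable
    qed auto
    moreover have "{\<omega> \<in> space (F k). \<epsilon> \<le> \<bar>S k \<omega> - S n \<omega>\<bar>} \<in> sets (F k)" by measurable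
    ultimately have "{\<omega> \<in> space (F k). \<epsilon> \<le> \<bar>S k \<omega> - S n \<omega>\<bar>} \<inter>
        {\<omega> \<in> space (F k). \<forall>j\<in>{n..<k}. \<bar>S j \<omega> - S n \<omega>\<bar> < \<epsilon>} \<in> sets (F k)" by blast
    also have "{\<omega> \<in> space (F k). \<epsilon> \<le> \<bar>S k \<omega> - S n \<omega>\<bar>} \<inter>
        {\<omega> \<in> space (F k). \<forall>j\<in>{n..<k}. \<bar>S j \<omega> - S n \<omega>\<bar> < \<epsilon>} = A k"
      by (auto simp: A_def sp)
    finally show ?thesis .
  qed
  have AM [measurable]: "A k \<in> sets M" for k unfolding A_def by measurable
  have disj: "disjoint_family_on A {n..N}"
    unfolding disjoint_family_on_def
  proof (intro ballI impI)
    fix i j assume "i \<in> {n..N}" "j \<in> {n..N}" "i \<noteq> j"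
    then consider "i < j" "n \<le> i" | "j < i" "n \<le> j" by fastforce
    then show "A i \<inter> A j = {}" by cases (force simp: A_def)+
  qed
  have union: "{\<omega> \<in> space M. \<exists>k\<in>{n..N}. \<epsilon> \<le> \<bar>S k \<omega> - S n \<omega>\<bar>} = (\<Union>k\<in>{n..N}. A k)"
  proof (intro set_eqI iffI)
    fix \<omega> assume "\<omega> \<in> {\<omega> \<in> space M. \<exists>k\<in>{n..N}. \<epsilon> \<le> \<bar>S k \<omega> - S n \<omega>\<bar>}"
    then obtain k0 where \<omega>: "\<omega> \<in> space M" and k0: "k0 \<in> {n..N} \<and> \<epsilon> \<le> \<bar>S k0 \<omega> - S n \<omega>\<bar>" by blast
    define k where "k = (LEAST k. k \<in> {n..N} \<and> \<epsilon> \<le> \<bar>S k \<omega> - S n \<omega>\<bar>)"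
    have k: "k \<in> {n..N} \<and> \<epsilon> \<le> \<bar>S k \<omega> - S n \<omega>\<bar>" unfolding k_def using k0 by (rule LeastI)
    have "\<bar>S j \<omega> - S n \<omega>\<bar> < \<epsilon>" if "j \<in> {n..<k}" for j
      using not_less_Least[of j "\<lambda>k. k \<in> {n..N} \<and> \<epsilon> \<le> \<bar>S k \<omega> - S n \<omega>\<bar>"] that k
      unfolding k_def[symmetric] by auto
    then show "\<omega> \<in> (\<Union>k\<in>{n..N}. A k)" using \<omega> k by (auto simp: A_def)
  qed (auto simp: A_def)
  \<comment> \<open>The expansion of the square has the cross term 2 Z (S N - S k), which has mean 0.\<close>
  have step: "prob (A k) * \<epsilon>\<^sup>2 \<le> (\<integral>\<omega>. (S N \<omega> - S n \<omega>)\<^sup>2 * indicator (A k) \<omega> \<partial>M)" if k: "k \<in> {n..N}" for k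
  proof -
    define Z where "Z \<omega> = (S k \<omega> - S n \<omega>) * indicator (A k) \<omega>" for \<omega>
    have nk: "n \<le> k" "k \<le> N" using k by auto
    have ind: "integrable M (\<lambda>\<omega>. f \<omega> * indicator (A k) \<omega>)" if "integrable M f" for f :: "'w \<Rightarrow> real"
      using integrable_mult_indicator[OF AM that] by (simp add: mult.commute)
    have Sn: "S n \<in> borel_measurable (F k)"
      using adapted[of n] filtration[OF nk(1)] subalg[of n] subalg[of k]
      by (auto simp: measurable_def subalgebra_def)
    have Z: "Z \<in> borel_measurable (F k)"
      unfolding Z_def using adapted[of k] Sn AF[OF nk(1)] by (intro borel_measurable_times borel_measurable_diff borel_measurable_indicator)
    have Zint: "integrable M (\<lambda>\<omega>. Z \<omega> * S j \<omega>)" for j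
    proof -
      have "integrable M (\<lambda>\<omega>. (S k \<omega> * S j \<omega> - S n \<omega> * S j \<omega>) * indicator (A k) \<omega>)"
        by (intro ind Bochner_Integration.integrable_diff S_int_mult)
      then show ?thesis by (simp add: Z_def algebra_simps)
    qed
    have orth: "(\<integral>\<omega>. Z \<omega> * (S N \<omega> - S k \<omega>) \<partial>M) = 0"
      using integral_mult_martingale(2)[OF nk(2) Z Zint] Zint by (simp add: right_diff_distrib)
    have "prob (A k) * \<epsilon>\<^sup>2 = (\<integral>\<omega>. indicator (A k) \<omega> * \<epsilon>\<^sup>2 \<partial>M)" by simp
    also have "\<dots> \<le> (\<integral>\<omega>. (S k \<omega> - S n \<omega>)\<^sup>2 * indicator (A k) \<omega> \<partial>M)"
    proof (rule integral_mono)
      show "integrable M (\<lambda>\<omega>. indicator (A k) \<omega> * \<epsilon>\<^sup>2)" by (simp add: emeasure_finite less_top[symmetric])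
      fix \<omega>
      show "indicator (A k) \<omega> * \<epsilon>\<^sup>2 \<le> (S k \<omega> - S n \<omega>)\<^sup>2 * indicator (A k) \<omega>"
      proof (cases "\<omega> \<in> A k")
        case True
        then have "\<epsilon> \<le> \<bar>S k \<omega> - S n \<omega>\<bar>" by (simp add: A_def)
        then have "\<epsilon>\<^sup>2 \<le> \<bar>S k \<omega> - S n \<omega>\<bar>\<^sup>2" using assms by (intro power_mono) auto
        then show ?thesis using True by simp
      qed simp
    qed (intro ind diff_sq_int)
    also have "\<dots> \<le> (\<integral>\<omega>. (S N \<omega> - S n \<omega>)\<^sup>2 * indicator (A k) \<omega> - 2 * (Z \<omega> * (S N \<omega> - S k \<omega>)) \<partial>M)"
    proof (rule integral_mono)
      show "integrable M (\<lambda>\<omega>. (S N \<omega> - S n \<omega>)\<^sup>2 * indicator (A k) \<omega> - 2 * (Z \<omega> * (S N \<omega> - S k \<omega>)))"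
        using Zint by (intro Bochner_Integration.integrable_diff ind diff_sq_int integrable_mult_right)
          (simp add: right_diff_distrib)
      fix \<omega>
      have "0 \<le> (S N \<omega> - S k \<omega>)\<^sup>2" by simp
      then show "(S k \<omega> - S n \<omega>)\<^sup>2 * indicator (A k) \<omega> \<le> (S N \<omega> - S n \<omega>)\<^sup>2 * indicator (A k) \<omega> - 2 * (Z \<omega> * (S N \<omega> - S k \<omega>))"
        by (cases "\<omega> \<in> A k") (auto simp: Z_def algebra_simps power2_eq_square)
    qed (intro ind diff_sq_int)
    also have "\<dots> = (\<integral>\<omega>. (S N \<omega> - S n \<omega>)\<^sup>2 * indicator (A k) \<omega> \<partial>M)"
      using Zint orth by (subst Bochner_Integration.integral_diff)
        (auto intro!: ind diff_sq_int simp: right_diff_distrib)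
    finally show ?thesis .
  qed
  have ind: "integrable M (\<lambda>\<omega>. (S N \<omega> - S n \<omega>)\<^sup>2 * indicator (A k) \<omega>)" for k
    using integrable_mult_indicator[OF AM diff_sq_int] by (simp add: mult.commute)
  have "prob (\<Union>k\<in>{n..N}. A k) = (\<Sum>k\<in>{n..N}. prob (A k))"
    by (rule finite_measure_finite_Union) (use disj in auto)
  then have "prob (\<Union>k\<in>{n..N}. A k) * \<epsilon>\<^sup>2 = (\<Sum>k\<in>{n..N}. prob (A k) * \<epsilon>\<^sup>2)" by (simp add: sum_distrib_right)
  also have "\<dots> \<le> (\<Sum>k\<in>{n..N}. (\<integral>\<omega>. (S N \<omega> - S n \<omega>)\<^sup>2 * indicator (A k) \<omega> \<partial>M))"
    by (rule sum_mono) (rule step)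
  also have "\<dots> = (\<integral>\<omega>. (\<Sum>k\<in>{n..N}. (S N \<omega> - S n \<omega>)\<^sup>2 * indicator (A k) \<omega>) \<partial>M)"
    by (rule Bochner_Integration.integral_sum[symmetric]) (rule ind)
  also have "\<dots> \<le> (\<integral>\<omega>. (S N \<omega> - S n \<omega>)\<^sup>2 \<partial>M)"
  proof (rule integral_mono)
    fix \<omega>
    have "(\<Sum>k\<in>{n..N}. indicator (A k) \<omega>) = (indicator (\<Union>k\<in>{n..N}. A k) \<omega> :: real)"
      by (rule indicator_UN_disjoint[symmetric]) (use disj in auto)
    then have "(\<Sum>k\<in>{n..N}. (S N \<omega> - S n \<omega>)\<^sup>2 * indicator (A k) \<omega>)
        = (S N \<omega> - S n \<omega>)\<^sup>2 * indicator (\<Union>k\<in>{n..N}. A k) \<omega>" by (simp add: sum_distrib_left[symmetric])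
    also have "\<dots> \<le> (S N \<omega> - S n \<omega>)\<^sup>2 * 1"
      by (rule mult_left_mono) (auto simp: indicator_le_1)
    finally show "(\<Sum>k\<in>{n..N}. (S N \<omega> - S n \<omega>)\<^sup>2 * indicator (A k) \<omega>) \<le> (S N \<omega> - S n \<omega>)\<^sup>2"
      by simp
  qed (intro Bochner_Integration.integrable_sum ind diff_sq_int)+
  also have "\<dots> = energy N - energy n" by (rule energy_diff[OF assms(2)])
  finally show ?thesis unfolding union .
qed

text \<open>
  Energies are increasing and bounded, so by the maximal inequality the probability of a deviation
  of size \<epsilon> after time n tends to 0.
\<close>

lemma AE_Cauchy: "AE \<omega> in M. Cauchy (\<lambda>n. S n \<omega>)"
proof -
  obtain L where L: "energy \<longlonglongrightarrow> L" "\<And>n. energy n \<le> L" by (rule energy_limit) blast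
  have *: "AE \<omega> in M. \<exists>n. \<forall>k\<ge>n. \<bar>S k \<omega> - S n \<omega>\<bar> < \<epsilon>" if \<epsilon>: "0 < \<epsilon>" for \<epsilon> :: real
  proof -
    define B where "B n N = {\<omega> \<in> space M. \<exists>k\<in>{n..N}. \<epsilon> \<le> \<bar>S k \<omega> - S n \<omega>\<bar>}" for n N
    have Bm [measurable]: "B n N \<in> sets M" for n N unfolding B_def by measurable
    have bnd: "prob (\<Union>N. B n N) \<le> (L - energy n) / \<epsilon>\<^sup>2" for n
    proof (rule LIMSEQ_le_const2)
      show "(\<lambda>N. prob (B n N)) \<longlonglongrightarrow> prob (\<Union>N. B n N)"
        by (rule finite_Lim_measure_incseq) (auto simp: incseq_def B_def)
      show "\<exists>K. \<forall>N\<ge>K. prob (B n N) \<le> (L - energy n) / \<epsilon>\<^sup>2"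
      proof (intro exI allI impI)
        fix N assume "n \<le> N"
        then have "prob (B n N) * \<epsilon>\<^sup>2 \<le> energy N - energy n"
          unfolding B_def by (rule maximal_inequality[OF \<epsilon>])
        also have "\<dots> \<le> L - energy n" using L(2)[of N] by simp
        finally show "prob (B n N) \<le> (L - energy n) / \<epsilon>\<^sup>2" using \<epsilon> by (simp add: pos_le_divide_eq)
      qed
    qed
    have "(\<lambda>n. (L - energy n) / \<epsilon>\<^sup>2) \<longlonglongrightarrow> (L - L) / \<epsilon>\<^sup>2" by (intro tendsto_intros L) (use \<epsilon> in simp)
    moreover have "prob (\<Inter>n. \<Union>N. B n N) \<le> (L - energy n) / \<epsilon>\<^sup>2" for n
      using bnd[of n] finite_measure_mono[of "\<Inter>n. \<Union>N. B n N" "\<Union>N. B n N"] by fastforce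
    ultimately have "prob (\<Inter>n. \<Union>N. B n N) \<le> (L - L) / \<epsilon>\<^sup>2"
      by (intro LIMSEQ_le_const) auto
    then have "prob (\<Inter>n. \<Union>N. B n N) \<le> 0" by simp
    then have "prob (\<Inter>n. \<Union>N. B n N) = 0" using measure_le_0_iff by blast
    then have "(\<Inter>n. \<Union>N. B n N) \<in> null_sets M" by (simp add: null_sets_def emeasure_eq_measure)
    then show ?thesis
    proof (rule AE_I')
      show "{\<omega> \<in> space M. \<not> (\<exists>n. \<forall>k\<ge>n. \<bar>S k \<omega> - S n \<omega>\<bar> < \<epsilon>)} \<subseteq> (\<Inter>n. \<Union>N. B n N)"
        by (force simp: B_def not_less)
    qed
  qed
  have "AE \<omega> in M. \<forall>j. \<exists>n. \<forall>k\<ge>n. \<bar>S k \<omega> - S n \<omega>\<bar> < 1 / real (Suc j)"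
    unfolding AE_all_countable by (intro allI *) simp
  then show ?thesis
  proof eventually_elim
    case (elim \<omega>)
    show ?case
    proof (rule CauchyI')
      fix e :: real assume "0 < e"
      then obtain j where j: "1 / real (Suc j) < e / 2" using nat_approx_posE[of "e / 2"] by auto
      obtain n where n: "\<And>k. n \<le> k \<Longrightarrow> \<bar>S k \<omega> - S n \<omega>\<bar> < 1 / real (Suc j)" using elim by blast
      have "dist (S m \<omega>) (S k \<omega>) < e" if "n \<le> m" "m < k" for m k
        using n[of m] n[of k] that j unfolding dist_real_def by linarith
      then show "\<exists>M. \<forall>m\<ge>M. \<forall>n>m. dist (S m \<omega>) (S n \<omega>) < e" by blast
    qed
  qed
qed

text \<open>
  The almost sure limit Y is also the limit in L_2, hence S n is the conditional expectation of Y
  and the moments of S n are at most those of Y, by Jensen's inequality. Together with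
  Fatou's lemma the p-th moments converge, and Scheffe's lemma turns this into convergence of the
  p-th powers in L_1.
\<close>

theorem Lp_martingale_convergence:
  obtains Y where "Y \<in> borel_measurable M" "\<And>\<omega>. 0 \<le> Y \<omega>" "AE \<omega> in M. (\<lambda>n. S n \<omega>) \<longlonglongrightarrow> Y \<omega>"
    "(\<lambda>n. \<integral>\<^sup>+\<omega>. ennreal (\<bar>S n \<omega> - Y \<omega>\<bar> ^ p) \<partial>M) \<longlonglongrightarrow> 0"
    "(\<integral>\<^sup>+\<omega>. ennreal (Y \<omega>) \<partial>M) = (\<integral>\<^sup>+\<omega>. ennreal (S 0 \<omega>) \<partial>M)"
proof -
  \<comment> \<open>Truncating at 0 only affects the null set where the sequence diverges.\<close>
  define Y where "Y = (\<lambda>\<omega>. max 0 (lim (\<lambda>n. S n \<omega>)))"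
  have Y_meas [measurable]: "Y \<in> borel_measurable M" unfolding Y_def by measurable
  have Y_nn: "0 \<le> Y \<omega>" for \<omega> by (simp add: Y_def)
  have lim: "AE \<omega> in M. (\<lambda>n. S n \<omega>) \<longlonglongrightarrow> Y \<omega>"
    using AE_Cauchy
  proof eventually_elim
    case (elim \<omega>)
    then have *: "(\<lambda>n. S n \<omega>) \<longlonglongrightarrow> lim (\<lambda>n. S n \<omega>)" by (simp add: Cauchy_convergent_iff convergent_LIMSEQ_iff)
    then have "0 \<le> lim (\<lambda>n. S n \<omega>)" by (rule LIMSEQ_le_const) (use nonneg in auto)
    then show ?case using * by (simp add: Y_def)
  qed
  have Y_bdd: "(\<integral>\<^sup>+\<omega>. ennreal (Y \<omega> ^ p) \<partial>M) \<le> ennreal C"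
  proof -
    have "(\<integral>\<^sup>+\<omega>. ennreal (Y \<omega> ^ p) \<partial>M) = (\<integral>\<^sup>+\<omega>. liminf (\<lambda>n. ennreal (S n \<omega> ^ p)) \<partial>M)"
    proof (rule nn_integral_cong_AE, use lim in eventually_elim)
      fix \<omega> assume "(\<lambda>n. S n \<omega>) \<longlonglongrightarrow> Y \<omega>"
      then have "(\<lambda>n. ennreal (S n \<omega> ^ p)) \<longlonglongrightarrow> ennreal (Y \<omega> ^ p)" by (intro tendsto_intros) auto
      then show "ennreal (Y \<omega> ^ p) = liminf (\<lambda>n. ennreal (S n \<omega> ^ p))" by (rule lim_imp_Liminf[OF sequentially_bot, symmetric])
    qed
    also have "\<dots> \<le> liminf (\<lambda>n. \<integral>\<^sup>+\<omega>. ennreal (S n \<omega> ^ p) \<partial>M)" by (rule nn_integral_liminf) simp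
    also have "\<dots> \<le> ennreal C"
      by (rule order_trans[OF Liminf_le_Limsup Limsup_bounded]) (use bounded in auto)
    finally show ?thesis .
  qed
  note Y_int = integrable_of_p[OF Y_meas Y_nn Y_bdd]
  have Y_int1: "integrable M Y" using Y_int[of 1] p by simp
  obtain L where L: "energy \<longlonglongrightarrow> L" "\<And>n. energy n \<le> L" by (rule energy_limit) blast
  \<comment> \<open>Fatou, applied to the squared distances to later members of the sequence.\<close>
  have L2: "(\<integral>\<^sup>+\<omega>. ennreal ((Y \<omega> - S n \<omega>)\<^sup>2) \<partial>M) \<le> ennreal (L - energy n)" for n
  proof -
    have "(\<integral>\<^sup>+\<omega>. ennreal ((Y \<omega> - S n \<omega>)\<^sup>2) \<partial>M) = (\<integral>\<^sup>+\<omega>. liminf (\<lambda>m. ennreal ((S m \<omega> - S n \<omega>)\<^sup>2)) \<partial>M)"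
    proof (rule nn_integral_cong_AE, use lim in eventually_elim)
      fix \<omega> assume "(\<lambda>n. S n \<omega>) \<longlonglongrightarrow> Y \<omega>"
      then have "(\<lambda>m. ennreal ((S m \<omega> - S n \<omega>)\<^sup>2)) \<longlonglongrightarrow> ennreal ((Y \<omega> - S n \<omega>)\<^sup>2)" by (intro tendsto_intros) auto
      then show "ennreal ((Y \<omega> - S n \<omega>)\<^sup>2) = liminf (\<lambda>m. ennreal ((S m \<omega> - S n \<omega>)\<^sup>2))" by (rule lim_imp_Liminf[OF sequentially_bot, symmetric])
    qed
    also have "\<dots> \<le> liminf (\<lambda>m. \<integral>\<^sup>+\<omega>. ennreal ((S m \<omega> - S n \<omega>)\<^sup>2) \<partial>M)" by (rule nn_integral_liminf) simp
    also have "\<dots> \<le> ennreal (L - energy n)"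
    proof (rule order_trans[OF Liminf_le_Limsup Limsup_bounded])
      show "\<forall>\<^sub>F m in sequentially. (\<integral>\<^sup>+\<omega>. ennreal ((S m \<omega> - S n \<omega>)\<^sup>2) \<partial>M) \<le> ennreal (L - energy n)"
        unfolding eventually_sequentially
      proof (intro exI allI impI)
        fix m assume "n \<le> m"
        have "(\<integral>\<^sup>+\<omega>. ennreal ((S m \<omega> - S n \<omega>)\<^sup>2) \<partial>M) = ennreal (\<integral>\<omega>. (S m \<omega> - S n \<omega>)\<^sup>2 \<partial>M)"
          by (rule nn_integral_eq_integral[OF diff_sq_int]) simp
        then show "(\<integral>\<^sup>+\<omega>. ennreal ((S m \<omega> - S n \<omega>)\<^sup>2) \<partial>M) \<le> ennreal (L - energy n)"
          using energy_diff[OF \<open>n \<le> m\<close>] L(2)[of m] by (simp add: ennreal_leI)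
      qed
    qed simp
    finally show ?thesis .
  qed
  have L1: "(\<lambda>n. \<integral>\<omega>. \<bar>Y \<omega> - S n \<omega>\<bar> \<partial>M) \<longlonglongrightarrow> 0"
  proof (rule LIMSEQ_I)
    fix e :: real assume e: "0 < e"
    have "\<forall>\<^sub>F n in sequentially. L - e\<^sup>2 / 8 < energy n"
      by (rule order_tendstoD(1)[OF L(1)]) (use e in simp)
    then obtain n0 where n0': "\<forall>n\<ge>n0. L - e\<^sup>2 / 8 < energy n"
      unfolding eventually_sequentially by blast
    have n0: "L - energy n < e\<^sup>2 / 8" if "n0 \<le> n" for n using n0' that by fastforce
    have "(\<integral>\<omega>. \<bar>Y \<omega> - S n \<omega>\<bar> \<partial>M) < e" if "n0 \<le> n" for n
    proof -
      have sq: "integrable M (\<lambda>\<omega>. (Y \<omega> - S n \<omega>)\<^sup>2)"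
        by (rule integrableI_nonneg) (use L2[of n] in \<open>auto intro: le_less_trans\<close>)
      have "ennreal (\<integral>\<omega>. (Y \<omega> - S n \<omega>)\<^sup>2 \<partial>M) \<le> ennreal (L - energy n)"
        using L2[of n] nn_integral_eq_integral[OF sq] by simp
      then have i2: "(\<integral>\<omega>. (Y \<omega> - S n \<omega>)\<^sup>2 \<partial>M) \<le> L - energy n"
        using L(2)[of n] by (subst (asm) ennreal_le_iff) auto
      have "(\<integral>\<omega>. \<bar>Y \<omega> - S n \<omega>\<bar> \<partial>M) \<le> (\<integral>\<omega>. e / 2 + (Y \<omega> - S n \<omega>)\<^sup>2 * (2 / e) \<partial>M)"
      proof (rule integral_mono)
        fix \<omega>
        define x where "x = \<bar>Y \<omega> - S n \<omega>\<bar>"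
        have "x \<le> e / 2 + x\<^sup>2 * (2 / e)"
        proof (cases "x \<le> e / 2")
          case False
          then have "x * (e / 2) \<le> x * x" by (intro mult_left_mono) (auto simp: x_def)
          then have "x \<le> x\<^sup>2 * (2 / e)" using e by (simp add: field_simps power2_eq_square)
          then show ?thesis using e by simp
        qed (use e in \<open>simp add: add_increasing2\<close>)
        then show "\<bar>Y \<omega> - S n \<omega>\<bar> \<le> e / 2 + (Y \<omega> - S n \<omega>)\<^sup>2 * (2 / e)" by (simp add: x_def)
      qed (use Y_int1 S_int1 sq in simp_all)
      also have "\<dots> = e / 2 + (\<integral>\<omega>. (Y \<omega> - S n \<omega>)\<^sup>2 \<partial>M) * (2 / e)"
        using sq by (simp add: prob_space)
      also have "\<dots> \<le> e / 2 + (L - energy n) * (2 / e)" using i2 e by (intro add_left_mono mult_right_mono) auto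
      also have "\<dots> < e / 2 + (e\<^sup>2 / 8) * (2 / e)" using n0[OF that] e by (intro add_strict_left_mono mult_strict_right_mono) auto
      also have "\<dots> \<le> e" using e by (simp add: power2_eq_square)
      finally show ?thesis .
    qed
    then show "\<exists>n0. \<forall>n\<ge>n0. norm ((\<integral>\<omega>. \<bar>Y \<omega> - S n \<omega>\<bar> \<partial>M) - 0) < e"
      by (intro exI[of _ n0]) simp
  qed
  have Y_mart: "(\<integral>\<^sup>+\<omega>. ennreal (Y \<omega>) * indicator A \<omega> \<partial>M) = (\<integral>\<^sup>+\<omega>. ennreal (S n \<omega>) * indicator A \<omega> \<partial>M)"
    if A: "A \<in> sets (F n)" for A n
  proof -
    have AM [measurable]: "A \<in> sets M" using A subalg[of n] by (auto simp: subalgebra_def)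
    have ind: "integrable M (\<lambda>\<omega>. f \<omega> * indicator A \<omega>)" if "integrable M f" for f :: "'w \<Rightarrow> real"
      using integrable_mult_indicator[OF AM that] by (simp add: mult.commute)
    have nn: "(\<integral>\<^sup>+\<omega>. ennreal (f \<omega>) * indicator A \<omega> \<partial>M) = ennreal (\<integral>\<omega>. f \<omega> * indicator A \<omega> \<partial>M)"
      if "integrable M f" "\<And>\<omega>. 0 \<le> f \<omega>" for f
      by (subst nn_integral_eq_integral[symmetric, OF ind[OF that(1)]])
        (use that in \<open>auto simp: ennreal_mult ennreal_indicator\<close>)
    have eqm: "(\<integral>\<omega>. S m \<omega> * indicator A \<omega> \<partial>M) = (\<integral>\<omega>. S n \<omega> * indicator A \<omega> \<partial>M)" if "n \<le> m" for m
      using martingale[OF that A] nn[OF S_int1 nonneg] by (simp add: integral_nonneg_AE nonneg)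
    have "(\<lambda>m. \<integral>\<omega>. S m \<omega> * indicator A \<omega> \<partial>M) \<longlonglongrightarrow> (\<integral>\<omega>. Y \<omega> * indicator A \<omega> \<partial>M)"
    proof (rule LIM_zero_cancel, rule tendsto_sandwich[OF _ _ _ L1])
      show "(\<lambda>m. - (\<integral>\<omega>. \<bar>Y \<omega> - S m \<omega>\<bar> \<partial>M)) \<longlonglongrightarrow> 0" using tendsto_minus[OF L1] by simp
      have *: "\<bar>(\<integral>\<omega>. S m \<omega> * indicator A \<omega> \<partial>M) - (\<integral>\<omega>. Y \<omega> * indicator A \<omega> \<partial>M)\<bar> \<le> (\<integral>\<omega>. \<bar>Y \<omega> - S m \<omega>\<bar> \<partial>M)" for m
      proof -
        have "(\<integral>\<omega>. S m \<omega> * indicator A \<omega> \<partial>M) - (\<integral>\<omega>. Y \<omega> * indicator A \<omega> \<partial>M) = (\<integral>\<omega>. (S m \<omega> - Y \<omega>) * indicator A \<omega> \<partial>M)"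
          using ind[OF S_int1[of m]] ind[OF Y_int1] by (simp add: left_diff_distrib)
        also have "\<bar>\<dots>\<bar> \<le> (\<integral>\<omega>. \<bar>(S m \<omega> - Y \<omega>) * indicator A \<omega>\<bar> \<partial>M)" by (rule integral_abs_bound)
        also have "\<dots> \<le> (\<integral>\<omega>. \<bar>Y \<omega> - S m \<omega>\<bar> \<partial>M)"
          by (rule integral_mono)
            (use Y_int1 S_int1[of m] ind[of "\<lambda>\<omega>. S m \<omega> - Y \<omega>"] in \<open>auto simp: indicator_def abs_minus_commute\<close>)
        finally show ?thesis .
      qed
      then show "\<forall>\<^sub>F m in sequentially. (\<integral>\<omega>. S m \<omega> * indicator A \<omega> \<partial>M) - (\<integral>\<omega>. Y \<omega> * indicator A \<omega> \<partial>M) \<le> (\<integral>\<omega>. \<bar>Y \<omega> - S m \<omega>\<bar> \<partial>M)"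
        "\<forall>\<^sub>F m in sequentially. - (\<integral>\<omega>. \<bar>Y \<omega> - S m \<omega>\<bar> \<partial>M) \<le> (\<integral>\<omega>. S m \<omega> * indicator A \<omega> \<partial>M) - (\<integral>\<omega>. Y \<omega> * indicator A \<omega> \<partial>M)"
        by (auto simp: abs_le_iff intro!: always_eventually) (smt (verit) *)
    qed
    moreover have "(\<lambda>m. \<integral>\<omega>. S m \<omega> * indicator A \<omega> \<partial>M) \<longlonglongrightarrow> (\<integral>\<omega>. S n \<omega> * indicator A \<omega> \<partial>M)"
      by (rule tendsto_eventually, unfold eventually_sequentially) (use eqm in blast)
    ultimately have "(\<integral>\<omega>. Y \<omega> * indicator A \<omega> \<partial>M) = (\<integral>\<omega>. S n \<omega> * indicator A \<omega> \<partial>M)"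
      by (rule LIMSEQ_unique)
    then show ?thesis using nn[OF S_int1 nonneg, of n] nn[OF Y_int1 Y_nn] by simp
  qed
  \<comment> \<open>The tangent inequality at S n, integrated; its linear term has mean 0.\<close>
  have moment_le: "(\<integral>\<omega>. S n \<omega> ^ p \<partial>M) \<le> (\<integral>\<omega>. Y \<omega> ^ p \<partial>M)" for n
  proof -
    obtain k where k: "p = Suc k" using p by (cases p) auto
    have meas: "(\<lambda>\<omega>. S n \<omega> ^ k) \<in> borel_measurable (F n)" using adapted[of n] by measurable
    have int: "integrable M (\<lambda>\<omega>. S n \<omega> ^ k * Y \<omega>)"
    proof (rule Bochner_Integration.integrable_bound)
      show "integrable M (\<lambda>\<omega>. S n \<omega> ^ p + Y \<omega> ^ p)" using S_int Y_int by simp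
      show "AE \<omega> in M. norm (S n \<omega> ^ k * Y \<omega>) \<le> norm (S n \<omega> ^ p + Y \<omega> ^ p)"
        using mixed_power_le nonneg Y_nn k by simp
    qed measurable
    note eq = integral_mult_adapted[OF Y_int1 Y_nn Y_mart meas int]
    have "(\<integral>\<omega>. S n \<omega> ^ p \<partial>M) = (\<integral>\<omega>. S n \<omega> ^ p + real p * (S n \<omega> ^ k * Y \<omega> - S n \<omega> ^ k * S n \<omega>) \<partial>M)"
      using S_int[of p n] int eq by simp
    also have "\<dots> \<le> (\<integral>\<omega>. Y \<omega> ^ p \<partial>M)"
    proof (rule integral_mono)
      fix \<omega> show "S n \<omega> ^ p + real p * (S n \<omega> ^ k * Y \<omega> - S n \<omega> ^ k * S n \<omega>) \<le> Y \<omega> ^ p"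
        using power_tangent_le[OF nonneg Y_nn, of n \<omega> k \<omega>] by (simp add: k algebra_simps)
    qed (use S_int[of p n] Y_int[of p] int eq in simp_all)
    finally show ?thesis .
  qed
  have pow: "(\<lambda>n. \<integral>\<^sup>+\<omega>. norm (S n \<omega> ^ p - Y \<omega> ^ p) \<partial>M) \<longlonglongrightarrow> 0"
  proof (rule Scheffe_lemma1)
    show "AE \<omega> in M. (\<lambda>n. S n \<omega> ^ p) \<longlonglongrightarrow> Y \<omega> ^ p" using lim by eventually_elim (intro tendsto_intros)
    have "(\<integral>\<^sup>+\<omega>. norm (S n \<omega> ^ p) \<partial>M) \<le> (\<integral>\<^sup>+\<omega>. norm (Y \<omega> ^ p) \<partial>M)" for n
      using moment_le[of n] S_int[of p n] Y_int[of p] nonneg Y_nn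
      by (simp add: nn_integral_eq_integral ennreal_leI)
    then show "limsup (\<lambda>n. \<integral>\<^sup>+\<omega>. norm (S n \<omega> ^ p) \<partial>M) \<le> (\<integral>\<^sup>+\<omega>. norm (Y \<omega> ^ p) \<partial>M)"
      by (intro Limsup_bounded always_eventually) auto
  qed (use S_int Y_int in auto)
  have Lp: "(\<lambda>n. \<integral>\<^sup>+\<omega>. ennreal (\<bar>S n \<omega> - Y \<omega>\<bar> ^ p) \<partial>M) \<longlonglongrightarrow> 0"
  proof (rule tendsto_sandwich[OF _ _ tendsto_const pow])
    show "\<forall>\<^sub>F n in sequentially. (\<integral>\<^sup>+\<omega>. ennreal (\<bar>S n \<omega> - Y \<omega>\<bar> ^ p) \<partial>M) \<le> (\<integral>\<^sup>+\<omega>. norm (S n \<omega> ^ p - Y \<omega> ^ p) \<partial>M)"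
      using abs_diff_power_le[OF nonneg Y_nn] p by (intro always_eventually allI nn_integral_mono) (auto intro!: ennreal_leI)
  qed auto
  have "(\<integral>\<^sup>+\<omega>. ennreal (Y \<omega>) \<partial>M) = (\<integral>\<^sup>+\<omega>. ennreal (S 0 \<omega>) \<partial>M)"
  proof -
    have "space M \<in> sets (F 0)" using subalg[of 0] by (metis sets.top subalgebra_def)
    from Y_mart[OF this] show ?thesis
      by (simp cong: nn_integral_cong_simp)
  qed
  then show ?thesis using that[of Y] Y_meas Y_nn lim Lp by blast
qed

end

section \<open>The Gaussian cascade and its moment formula\<close>

text \<open>
  Completing the square in the normal density. For an almost surely constant variable both sides
  are 1, since the constant is the mean.
\<close>

lemma (in prob_space) gaussian_rv_exp:
  assumes Y: "gaussian_rv M Y" and mean: "expectation Y = 0"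
  shows "(\<integral>\<^sup>+\<omega>. ennreal (exp (Y \<omega>)) \<partial>M) = ennreal (exp (expectation (\<lambda>\<omega>. (Y \<omega>)\<^sup>2) / 2))"
proof -
  consider (normal) m v where "0 < v" "distributed M lborel Y (\<lambda>x. ennreal (normal_density m v x))"
    | (const) m where "AE \<omega> in M. Y \<omega> = m" "Y \<in> borel_measurable M"
    using Y unfolding gaussian_rv_def by blast
  then show ?thesis
  proof cases
    case normal
    have m: "m = 0" using normal_distributed_expectation[OF normal] mean by simp
    have var: "expectation (\<lambda>\<omega>. (Y \<omega>)\<^sup>2) = v\<^sup>2" using normal_distributed_variance[OF normal] mean by simp
    have eq: "normal_density 0 v x * exp x = exp (v\<^sup>2 / 2) * normal_density (v\<^sup>2) v x" for x
    proof -
      have "- x\<^sup>2 / (2 * v\<^sup>2) + x = v\<^sup>2 / 2 + - (x - v\<^sup>2)\<^sup>2 / (2 * v\<^sup>2)"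
        using normal(1) by (simp add: field_simps power2_eq_square)
      then have "exp (- x\<^sup>2 / (2 * v\<^sup>2)) * exp x = exp (v\<^sup>2 / 2) * exp (- (x - v\<^sup>2)\<^sup>2 / (2 * v\<^sup>2))"
        by (simp only: exp_add[symmetric])
      then show ?thesis by (simp add: normal_density_def)
    qed
    have "(\<integral>\<^sup>+\<omega>. ennreal (exp (Y \<omega>)) \<partial>M) = (\<integral>\<^sup>+x. ennreal (normal_density 0 v x) * ennreal (exp x) \<partial>lborel)"
      using normal m by (subst distributed_nn_integral[symmetric]) auto
    also have "\<dots> = (\<integral>\<^sup>+x. ennreal (exp (v\<^sup>2 / 2)) * ennreal (normal_density (v\<^sup>2) v x) \<partial>lborel)"
      by (intro nn_integral_cong) (simp add: ennreal_mult[symmetric] eq)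
    also have "\<dots> = ennreal (exp (v\<^sup>2 / 2)) * (\<integral>\<^sup>+x. ennreal (normal_density (v\<^sup>2) v x) \<partial>lborel)"
      by (rule nn_integral_cmult) simp
    also have "(\<integral>\<^sup>+x. ennreal (normal_density (v\<^sup>2) v x) \<partial>lborel) = 1"
      using normal(1) by (subst nn_integral_eq_integral) (auto simp: integral_normal_density)
    finally show ?thesis by (simp add: var)
  next
    case const
    have "expectation Y = (\<integral>\<omega>. m \<partial>M)" by (rule integral_cong_AE) (use const in auto)
    then have m: "m = 0" using mean by (simp add: prob_space)
    have "expectation (\<lambda>\<omega>. (Y \<omega>)\<^sup>2) = (\<integral>\<omega>. 0 \<partial>M)" by (rule integral_cong_AE) (use const m in auto)
    moreover have "(\<integral>\<^sup>+\<omega>. ennreal (exp (Y \<omega>)) \<partial>M) = (\<integral>\<^sup>+\<omega>. 1 \<partial>M)"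
      by (rule nn_integral_cong_AE) (use const m in auto)
    ultimately show ?thesis by (simp add: emeasure_space_1)
  qed
qed

lemma measurable_sphere_measure_id: "(\<lambda>x. x) \<in> borel_measurable sphere_measure"
  by (subst measurable_cong_sets[OF sets_sphere_measure refl]) (rule measurable_restrict_space1, simp)

(* From here on the sigma-algebra of sphere_measure is kept abstract, so that it has a single form
   as a factor of product spaces. *)
declare sets_sphere_measure [measurable_cong del, simp del]

locale gaussian_cascade = prob_space M for M :: "'w measure" +
  fixes X :: "nat \<Rightarrow> 'u::euclidean_space \<Rightarrow> 'w \<Rightarrow> real" and r :: "real \<Rightarrow> real" and b s :: real and d p :: nat
  assumes d: "1 \<le> d" and DIM: "DIM('u) = Suc d"
    and X_joint: "(\<lambda>(u, \<omega>). X i u \<omega>) \<in> borel_measurable (borel \<Otimes>\<^sub>M M)"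
    and iid: "iid_fields M X"
    and gauss: "gaussian_field M (X i)"
    and sq_int: "integrable M (\<lambda>\<omega>. (X i u \<omega>)\<^sup>2)"
    and mean: "expectation (X i u) = 0"
    and variance: "variance (X i u) = s\<^sup>2" and s: "s\<^sup>2 > 0"
    and cov: "expectation (\<lambda>\<omega>. X i u \<omega> * X i v \<omega>) = r (norm (u - v))"
    and b: "1 < b" and r_antimono: "antimono_on {0..} r"
    and p: "2 \<le> p" and b_large: "exp (real p * (real p - 1) * s\<^sup>2 / (2 * real d)) < b"
    and r_summable: "summable (\<lambda>i. r (b ^ i))"
    and r_summable': "summable (\<lambda>i. s\<^sup>2 - r (b powi (- int i)))"
begin

abbreviation \<sigma> :: "'u measure" where "\<sigma> \<equiv> sphere_measure"

sublocale \<sigma>: finite_measure \<sigma> by (rule finite_measure_sphere_measure)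

lemma X_measurable_pair [measurable (raw)]:
  assumes "f \<in> N \<rightarrow>\<^sub>M borel" "g \<in> N \<rightarrow>\<^sub>M M"
  shows "(\<lambda>x. X i (f x) (g x)) \<in> borel_measurable N"
  using measurable_compose[OF measurable_Pair[OF assms] X_joint[of i]] by simp

lemma r_0: "r 0 = s\<^sup>2"
  using cov[of 0 0 0] variance[of 0 0] mean[of 0 0] by (simp add: power2_eq_square)

lemma r_mono: "0 \<le> x \<Longrightarrow> x \<le> y \<Longrightarrow> r y \<le> r x"
  using r_antimono by (auto simp: monotone_on_def)

lemma r_le: "0 \<le> x \<Longrightarrow> r x \<le> s\<^sup>2" using r_mono[of 0 x] r_0 by simp

text \<open>
  A negative value of r would, by monotonicity, bound the terms r (b ^ i) away from 0.
\<close>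

lemma r_nonneg: "0 \<le> x \<Longrightarrow> 0 \<le> r x"
proof (rule ccontr)
  assume x: "0 \<le> x" "\<not> 0 \<le> r x"
  have lim: "(\<lambda>i. r (b ^ i)) \<longlonglongrightarrow> 0" by (rule summable_LIMSEQ_zero[OF r_summable])
  obtain n where n: "x < b ^ n" using real_arch_pow[OF b] by blast
  have "r (b ^ i) \<le> r x" if "n \<le> i" for i
    using power_increasing[OF that, of b] b n x by (intro r_mono) linarith+
  then have "0 \<le> r x" by (intro LIMSEQ_le_const2[OF lim]) blast
  then show False using x by simp
qed

lemma X_prod_int: "integrable M (\<lambda>\<omega>. X i u \<omega> * X i v \<omega>)"
proof (rule Bochner_Integration.integrable_bound)
  show "integrable M (\<lambda>\<omega>. (X i u \<omega>)\<^sup>2 + (X i v \<omega>)\<^sup>2)" using sq_int by simp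
  have "\<bar>x * y\<bar> \<le> x\<^sup>2 + y\<^sup>2" for x y :: real
  proof -
    have "2 * (x * y) \<le> x\<^sup>2 + y\<^sup>2" "2 * (- (x * y)) \<le> x\<^sup>2 + y\<^sup>2"
      using sum_squares_bound[of x y] sum_squares_bound[of "-x" y] by (auto simp: mult.assoc)
    then show ?thesis by (smt (verit) zero_le_power2)
  qed
  then show "AE \<omega> in M. norm (X i u \<omega> * X i v \<omega>) \<le> norm ((X i u \<omega>)\<^sup>2 + (X i v \<omega>)\<^sup>2)" by simp
qed measurable

lemma X_int: "integrable M (X i u)"
proof (rule Bochner_Integration.integrable_bound)
  show "integrable M (\<lambda>\<omega>. 1 + (X i u \<omega>)\<^sup>2)" using sq_int by simp
  have "\<bar>x\<bar> \<le> 1 + x\<^sup>2" for x :: real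
    using sum_squares_bound[of "\<bar>x\<bar>" 1] by simp
  then show "AE \<omega> in M. norm (X i u \<omega>) \<le> norm (1 + (X i u \<omega>)\<^sup>2)" by simp
qed measurable

text \<open>
  The points u j may coincide, while a Gaussian field is defined through combinations over sets of
  points; so coefficients with the same point are collected first.
\<close>

lemma exp_moment_single:
  assumes J: "finite J"
  shows "(\<integral>\<^sup>+\<omega>. ennreal (exp (\<Sum>j\<in>J. c j * X i (u j) \<omega>)) \<partial>M)
    = ennreal (exp ((\<Sum>j\<in>J. \<Sum>l\<in>J. c j * c l * r (norm (u j - u l))) / 2))"
proof -
  define Y where "Y = (\<lambda>\<omega>. \<Sum>j\<in>J. c j * X i (u j) \<omega>)"
  define a where "a v = (\<Sum>j\<in>{j\<in>J. u j = v}. c j)" for v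
  have Y_eq: "Y = (\<lambda>\<omega>. \<Sum>v\<in>u ` J. a v * X i v \<omega>)"
    unfolding Y_def a_def by (subst sum.image_gen[OF J, of _ u]) (auto simp: sum_distrib_right intro!: sum.cong)
  have "gaussian_rv M Y" using gauss[of i] J unfolding Y_eq gaussian_field_def by simp
  moreover have "expectation Y = 0" unfolding Y_def using X_int mean by simp
  ultimately have "(\<integral>\<^sup>+\<omega>. ennreal (exp (Y \<omega>)) \<partial>M) = ennreal (exp (expectation (\<lambda>\<omega>. (Y \<omega>)\<^sup>2) / 2))"
    by (rule gaussian_rv_exp)
  also have "expectation (\<lambda>\<omega>. (Y \<omega>)\<^sup>2) = expectation (\<lambda>\<omega>. \<Sum>j\<in>J. \<Sum>l\<in>J. c j * c l * (X i (u j) \<omega> * X i (u l) \<omega>))"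
    unfolding Y_def power2_eq_square sum_product by (simp add: ac_simps)
  also have "\<dots> = (\<Sum>j\<in>J. \<Sum>l\<in>J. c j * c l * r (norm (u j - u l)))"
    using X_prod_int cov by simp
  finally show ?thesis unfolding Y_def .
qed

lemma indep_fields: "indep_vars (\<lambda>_. Pi\<^sub>M UNIV (\<lambda>_. borel)) (\<lambda>i \<omega> u. X i u \<omega>) UNIV"
  using iid unfolding iid_fields_def by simp

lemma exp_moment:
  assumes J: "finite J"
  shows "(\<integral>\<^sup>+\<omega>. ennreal (exp (\<Sum>i\<le>N. \<Sum>j\<in>J. c i j * X i (u i j) \<omega>)) \<partial>M)
    = ennreal (exp (\<Sum>i\<le>N. (\<Sum>j\<in>J. \<Sum>l\<in>J. c i j * c i l * r (norm (u i j - u i l))) / 2))"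
proof -
  have "indep_vars (\<lambda>_. borel) (\<lambda>i \<omega>. ennreal (exp (\<Sum>j\<in>J. c i j * X i (u i j) \<omega>))) UNIV"
    by (rule indep_vars_compose2[OF indep_fields, of "\<lambda>i f. ennreal (exp (\<Sum>j\<in>J. c i j * f (u i j)))"]) measurable
  then have ind: "indep_vars (\<lambda>_. borel) (\<lambda>i \<omega>. ennreal (exp (\<Sum>j\<in>J. c i j * X i (u i j) \<omega>))) {..N}"
    by (rule indep_vars_subset) simp
  have "(\<integral>\<^sup>+\<omega>. ennreal (exp (\<Sum>i\<le>N. \<Sum>j\<in>J. c i j * X i (u i j) \<omega>)) \<partial>M)
      = (\<integral>\<^sup>+\<omega>. (\<Prod>i\<le>N. ennreal (exp (\<Sum>j\<in>J. c i j * X i (u i j) \<omega>))) \<partial>M)"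
    by (simp add: exp_sum prod_ennreal)
  also have "\<dots> = (\<Prod>i\<le>N. \<integral>\<^sup>+\<omega>. ennreal (exp (\<Sum>j\<in>J. c i j * X i (u i j) \<omega>)) \<partial>M)"
    by (rule indep_vars_nn_integral[OF _ ind]) auto
  also have "\<dots> = (\<Prod>i\<le>N. ennreal (exp ((\<Sum>j\<in>J. \<Sum>l\<in>J. c i j * c i l * r (norm (u i j - u i l))) / 2)))"
    by (simp add: exp_moment_single[OF J])
  also have "\<dots> = ennreal (exp (\<Sum>i\<le>N. (\<Sum>j\<in>J. \<Sum>l\<in>J. c i j * c i l * r (norm (u i j - u i l))) / 2))"
    by (simp add: exp_sum prod_ennreal)
  finally show ?thesis .
qed

text \<open>
  The density of the measure of level N: the mean of exp (X i u) is exp (s^2 / 2).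
\<close>

definition dens :: "nat \<Rightarrow> 'u \<Rightarrow> 'w \<Rightarrow> real" where
  "dens N \<theta> \<omega> = exp (\<Sum>i\<le>N. X i (b ^ i *\<^sub>R \<theta>) \<omega> - s\<^sup>2 / 2)"

lemma dens_meas [measurable (raw)]:
  assumes "f \<in> L \<rightarrow>\<^sub>M \<sigma>" and [measurable]: "g \<in> L \<rightarrow>\<^sub>M M"
  shows "(\<lambda>x. dens N (f x) (g x)) \<in> borel_measurable L"
proof -
  have [measurable]: "f \<in> L \<rightarrow>\<^sub>M borel"
    using measurable_compose[OF assms(1) measurable_sphere_measure_id] by simp
  show ?thesis unfolding dens_def by measurable
qed

lemma prod_Lambda: "(\<Prod>i\<le>N. Lambda M b X i \<theta> \<omega>) = dens N \<theta> \<omega>"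
proof -
  have "expectation (\<lambda>\<omega>. exp (X i u \<omega>)) = exp (s\<^sup>2 / 2)" for i u
    using exp_moment_single[of "{0::nat}" "\<lambda>_. 1" i "\<lambda>_. u"]
    by (subst integral_eq_nn_integral) (auto simp: r_0)
  then show ?thesis by (simp add: Lambda_def dens_def exp_sum exp_diff)
qed

definition mass :: "nat \<Rightarrow> 'u set \<Rightarrow> 'w \<Rightarrow> real" where
  "mass N B \<omega> = measure (approx_measure M b X N \<omega>) B"

lemma emeasure_approx:
  assumes "\<omega> \<in> space M" "B \<in> sets \<sigma>"
  shows "emeasure (approx_measure M b X N \<omega>) B = (\<integral>\<^sup>+\<theta>. ennreal (dens N \<theta> \<omega>) * indicator B \<theta> \<partial>\<sigma>)"
  unfolding approx_measure_def prod_Lambda using assms by (subst emeasure_density) auto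

lemma mass_meas [measurable]:
  assumes [measurable]: "B \<in> sets \<sigma>"
  shows "mass N B \<in> borel_measurable M"
proof -
  have "(\<lambda>\<omega>. enn2real (\<integral>\<^sup>+\<theta>. ennreal (dens N \<theta> \<omega>) * indicator B \<theta> \<partial>\<sigma>)) \<in> borel_measurable M"
    by measurable
  then show ?thesis
    by (rule measurable_cong[THEN iffD1, rotated]) (simp add: mass_def measure_def emeasure_approx[OF _ assms])
qed

lemma mass_nonneg: "0 \<le> mass N B \<omega>" by (simp add: mass_def)

lemma Fubini_prod:
  assumes "finite J" and [measurable]: "(\<lambda>(\<omega>, x). f \<omega> x) \<in> borel_measurable (M \<Otimes>\<^sub>M Pi\<^sub>M J (\<lambda>_. \<sigma>))"
  shows "(\<integral>\<^sup>+\<omega>. \<integral>\<^sup>+x. f \<omega> x \<partial>Pi\<^sub>M J (\<lambda>_. \<sigma>) \<partial>M) = (\<integral>\<^sup>+x. \<integral>\<^sup>+\<omega>. f \<omega> x \<partial>M \<partial>Pi\<^sub>M J (\<lambda>_. \<sigma>))"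
proof -
  interpret P: finite_product_sigma_finite "\<lambda>_. \<sigma>" J by standard (rule assms)
  interpret PP: pair_sigma_finite M "Pi\<^sub>M J (\<lambda>_. \<sigma>)" by standard
  show ?thesis by (rule PP.Fubini'[symmetric]) simp
qed

lemma Fubini_sphere:
  assumes [measurable]: "(\<lambda>(\<omega>, x). f \<omega> x) \<in> borel_measurable (M \<Otimes>\<^sub>M \<sigma>)"
  shows "(\<integral>\<^sup>+\<omega>. \<integral>\<^sup>+x. f \<omega> x \<partial>\<sigma> \<partial>M) = (\<integral>\<^sup>+x. \<integral>\<^sup>+\<omega>. f \<omega> x \<partial>M \<partial>\<sigma>)"
proof -
  interpret PP: pair_sigma_finite M \<sigma> by standard
  show ?thesis by (rule PP.Fubini'[symmetric]) simp
qed

text \<open>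
  The mass as an extended real. It agrees with mass unless it is infinite, which happens with
  probability 0; Tonelli's theorem applies to it without any integrability.
\<close>

definition emass :: "nat \<Rightarrow> 'u set \<Rightarrow> 'w \<Rightarrow> ennreal" where
  "emass N B \<omega> = (\<integral>\<^sup>+\<theta>. ennreal (dens N \<theta> \<omega>) * indicator B \<theta> \<partial>\<sigma>)"

lemma emass_meas [measurable]:
  assumes [measurable]: "B \<in> sets \<sigma>"
  shows "emass N B \<in> borel_measurable M"
  unfolding emass_def by measurable

text \<open>
  In the exponential moments below, the index 0 stands for the reference point with coefficient c
  on the first n levels, and the indices 1 to k for the k points of integration.
\<close>

definition weight :: "real \<Rightarrow> nat \<Rightarrow> nat \<Rightarrow> nat \<Rightarrow> real" where
  "weight c n i j = (if j = 0 then if i < n then c else 0 else 1)"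

text \<open>
  The variance at level i of the weighted sum of the values of the field at the points x 0, ..., x k.
\<close>

definition qform :: "real \<Rightarrow> nat \<Rightarrow> nat \<Rightarrow> nat \<Rightarrow> (nat \<Rightarrow> 'u) \<Rightarrow> real" where
  "qform c n k i x = (\<Sum>j\<le>k. \<Sum>l\<le>k. weight c n i j * weight c n i l * r (b ^ i * norm (x j - x l)))"

text \<open>
  The contribution of the first n levels to the logarithm of the density at \<theta>, without
  normalisation.
\<close>

definition coarse_field :: "nat \<Rightarrow> 'u \<Rightarrow> 'w \<Rightarrow> real" where
  "coarse_field n \<theta> \<omega> = (\<Sum>i<n. X i (b ^ i *\<^sub>R \<theta>) \<omega>)"

lemma coarse_field_meas [measurable]: "coarse_field n \<theta> \<in> borel_measurable M"
  unfolding coarse_field_def by measurable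

text \<open>
  The k-th power of a mass is an integral over k independent points, and for fixed points the
  integrand is the exponential of a Gaussian variable. The factor exp (c * coarse_field) tilts the
  probability measure; it will allow to factor out the behaviour of the first n levels.
\<close>

lemma moment_formula:
  assumes [measurable]: "B \<in> sets \<sigma>" and n: "n \<le> Suc N"
  shows "(\<integral>\<^sup>+\<omega>. ennreal (exp (c * coarse_field n \<theta> \<omega>)) * emass N B \<omega> ^ k \<partial>M) =
    (\<integral>\<^sup>+x. (\<Prod>j\<in>{1..k}. indicator B (x j)) *
       ennreal (exp (\<Sum>i\<le>N. (qform c n k i (x(0 := \<theta>)) - k * s\<^sup>2) / 2)) \<partial>Pi\<^sub>M {1..k} (\<lambda>_. \<sigma>))"
proof -
  interpret P: product_sigma_finite "\<lambda>_::nat. \<sigma>" by standard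
  let ?P = "Pi\<^sub>M {1..k} (\<lambda>_. \<sigma>)"
  have [measurable]: "(\<lambda>x. x j) \<in> ?P \<rightarrow>\<^sub>M borel" if "j \<in> {1..k}" for j
    using measurable_compose[OF measurable_component_singleton[OF that] measurable_sphere_measure_id] .
  have pow: "emass N B \<omega> ^ k = (\<integral>\<^sup>+x. (\<Prod>j\<in>{1..k}. ennreal (dens N (x j) \<omega>) * indicator B (x j)) \<partial>?P)"
    if "\<omega> \<in> space M" for \<omega>
    using that by (subst P.product_nn_integral_prod) (auto simp: emass_def)
  have "(\<integral>\<^sup>+\<omega>. ennreal (exp (c * coarse_field n \<theta> \<omega>)) * emass N B \<omega> ^ k \<partial>M)
      = (\<integral>\<^sup>+\<omega>. \<integral>\<^sup>+x. ennreal (exp (c * coarse_field n \<theta> \<omega>)) * (\<Prod>j\<in>{1..k}. ennreal (dens N (x j) \<omega>) * indicator B (x j)) \<partial>?P \<partial>M)"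
    by (intro nn_integral_cong, subst nn_integral_cmult) (auto simp: pow)
  also have "\<dots> = (\<integral>\<^sup>+x. \<integral>\<^sup>+\<omega>. ennreal (exp (c * coarse_field n \<theta> \<omega>)) * (\<Prod>j\<in>{1..k}. ennreal (dens N (x j) \<omega>) * indicator B (x j)) \<partial>M \<partial>?P)"
    by (rule Fubini_prod) auto
  also have "\<dots> = (\<integral>\<^sup>+x. (\<Prod>j\<in>{1..k}. indicator B (x j)) *
       ennreal (exp (\<Sum>i\<le>N. (qform c n k i (x(0 := \<theta>)) - k * s\<^sup>2) / 2)) \<partial>?P)"
  proof (rule nn_integral_cong)
    fix x :: "nat \<Rightarrow> 'u"
    define y where "y = x(0 := \<theta>)"
    have coarse_field_eq: "c * coarse_field n \<theta> \<omega> = (\<Sum>i\<le>N. weight c n i 0 * X i (b ^ i *\<^sub>R y 0) \<omega>)" for \<omega>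
    proof -
      have "c * coarse_field n \<theta> \<omega> = (\<Sum>i<n. weight c n i 0 * X i (b ^ i *\<^sub>R y 0) \<omega>)"
        unfolding coarse_field_def sum_distrib_left by (intro sum.cong) (auto simp: weight_def y_def)
      also have "\<dots> = (\<Sum>i\<le>N. weight c n i 0 * X i (b ^ i *\<^sub>R y 0) \<omega>)"
        by (rule sum.mono_neutral_left) (use n in \<open>auto simp: weight_def\<close>)
      finally show ?thesis .
    qed
    have split: "(\<Sum>j\<le>k. g j) = g 0 + (\<Sum>j\<in>{1..k}. g j)" for g :: "nat \<Rightarrow> real"
      by (simp add: atMost_atLeast0 sum.atLeast_Suc_atMost)
    have exp_eq: "exp (c * coarse_field n \<theta> \<omega>) * (\<Prod>j\<in>{1..k}. dens N (x j) \<omega>)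
        = exp (- (\<Sum>i\<le>N. k * s\<^sup>2 / 2)) * exp (\<Sum>i\<le>N. \<Sum>j\<le>k. weight c n i j * X i (b ^ i *\<^sub>R y j) \<omega>)" for \<omega>
    proof -
      have "(\<Sum>j\<in>{1..k}. \<Sum>i\<le>N. X i (b ^ i *\<^sub>R x j) \<omega> - s\<^sup>2 / 2)
          = (\<Sum>i\<le>N. \<Sum>j\<in>{1..k}. weight c n i j * X i (b ^ i *\<^sub>R y j) \<omega> - s\<^sup>2 / 2)"
        by (subst sum.swap) (auto simp: weight_def y_def intro!: sum.cong)
      then have "c * coarse_field n \<theta> \<omega> + (\<Sum>j\<in>{1..k}. \<Sum>i\<le>N. X i (b ^ i *\<^sub>R x j) \<omega> - s\<^sup>2 / 2)
          = - (\<Sum>i\<le>N. k * s\<^sup>2 / 2) + (\<Sum>i\<le>N. \<Sum>j\<le>k. weight c n i j * X i (b ^ i *\<^sub>R y j) \<omega>)"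
        unfolding coarse_field_eq split by (simp add: sum_subtractf sum.distrib algebra_simps)
      then show ?thesis
        by (simp only: dens_def exp_sum[symmetric] exp_add[symmetric] finite_atLeastAtMost)
    qed
    have "(\<integral>\<^sup>+\<omega>. ennreal (exp (c * coarse_field n \<theta> \<omega>)) * (\<Prod>j\<in>{1..k}. ennreal (dens N (x j) \<omega>) * indicator B (x j)) \<partial>M)
        = (\<integral>\<^sup>+\<omega>. ((\<Prod>j\<in>{1..k}. indicator B (x j)) * ennreal (exp (- (\<Sum>i\<le>N. k * s\<^sup>2 / 2)))) *
            ennreal (exp (\<Sum>i\<le>N. \<Sum>j\<le>k. weight c n i j * X i (b ^ i *\<^sub>R y j) \<omega>)) \<partial>M)"
    proof (rule nn_integral_cong)
      fix \<omega>
      have "ennreal (exp (c * coarse_field n \<theta> \<omega>)) * (\<Prod>j\<in>{1..k}. ennreal (dens N (x j) \<omega>) * indicator B (x j))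
        = (\<Prod>j\<in>{1..k}. indicator B (x j)) * ennreal (exp (c * coarse_field n \<theta> \<omega>) * (\<Prod>j\<in>{1..k}. dens N (x j) \<omega>))"
        by (simp add: prod.distrib ennreal_mult dens_def prod_ennreal prod_nonneg ac_simps)
      also have "\<dots> = ((\<Prod>j\<in>{1..k}. indicator B (x j)) * ennreal (exp (- (\<Sum>i\<le>N. k * s\<^sup>2 / 2)))) *
            ennreal (exp (\<Sum>i\<le>N. \<Sum>j\<le>k. weight c n i j * X i (b ^ i *\<^sub>R y j) \<omega>))"
        unfolding exp_eq by (simp add: ennreal_mult mult.assoc)
      finally show "ennreal (exp (c * coarse_field n \<theta> \<omega>)) * (\<Prod>j\<in>{1..k}. ennreal (dens N (x j) \<omega>) * indicator B (x j)) = \<dots>" .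
    qed
    also have "\<dots> = ((\<Prod>j\<in>{1..k}. indicator B (x j)) * ennreal (exp (- (\<Sum>i\<le>N. k * s\<^sup>2 / 2)))) *
        ennreal (exp (\<Sum>i\<le>N. (\<Sum>j\<le>k. \<Sum>l\<le>k. weight c n i j * weight c n i l * r (norm (b ^ i *\<^sub>R y j - b ^ i *\<^sub>R y l))) / 2))"
      by (subst nn_integral_cmult) (auto simp: exp_moment)
    also have "\<dots> = (\<Prod>j\<in>{1..k}. indicator B (x j)) * ennreal (exp (\<Sum>i\<le>N. (qform c n k i y - k * s\<^sup>2) / 2))"
    proof -
      have "norm (b ^ i *\<^sub>R y j - b ^ i *\<^sub>R y l) = b ^ i * norm (y j - y l)" for i j l
        using b by (simp add: scaleR_diff_right[symmetric])
      then have "exp (- (\<Sum>i\<le>N. k * s\<^sup>2 / 2)) * exp (\<Sum>i\<le>N. (\<Sum>j\<le>k. \<Sum>l\<le>k. weight c n i j * weight c n i l * r (norm (b ^ i *\<^sub>R y j - b ^ i *\<^sub>R y l))) / 2)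
        = exp (\<Sum>i\<le>N. (qform c n k i y - k * s\<^sup>2) / 2)"
        by (simp add: exp_add[symmetric] qform_def diff_divide_distrib sum_subtractf)
      then show ?thesis by (simp add: mult.assoc ennreal_mult[symmetric])
    qed
    finally show "(\<integral>\<^sup>+\<omega>. ennreal (exp (c * coarse_field n \<theta> \<omega>)) * (\<Prod>j\<in>{1..k}. ennreal (dens N (x j) \<omega>) * indicator B (x j)) \<partial>M)
      = (\<Prod>j\<in>{1..k}. indicator B (x j)) * ennreal (exp (\<Sum>i\<le>N. (qform c n k i (x(0 := \<theta>)) - k * s\<^sup>2) / 2))"
      unfolding y_def .
  qed
  finally show ?thesis .
qed

section \<open>Bounds for tilted integer moments\<close>

text \<open>
  The two series of the hypothesis: correlations at distances 1, b, b^2, ..., and defects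
  from full correlation at distances 1, 1 / b, 1 / b^2, ....
\<close>

definition R_out :: real where "R_out = (\<Sum>i. r (b ^ i))"
definition R_in :: real where "R_in = (\<Sum>i. s\<^sup>2 - r (b powi (- int i)))"

lemma b_pow_pos: "0 < b ^ n" using b by simp

lemma sum_r_le_R_out: "finite A \<Longrightarrow> (\<Sum>i\<in>A. r (b ^ i)) \<le> R_out"
  unfolding R_out_def by (rule sum_le_suminf[OF r_summable]) (use b in \<open>auto intro!: r_nonneg\<close>)

lemma sum_r_le_R_in: "finite A \<Longrightarrow> (\<Sum>i\<in>A. s\<^sup>2 - r (b powi (- int i))) \<le> R_in"
  unfolding R_in_def by (rule sum_le_suminf[OF r_summable']) (use b in \<open>auto intro!: r_le\<close>)

text \<open>
  The diameter, up to the factor b^a, at which the first n levels stop being nearly constant.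
\<close>

definition scale :: "nat \<Rightarrow> nat \<Rightarrow> real" where "scale a n = b ^ a / b ^ n"

lemma scale_pos: "0 < scale a n" using b by (simp add: scale_def)

text \<open>
  At distance b^(a-n), level i is seen at distance b^(a-n+i). All but the last a of the first n
  levels are seen at distances b^(-1), b^(-2), ..., so their defects sum to at most R_in.
\<close>

lemma coarse_defect:
  "(\<Sum>i<n. s\<^sup>2 - r (b ^ i * scale a n)) \<le> a * s\<^sup>2 + R_in"
proof -
  define g where "g j = s\<^sup>2 - r (b powi (- int j))" for j
  have g: "0 \<le> g j" for j unfolding g_def using b by (simp add: r_le)
  have "(\<Sum>i<n. s\<^sup>2 - r (b ^ i * scale a n))
      \<le> (\<Sum>i<n. (if n \<le> i + a then s\<^sup>2 else 0) + (if n \<le> i + a then 0 else g (n - (i + a))))"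
  proof (rule sum_mono)
    fix i assume "i \<in> {..<n}"
    show "s\<^sup>2 - r (b ^ i * scale a n) \<le> (if n \<le> i + a then s\<^sup>2 else 0) + (if n \<le> i + a then 0 else g (n - (i + a)))"
    proof (cases "n \<le> i + a")
      case True
      then show ?thesis using r_nonneg[of "b ^ i * scale a n"] b scale_pos[of a n] by simp
    next
      case False
      have "b ^ i * scale a n = b ^ (i + a) / b ^ n" by (simp add: scale_def power_add)
      also have "b ^ n = b ^ (i + a) * b ^ (n - (i + a))" using False by (simp add: power_add[symmetric])
      finally have "b ^ i * scale a n = inverse (b ^ (n - (i + a)))" using b by (simp add: field_simps)
      also have "\<dots> = b powi (- int (n - (i + a)))" by (simp only: power_int_minus power_int_of_nat)
      finally show ?thesis using False by (simp add: g_def)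
    qed
  qed
  also have "\<dots> = (\<Sum>i<n. if n \<le> i + a then s\<^sup>2 else 0) + (\<Sum>i<n. if n \<le> i + a then 0 else g (n - (i + a)))"
    by (rule sum.distrib)
  also have "(\<Sum>i<n. if n \<le> i + a then s\<^sup>2 else 0) = real (card {i\<in>{..<n}. n \<le> i + a}) * s\<^sup>2"
    by (simp add: sum.inter_filter[symmetric])
  also have "card {i\<in>{..<n}. n \<le> i + a} \<le> a"
  proof -
    have "{i\<in>{..<n}. n \<le> i + a} \<subseteq> {n - a..<n}" by auto
    then have "card {i\<in>{..<n}. n \<le> i + a} \<le> card {n - a..<n}" by (intro card_mono) auto
    then show ?thesis by simp
  qed
  also have "(\<Sum>i<n. if n \<le> i + a then 0 else g (n - (i + a))) = (\<Sum>i\<in>{i\<in>{..<n}. \<not> n \<le> i + a}. g (n - (i + a)))"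
    by (subst sum.inter_filter) (auto intro!: sum.cong)
  also have "\<dots> = (\<Sum>j\<in>(\<lambda>i. n - (i + a)) ` {i\<in>{..<n}. \<not> n \<le> i + a}. g j)"
    by (subst sum.reindex) (auto simp: inj_on_def)
  also have "\<dots> \<le> R_in" unfolding g_def by (rule sum_r_le_R_in) simp
  finally show ?thesis by (simp add: mult_right_mono)
qed

text \<open>
  The covariance accumulated by the levels n to N between points at distance t.
\<close>

definition fine_cov :: "nat \<Rightarrow> nat \<Rightarrow> real \<Rightarrow> real" where
  "fine_cov n N t = (\<Sum>i\<in>{n..N}. r (b ^ i * t))"

lemma fine_cov_nonneg: "0 \<le> t \<Longrightarrow> 0 \<le> fine_cov n N t"
  unfolding fine_cov_def using b by (intro sum_nonneg r_nonneg) simp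

text \<open>
  If t is about scale a n / b^m, then the first m + 1 of the levels contribute at most s^2 each; the
  later ones see the points at distances at least 1, b, b^2, ... and contribute at most R_out
  together. Thus exp (fine_cov n N t) is bounded by a multiple of (t / scale a n)^(- s^2 / ln b),
  uniformly in N.
\<close>

lemma fine_cov_shell:
  assumes t: "0 \<le> t" "t \<le> scale a n"
  obtains m where "t \<le> scale a n / b ^ m" "fine_cov n N t \<le> s\<^sup>2 * (real m + 1) + R_out"
proof -
  \<comment> \<open>The bound m \<le> N makes the shell exist also for t = 0.\<close>
  define m where "m = (GREATEST m. m \<le> N \<and> t \<le> scale a n / b ^ m)"
  have ex: "0 \<le> N \<and> t \<le> scale a n / b ^ 0" using t by simp
  have m: "m \<le> N \<and> t \<le> scale a n / b ^ m"
    unfolding m_def by (rule GreatestI_nat[where P="\<lambda>m. m \<le> N \<and> t \<le> scale a n / b ^ m", OF ex]) auto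
  have far: "scale a n / b ^ Suc m < t" if "m < N"
  proof (rule ccontr)
    assume "\<not> ?thesis"
    then have "Suc m \<le> N \<and> t \<le> scale a n / b ^ Suc m" using that by simp
    then have "Suc m \<le> m" unfolding m_def
      by (rule Greatest_le_nat[where P="\<lambda>m. m \<le> N \<and> t \<le> scale a n / b ^ m"]) auto
    then show False by simp
  qed
  have "fine_cov n N t \<le> (\<Sum>i\<in>{n..N}. (if i \<le> n + m then s\<^sup>2 else 0) + (if i \<le> n + m then 0 else r (b ^ (i - (n + m + 1)))))"
    unfolding fine_cov_def
  proof (rule sum_mono)
    fix i assume i: "i \<in> {n..N}"
    show "r (b ^ i * t) \<le> (if i \<le> n + m then s\<^sup>2 else 0) + (if i \<le> n + m then 0 else r (b ^ (i - (n + m + 1))))"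
    proof (cases "i \<le> n + m")
      case True
      then show ?thesis using r_le[of "b ^ i * t"] b t by simp
    next
      case False
      then have "m < N" using i by auto
      define e where "e = i - (n + m + 1)"
      have "i = e + n + Suc m" using False by (simp add: e_def)
      then have "b ^ i = b ^ e * b ^ n * b ^ Suc m" by (simp add: power_add)
      then have "b ^ i = b ^ (i - (n + m + 1)) * b ^ n * b ^ Suc m" by (simp only: e_def)
      then have "b ^ (i - (n + m + 1)) * b ^ a = b ^ i * (scale a n / b ^ Suc m)"
        using b by (simp add: scale_def)
      also have "\<dots> \<le> b ^ i * t" using far[OF \<open>m < N\<close>] b by (intro mult_left_mono) auto
      finally have "b ^ (i - (n + m + 1)) * b ^ a \<le> b ^ i * t" .
      moreover have "b ^ (i - (n + m + 1)) * 1 \<le> b ^ (i - (n + m + 1)) * b ^ a"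
        using b by (intro mult_left_mono one_le_power) auto
      ultimately have "b ^ (i - (n + m + 1)) \<le> b ^ i * t" by linarith
      then have "r (b ^ i * t) \<le> r (b ^ (i - (n + m + 1)))"
        using b by (intro r_mono) auto
      then show ?thesis using False by simp
    qed
  qed
  also have "\<dots> = (\<Sum>i\<in>{n..N}. if i \<le> n + m then s\<^sup>2 else 0) + (\<Sum>i\<in>{n..N}. if i \<le> n + m then 0 else r (b ^ (i - (n + m + 1))))"
    by (rule sum.distrib)
  also have "(\<Sum>i\<in>{n..N}. if i \<le> n + m then s\<^sup>2 else 0) = real (card {i\<in>{n..N}. i \<le> n + m}) * s\<^sup>2"
    by (simp add: sum.inter_filter[symmetric])
  also have "card {i\<in>{n..N}. i \<le> n + m} \<le> m + 1"
  proof -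
    have "{i\<in>{n..N}. i \<le> n + m} \<subseteq> {n..n + m}" by auto
    then have "card {i\<in>{n..N}. i \<le> n + m} \<le> card {n..n + m}" by (intro card_mono) auto
    then show ?thesis by simp
  qed
  also have "(\<Sum>i\<in>{n..N}. if i \<le> n + m then 0 else r (b ^ (i - (n + m + 1)))) = (\<Sum>i\<in>{i\<in>{n..N}. \<not> i \<le> n + m}. r (b ^ (i - (n + m + 1))))"
    by (subst sum.inter_filter) (auto intro!: sum.cong)
  also have "\<dots> = (\<Sum>j\<in>(\<lambda>i. i - (n + m + 1)) ` {i\<in>{n..N}. \<not> i \<le> n + m}. r (b ^ j))"
    by (subst sum.reindex) (auto simp: inj_on_def)
  also have "\<dots> \<le> R_out" by (rule sum_r_le_R_out) simp
  finally have "fine_cov n N t \<le> s\<^sup>2 * (real m + 1) + R_out" by (simp add: mult_right_mono mult.commute add.commute)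
  then show ?thesis using that m by blast
qed

definition cap_const :: real where
  "cap_const = real (Suc d) * unit_ball_vol (Suc d) * 2 ^ (d + 2)"

lemma cap_const_pos: "0 < cap_const" unfolding cap_const_def by simp

lemma cap_le:
  assumes "norm y = 1" "0 < u"
  shows "emeasure \<sigma> {x \<in> sphere 0 1. norm (x - y) \<le> u} \<le> ennreal (cap_const * u ^ d)"
  using emeasure_sphere_measure_cap_le[OF DIM assms] by (simp add: cap_const_def)

lemma borel_subset_sphere_in_sets: "A \<in> sets borel \<Longrightarrow> A \<subseteq> sphere 0 1 \<Longrightarrow> A \<in> sets \<sigma>"
  by (auto simp: sets_sphere_measure sets_restrict_space)

lemma cap_sets: "{x \<in> sphere 0 1. norm (x - y) \<le> u} \<in> sets \<sigma>"
  by (rule borel_subset_sphere_in_sets) auto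

lemma sphere_sets: "sphere 0 1 \<in> sets \<sigma>" by (rule borel_subset_sphere_in_sets) auto

lemma emeasure_cap_ge:
  assumes "norm y = 1" "0 < u" "u \<le> 1"
  shows "ennreal (unit_ball_vol (Suc d) / 8 ^ Suc d * u ^ d) \<le> emeasure \<sigma> {x \<in> sphere 0 1. norm (x - y) \<le> u}"
  by (rule emeasure_sphere_measure_cap_ge[OF DIM assms])

lemma norm_eq_1_of_mem_sets: "B \<in> sets \<sigma> \<Longrightarrow> x \<in> B \<Longrightarrow> norm x = 1"
  using sets.sets_into_space[of B \<sigma>] by auto

lemma fine_cov_meas [measurable (raw)]:
  fixes f g :: "'z \<Rightarrow> 'u"
  assumes [measurable]: "f \<in> borel_measurable L" "g \<in> borel_measurable L"
  shows "(\<lambda>x. fine_cov n N (norm (f x - g x))) \<in> borel_measurable L"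
proof -
  have "mono (\<lambda>t. - r (max 0 t))" by (intro monoI) (auto intro!: r_mono)
  then have "(\<lambda>t. - (- r (max 0 t))) \<in> borel_measurable borel"
    by (intro borel_measurable_uminus borel_measurable_mono)
  then have [measurable]: "(\<lambda>t. r (max 0 t)) \<in> borel_measurable borel" by simp
  have "fine_cov n N (norm (f x - g x)) = (\<Sum>i\<in>{n..N}. r (max 0 (b ^ i * norm (f x - g x))))" for x
    unfolding fine_cov_def using b by (simp add: max_absorb2)
  then show ?thesis by simp
qed

text \<open>
  The cap of index m has measure of order (scale a n / b^m)^d and the integrand there is of
  order exp (K s^2)^m, so the integral is a geometric series. Its convergence is what the lower
  bound on b is for.
\<close>

lemma kernel_integral:
  assumes K: "0 \<le> K" "exp (K * s\<^sup>2) < b ^ d" and B: "B \<in> sets \<sigma>" and y: "norm y = 1"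
    and diam: "\<And>x. x \<in> B \<Longrightarrow> norm (x - y) \<le> scale a n"
  shows "(\<integral>\<^sup>+x. indicator B x * ennreal (exp (K * fine_cov n N (norm (x - y)))) \<partial>\<sigma>)
    \<le> ennreal (cap_const * exp (K * (s\<^sup>2 + R_out)) * (1 / (1 - exp (K * s\<^sup>2) / b ^ d)) * scale a n ^ d)"
proof -
  define \<rho> where "\<rho> = exp (K * s\<^sup>2) / b ^ d"
  have \<rho>: "0 \<le> \<rho>" "\<rho> < 1" using K b by (auto simp: \<rho>_def)
  define cp where "cp = (\<lambda>m. {x \<in> sphere 0 1. norm (x - y) \<le> scale a n / b ^ m})"
  have cp_sets [measurable]: "cp m \<in> sets \<sigma>" for m unfolding cp_def by (rule cap_sets)
  let ?w = "\<lambda>m::nat. ennreal (exp (K * (s\<^sup>2 * (real m + 1) + R_out)))"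
  note [measurable] = B
  have "(\<integral>\<^sup>+x. indicator B x * ennreal (exp (K * fine_cov n N (norm (x - y)))) \<partial>\<sigma>)
      \<le> (\<integral>\<^sup>+x. (\<Sum>m. ?w m * indicator (cp m) x) \<partial>\<sigma>)"
  proof (rule nn_integral_mono)
    fix x assume x: "x \<in> space \<sigma>"
    show "indicator B x * ennreal (exp (K * fine_cov n N (norm (x - y)))) \<le> (\<Sum>m. ?w m * indicator (cp m) x)"
    proof (cases "x \<in> B")
      case True
      obtain m where m: "norm (x - y) \<le> scale a n / b ^ m" "fine_cov n N (norm (x - y)) \<le> s\<^sup>2 * (real m + 1) + R_out"
        using fine_cov_shell[OF norm_ge_zero diam[OF True]] by blast
      have "indicator B x * ennreal (exp (K * fine_cov n N (norm (x - y)))) \<le> ?w m * indicator (cp m) x"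
        using True m x K by (auto simp: cp_def intro!: ennreal_leI mult_left_mono)
      also have "\<dots> \<le> (\<Sum>m. ?w m * indicator (cp m) x)"
      proof -
        have "(\<Sum>m\<in>{m}. ?w m * indicator (cp m) x) \<le> (\<Sum>m. ?w m * indicator (cp m) x)"
          by (rule sum_le_suminf) auto
        then show ?thesis by (simp only: sum.insert[OF finite.emptyI] empty_iff sum.empty add_0_right simp_thms)
      qed
      finally show ?thesis .
    qed simp
  qed
  also have "\<dots> = (\<Sum>m. ?w m * emeasure \<sigma> (cp m))"
    by (subst nn_integral_suminf) (auto simp: nn_integral_cmult_indicator)
  also have "\<dots> \<le> (\<Sum>m. ?w m * ennreal (cap_const * (scale a n / b ^ m) ^ d))"
    unfolding cp_def using y scale_pos b by (intro suminf_le mult_left_mono cap_le) auto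
  also have "\<dots> = (\<Sum>m. ennreal (cap_const * exp (K * (s\<^sup>2 + R_out)) * scale a n ^ d * \<rho> ^ m))"
  proof (rule arg_cong[where f=suminf], rule ext)
    fix m
    have "exp (K * (s\<^sup>2 * (real m + 1) + R_out)) = exp (K * (s\<^sup>2 + R_out)) * exp (K * s\<^sup>2) ^ m"
      by (simp add: exp_of_nat_mult[symmetric] exp_add[symmetric] algebra_simps)
    moreover have "(scale a n / b ^ m) ^ d = scale a n ^ d * (1 / b ^ d) ^ m"
      by (simp add: power_divide power_mult[symmetric] mult.commute)
    moreover have "(b ^ m) ^ d = (b ^ d) ^ m" by (simp add: power_mult[symmetric] mult.commute)
    ultimately have "exp (K * (s\<^sup>2 * (real m + 1) + R_out)) * (cap_const * (scale a n / b ^ m) ^ d)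
        = cap_const * exp (K * (s\<^sup>2 + R_out)) * scale a n ^ d * \<rho> ^ m"
      by (simp add: \<rho>_def power_divide)
    moreover have "?w m * ennreal (cap_const * (scale a n / b ^ m) ^ d)
        = ennreal (exp (K * (s\<^sup>2 * (real m + 1) + R_out)) * (cap_const * (scale a n / b ^ m) ^ d))"
      using cap_const_pos scale_pos[of a n] b by (intro ennreal_mult[symmetric]) auto
    ultimately show "?w m * ennreal (cap_const * (scale a n / b ^ m) ^ d)
        = ennreal (cap_const * exp (K * (s\<^sup>2 + R_out)) * scale a n ^ d * \<rho> ^ m)"
      by (simp only:)
  qed
  also have "\<dots> = ennreal (\<Sum>m. cap_const * exp (K * (s\<^sup>2 + R_out)) * scale a n ^ d * \<rho> ^ m)"
    using \<rho> cap_const_pos scale_pos[of a n]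
    by (intro suminf_ennreal2) (auto intro!: summable_mult summable_geometric)
  also have "(\<Sum>m. cap_const * exp (K * (s\<^sup>2 + R_out)) * scale a n ^ d * \<rho> ^ m)
      = cap_const * exp (K * (s\<^sup>2 + R_out)) * scale a n ^ d * (1 / (1 - \<rho>))"
    using \<rho> by (subst suminf_mult) (auto simp: suminf_geometric summable_geometric)
  finally show ?thesis by (simp add: \<rho>_def mult_ac)
qed

text \<open>
  The lower bound on b, for the number k (k - 1) / 2 of unordered pairs among k \<le> p points.
\<close>

lemma exp_pair_count_less:
  assumes "k \<le> p"
  shows "exp (real (k * (k - 1)) / 2 * s\<^sup>2) < b ^ d"
proof -
  have kp: "real (k * (k - 1)) \<le> real p * (real p - 1)"
  proof -
    have "k * (k - 1) \<le> p * (p - 1)" using assms by (intro mult_mono) auto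
    then have "real (k * (k - 1)) \<le> real (p * (p - 1))" by (simp only: of_nat_le_iff)
    then show ?thesis using p by (simp add: of_nat_diff)
  qed
  have "exp (real (k * (k - 1)) / 2 * s\<^sup>2) \<le> exp (real p * (real p - 1) / 2 * s\<^sup>2)"
    using kp by (simp add: mult_right_mono)
  also have "\<dots> = exp (real p * (real p - 1) * s\<^sup>2 / (2 * real d)) ^ d"
    using d by (simp add: exp_of_nat_mult[symmetric])
  also have "\<dots> < b ^ d" using b_large d by (intro power_strict_mono) auto
  finally show ?thesis .
qed

lemma sum_weight: "(\<Sum>j\<le>k. weight c n i j) = (if i < n then c else 0) + real k"
proof -
  have "(\<Sum>j\<le>k. weight c n i j) = weight c n i 0 + (\<Sum>j\<in>{1..k}. weight c n i j)"
    by (simp add: atMost_atLeast0 sum.atLeast_Suc_atMost)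
  then show ?thesis by (simp add: weight_def)
qed

lemma sum_abs_weight: "i < n \<Longrightarrow> (\<Sum>j\<le>k. \<bar>weight c n i j\<bar>) = \<bar>c\<bar> + real k"
proof -
  have "(\<Sum>j\<le>k. \<bar>weight c n i j\<bar>) = \<bar>weight c n i 0\<bar> + (\<Sum>j\<in>{1..k}. \<bar>weight c n i j\<bar>)"
    by (simp add: atMost_atLeast0 sum.atLeast_Suc_atMost)
  then show "i < n \<Longrightarrow> ?thesis" by (simp add: weight_def)
qed

text \<open>
  If all correlations were s^2, the variance would be s^2 times the square of the total weight.
\<close>

lemma qform_coarse:
  assumes i: "i < n" and T: "\<And>j l. j \<le> k \<Longrightarrow> l \<le> k \<Longrightarrow> norm (x j - x l) \<le> T"
  shows "\<bar>qform c n k i x - (c + k)\<^sup>2 * s\<^sup>2\<bar> \<le> (\<bar>c\<bar> + k)\<^sup>2 * (s\<^sup>2 - r (b ^ i * T))"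
proof -
  let ?w = "weight c n i"
  have "(c + k)\<^sup>2 * s\<^sup>2 = (\<Sum>j\<le>k. \<Sum>l\<le>k. ?w j * ?w l * s\<^sup>2)"
    using i sum_weight[of c n i k] by (simp add: power2_eq_square sum_product[symmetric] sum_distrib_right[symmetric])
  then have "\<bar>qform c n k i x - (c + k)\<^sup>2 * s\<^sup>2\<bar> = \<bar>\<Sum>j\<le>k. \<Sum>l\<le>k. ?w j * ?w l * (r (b ^ i * norm (x j - x l)) - s\<^sup>2)\<bar>"
    by (simp add: qform_def sum_subtractf[symmetric] right_diff_distrib)
  also have "\<dots> \<le> (\<Sum>j\<le>k. \<Sum>l\<le>k. \<bar>?w j\<bar> * \<bar>?w l\<bar> * (s\<^sup>2 - r (b ^ i * T)))"
  proof (intro order_trans[OF sum_abs] sum_mono)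
    fix j l assume "j \<in> {..k}" "l \<in> {..k}"
    then have "norm (x j - x l) \<le> T" using T by simp
    then have "r (b ^ i * T) \<le> r (b ^ i * norm (x j - x l))" using b by (intro r_mono mult_left_mono) auto
    moreover have "r (b ^ i * norm (x j - x l)) \<le> s\<^sup>2" using b by (intro r_le) simp
    ultimately show "\<bar>?w j * ?w l * (r (b ^ i * norm (x j - x l)) - s\<^sup>2)\<bar> \<le> \<bar>?w j\<bar> * \<bar>?w l\<bar> * (s\<^sup>2 - r (b ^ i * T))"
      unfolding abs_mult by (intro mult_left_mono) auto
  qed
  also have "\<dots> = (\<bar>c\<bar> + k)\<^sup>2 * (s\<^sup>2 - r (b ^ i * T))"
    using sum_abs_weight[OF i, of c k] by (simp add: power2_eq_square sum_product[symmetric] sum_distrib_right[symmetric])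
  finally show ?thesis .
qed

definition pairs :: "nat \<Rightarrow> (nat \<times> nat) set" where
  "pairs k = {(j, l). j \<in> {1..k} \<and> l \<in> {1..k} \<and> j \<noteq> l}"

lemma finite_pairs: "finite (pairs k)"
  by (rule finite_subset[of _ "{1..k} \<times> {1..k}"]) (auto simp: pairs_def)

lemma card_pairs: "card (pairs k) = k * (k - 1)"
proof -
  have "pairs k = (SIGMA j:{1..k}. {1..k} - {j})" by (auto simp: pairs_def)
  then show ?thesis by (simp add: card_SigmaI)
qed

text \<open>
  On the fine levels the reference point has weight 0 and the diagonal contributes k s^2, which the
  normalisation of the density cancels; only the correlations of distinct points remain.
\<close>

lemma qform_fine:
  assumes i: "n \<le> i"
  shows "qform c n k i x - k * s\<^sup>2 = (\<Sum>(j, l)\<in>pairs k. r (b ^ i * norm (x j - x l)))"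
proof -
  define R where "R = (\<lambda>j l. r (b ^ i * norm (x j - x l)))"
  have split: "(\<Sum>j\<le>k. g j) = g 0 + (\<Sum>j\<in>{1..k}. g j)" for g :: "nat \<Rightarrow> real"
    by (simp add: atMost_atLeast0 sum.atLeast_Suc_atMost)
  have "qform c n k i x = (\<Sum>j\<in>{1..k}. \<Sum>l\<in>{1..k}. R j l)"
    unfolding qform_def split using i by (simp add: weight_def R_def)
  also have "\<dots> = (\<Sum>j\<in>{1..k}. s\<^sup>2 + (\<Sum>l\<in>{1..k} - {j}. R j l))"
  proof (intro sum.cong refl)
    fix j assume "j \<in> {1..k}"
    then have "(\<Sum>l\<in>{1..k}. R j l) = R j j + (\<Sum>l\<in>{1..k} - {j}. R j l)" by (intro sum.remove) auto
    then show "(\<Sum>l\<in>{1..k}. R j l) = s\<^sup>2 + (\<Sum>l\<in>{1..k} - {j}. R j l)" by (simp add: R_def r_0)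
  qed
  also have "\<dots> = k * s\<^sup>2 + (\<Sum>(j, l)\<in>(SIGMA j:{1..k}. {1..k} - {j}). R j l)"
    by (simp add: sum.distrib sum.Sigma)
  also have "(SIGMA j:{1..k}. {1..k} - {j}) = pairs k" by (auto simp: pairs_def)
  finally show ?thesis by (simp add: R_def)
qed

text \<open>
  For points within distance scale a n, the exponent in the moment formula is that of n perfectly
  correlated levels followed by the fine covariances, up to a constant that depends on neither
  n nor N.
\<close>

lemma exponent_bounds:
  assumes n: "n \<le> Suc N" and T: "\<And>j l. j \<le> k \<Longrightarrow> l \<le> k \<Longrightarrow> norm (x j - x l) \<le> scale a n"
  shows "\<bar>(\<Sum>i\<le>N. (qform c n k i x - k * s\<^sup>2) / 2) -
     (n * ((c + k)\<^sup>2 - k) * s\<^sup>2 / 2 + (\<Sum>(j, l)\<in>pairs k. fine_cov n N (norm (x j - x l))) / 2)\<bar>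
     \<le> (\<bar>c\<bar> + k)\<^sup>2 * (a * s\<^sup>2 + R_in) / 2"
proof -
  have "{..N} = {..<n} \<union> {n..N}" using n by auto
  then have "(\<Sum>i\<le>N. (qform c n k i x - k * s\<^sup>2) / 2)
      = (\<Sum>i<n. (qform c n k i x - k * s\<^sup>2) / 2) + (\<Sum>i\<in>{n..N}. (qform c n k i x - k * s\<^sup>2) / 2)"
    by (simp add: sum.union_disjoint ivl_disj_int)
  also have "(\<Sum>i\<in>{n..N}. (qform c n k i x - k * s\<^sup>2) / 2) = (\<Sum>(j, l)\<in>pairs k. fine_cov n N (norm (x j - x l))) / 2"
    unfolding fine_cov_def sum_divide_distrib[symmetric] using finite_pairs[of k]
    by (subst sum.cong[OF refl qform_fine]) (auto simp: case_prod_unfold intro: sum.swap)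
  finally have *: "(\<Sum>i\<le>N. (qform c n k i x - k * s\<^sup>2) / 2) -
     (n * ((c + k)\<^sup>2 - k) * s\<^sup>2 / 2 + (\<Sum>(j, l)\<in>pairs k. fine_cov n N (norm (x j - x l))) / 2)
     = (\<Sum>i<n. (qform c n k i x - (c + k)\<^sup>2 * s\<^sup>2) / 2)"
    by (simp add: sum_subtractf sum_divide_distrib[symmetric] diff_divide_distrib left_diff_distrib algebra_simps)
  have "\<bar>\<Sum>i<n. (qform c n k i x - (c + k)\<^sup>2 * s\<^sup>2) / 2\<bar> \<le> (\<Sum>i<n. \<bar>(qform c n k i x - (c + k)\<^sup>2 * s\<^sup>2) / 2\<bar>)"
    by (rule sum_abs)
  also have "\<dots> \<le> (\<Sum>i<n. (\<bar>c\<bar> + k)\<^sup>2 / 2 * (s\<^sup>2 - r (b ^ i * scale a n)))"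
    by (rule sum_mono) (use qform_coarse[OF _ T] in fastforce)
  also have "\<dots> = (\<bar>c\<bar> + k)\<^sup>2 / 2 * (\<Sum>i<n. s\<^sup>2 - r (b ^ i * scale a n))" by (rule sum_distrib_left[symmetric])
  also have "\<dots> \<le> (\<bar>c\<bar> + k)\<^sup>2 / 2 * (a * s\<^sup>2 + R_in)" by (intro mult_left_mono coarse_defect) simp
  finally show ?thesis unfolding * by simp
qed

text \<open>
  A sum is at most its number of terms times its largest term. This decouples the pairs at
  the price of multiplying each exponent by the number of pairs.
\<close>

lemma exp_sum_pairs_le:
  assumes P: "finite P" and f: "\<And>z. z \<in> P \<Longrightarrow> 0 \<le> (f z :: real)"
  shows "exp (sum f P / 2) \<le> 1 + (\<Sum>z\<in>P. exp (real (card P) / 2 * f z))"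
proof (cases "P = {}")
  case False
  have "Max (f ` P) \<in> f ` P" using P False by (intro Max_in) auto
  then obtain z where z: "z \<in> P" "f z = Max (f ` P)" by force
  have "sum f P \<le> real (card P) * f z" using sum_bounded_above[of P f "f z"] z P by simp
  then have "exp (sum f P / 2) \<le> exp (real (card P) / 2 * f z)" by simp
  also have "\<dots> \<le> (\<Sum>z\<in>P. exp (real (card P) / 2 * f z))"
    by (rule member_le_sum[OF z(1)]) (use P in auto)
  finally show ?thesis by simp
qed simp

lemma PiM_component_borel:
  assumes "j \<in> J"
  shows "(\<lambda>x. x j) \<in> Pi\<^sub>M J (\<lambda>_. \<sigma>) \<rightarrow>\<^sub>M borel"
  using measurable_compose[OF measurable_component_singleton[OF assms] measurable_sphere_measure_id] .

lemma indicator_prod: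
  assumes "finite J"
  shows "(\<Prod>j\<in>J. indicator B (x j)) = (if \<forall>j\<in>J. x j \<in> B then 1 else (0::ennreal))"
proof (cases "\<forall>j\<in>J. x j \<in> B")
  case False
  then obtain j where "j \<in> J" "x j \<notin> B" by blast
  then have "(\<Prod>j\<in>J. indicator B (x j)) = (0::ennreal)"
    by (intro prod_zero assms bexI[of _ j]) auto
  then show ?thesis using False by simp
qed simp

text \<open>
  Integrating over the point x j first, with x l fixed, gives at most D; the remaining points
  contribute the measure of B each.
\<close>

lemma pair_integral:
  fixes g :: "'u \<Rightarrow> 'u \<Rightarrow> ennreal"
  assumes jl: "j \<in> J" "l \<in> J" "j \<noteq> l" and J: "finite J" and B[measurable]: "B \<in> sets \<sigma>"
    and g [measurable]: "(\<lambda>x. g (x j) (x l)) \<in> borel_measurable (Pi\<^sub>M J (\<lambda>_. \<sigma>))"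
    and D: "\<And>y. y \<in> B \<Longrightarrow> (\<integral>\<^sup>+x. indicator B x * g x y \<partial>\<sigma>) \<le> D"
    and g': "\<And>y. y \<in> B \<Longrightarrow> (\<lambda>x. g x y) \<in> borel_measurable \<sigma>"
  shows "(\<integral>\<^sup>+x. (\<Prod>i\<in>J. indicator B (x i)) * g (x j) (x l) \<partial>Pi\<^sub>M J (\<lambda>_. \<sigma>)) \<le> D * emeasure \<sigma> B ^ (card J - 1)"
proof -
  interpret P: product_sigma_finite "\<lambda>_. \<sigma>" by standard
  define I where "I = J - {j}"
  have J_eq: "J = insert j I" and I: "finite I" "j \<notin> I" "l \<in> I" using jl J by (auto simp: I_def)
  have "(\<integral>\<^sup>+x. (\<Prod>i\<in>J. indicator B (x i)) * g (x j) (x l) \<partial>Pi\<^sub>M J (\<lambda>_. \<sigma>))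
      = (\<integral>\<^sup>+x. \<integral>\<^sup>+y. (\<Prod>i\<in>J. indicator B ((x(j := y)) i)) * g ((x(j := y)) j) ((x(j := y)) l) \<partial>\<sigma> \<partial>Pi\<^sub>M I (\<lambda>_. \<sigma>))"
    unfolding J_eq by (rule P.product_nn_integral_insert[OF I(1,2)]) (use g in \<open>simp add: J_eq[symmetric]\<close>)
  also have "\<dots> \<le> (\<integral>\<^sup>+x. (\<Prod>i\<in>I. indicator B (x i)) * D \<partial>Pi\<^sub>M I (\<lambda>_. \<sigma>))"
  proof (rule nn_integral_mono)
    fix x
    have "(\<Prod>i\<in>J. indicator B ((x(j := y)) i)) = indicator B y * (\<Prod>i\<in>I. indicator B (x i) :: ennreal)" for y
    proof -
      have "(\<Prod>i\<in>I. indicator B ((x(j := y)) i)) = (\<Prod>i\<in>I. indicator B (x i) :: ennreal)"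
        by (rule prod.cong) (use I in auto)
      then show ?thesis unfolding J_eq using I by simp
    qed
    then have eq: "(\<integral>\<^sup>+y. (\<Prod>i\<in>J. indicator B ((x(j := y)) i)) * g ((x(j := y)) j) ((x(j := y)) l) \<partial>\<sigma>)
        = (\<integral>\<^sup>+y. (\<Prod>i\<in>I. indicator B (x i)) * (indicator B y * g y (x l)) \<partial>\<sigma>)"
      using jl by (simp add: mult_ac)
    show "(\<integral>\<^sup>+y. (\<Prod>i\<in>J. indicator B ((x(j := y)) i)) * g ((x(j := y)) j) ((x(j := y)) l) \<partial>\<sigma>) \<le> (\<Prod>i\<in>I. indicator B (x i)) * D"
    proof (cases "\<forall>i\<in>I. x i \<in> B")
      case True
      then have "x l \<in> B" using I by simp
      then show ?thesis unfolding eq indicator_prod[OF I(1)] using True D[of "x l"] by simp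
    next
      case False
      then show ?thesis unfolding eq indicator_prod[OF I(1)] if_not_P[OF False] by simp
    qed
  qed
  also have "\<dots> = (\<integral>\<^sup>+x. (\<Prod>i\<in>I. indicator B (x i)) \<partial>Pi\<^sub>M I (\<lambda>_. \<sigma>)) * D"
    by (rule nn_integral_multc) measurable
  also have "(\<integral>\<^sup>+x. (\<Prod>i\<in>I. indicator B (x i)) \<partial>Pi\<^sub>M I (\<lambda>_. \<sigma>)) = emeasure \<sigma> B ^ card I"
    using I by (subst P.product_nn_integral_prod) auto
  also have "card I = card J - 1" unfolding I_def using jl J by simp
  finally show ?thesis by (simp add: mult.commute)
qed

lemma emeasure_le_cap:
  assumes B: "B \<in> sets \<sigma>" and \<theta>: "norm \<theta> = 1" and diam: "\<And>x. x \<in> B \<Longrightarrow> norm (x - \<theta>) \<le> scale a n"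
  shows "emeasure \<sigma> B \<le> ennreal (cap_const * scale a n ^ d)"
proof -
  have "emeasure \<sigma> B \<le> emeasure \<sigma> {x \<in> sphere 0 1. norm (x - \<theta>) \<le> scale a n}"
    by (rule emeasure_mono[OF _ cap_sets]) (use diam norm_eq_1_of_mem_sets[OF B] in auto)
  also have "\<dots> \<le> ennreal (cap_const * scale a n ^ d)" by (rule cap_le[OF \<theta> scale_pos])
  finally show ?thesis .
qed

text \<open>
  Sets on which the first n levels are nearly constant, with \<theta> as reference point.
\<close>

definition small_cell :: "nat \<Rightarrow> nat \<Rightarrow> 'u \<Rightarrow> 'u set \<Rightarrow> bool" where
  "small_cell a n \<theta> B \<longleftrightarrow> B \<in> sets \<sigma> \<and> norm \<theta> = 1 \<and>
     (\<forall>x\<in>B. norm (x - \<theta>) \<le> scale a n) \<and> (\<forall>x\<in>B. \<forall>y\<in>B. norm (x - y) \<le> scale a n)"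

text \<open>
  The error term of exponent_bounds.
\<close>

definition distortion :: "nat \<Rightarrow> real \<Rightarrow> nat \<Rightarrow> real" where
  "distortion a c k = (\<bar>c\<bar> + k)\<^sup>2 * (a * s\<^sup>2 + R_in) / 2"

text \<open>
  The constant of kernel_integral for the exponent k (k - 1) / 2.
\<close>

definition pair_const :: "nat \<Rightarrow> real" where
  "pair_const k = cap_const * exp (real (k * (k - 1)) / 2 * (s\<^sup>2 + R_out)) *
     (1 / (1 - exp (real (k * (k - 1)) / 2 * s\<^sup>2) / b ^ d))"

text \<open>
  The constant of moment_upper. That it is independent of n, N and the cell is what the
  estimate is about; its value is read off the proof.
\<close>

definition moment_const :: "nat \<Rightarrow> real \<Rightarrow> nat \<Rightarrow> real" where
  "moment_const a q k = exp (distortion a (q - k) k) *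
     (cap_const ^ k + real (k * (k - 1)) * (pair_const k * cap_const ^ (k - 1))) * (b ^ a) ^ (d * k)"

lemma pair_const_pos: "k \<le> p \<Longrightarrow> 0 < pair_const k"
  unfolding pair_const_def using cap_const_pos exp_pair_count_less[of k] b by (intro mult_pos_pos) auto

lemma moment_const_pos: "k \<le> p \<Longrightarrow> 0 < moment_const a q k"
  unfolding moment_const_def using cap_const_pos b pair_const_pos[of k]
  by (intro mult_pos_pos add_pos_nonneg) auto

text \<open>
  On a small cell the coarse levels contribute exp (n (q^2 - k) s^2 / 2), as if they were
  constant. The fine levels contribute the k-fold integral of the decoupled kernels, which is of
  the same order as the k-th power of the volume b^(-n d).
\<close>

lemma moment_upper:
  assumes k: "k \<le> p" and n: "n \<le> Suc N" and cell: "small_cell a n \<theta> B"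
  shows "(\<integral>\<^sup>+\<omega>. ennreal (exp ((q - k) * coarse_field n \<theta> \<omega>)) * emass N B \<omega> ^ k \<partial>M)
    \<le> ennreal (moment_const a q k * exp (n * (q\<^sup>2 - k) * s\<^sup>2 / 2) * (1 / b ^ n) ^ (d * k))"
proof -
  have B [measurable]: "B \<in> sets \<sigma>" and \<theta>: "norm \<theta> = 1"
    and diam1: "\<And>x. x \<in> B \<Longrightarrow> norm (x - \<theta>) \<le> scale a n"
    and diam2: "\<And>x y. x \<in> B \<Longrightarrow> y \<in> B \<Longrightarrow> norm (x - y) \<le> scale a n"
    using cell unfolding small_cell_def by blast+
  define K where "K = real (k * (k - 1)) / 2"
  have K: "0 \<le> K" "exp (K * s\<^sup>2) < b ^ d" using exp_pair_count_less[OF k] by (auto simp: K_def)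
  define H where "H = distortion a (q - k) k"
  define D where "D = pair_const k"
  have D: "0 < D" unfolding D_def by (rule pair_const_pos[OF k])
  interpret P: product_sigma_finite "\<lambda>_::nat. \<sigma>" by standard
  let ?P = "Pi\<^sub>M {1..k} (\<lambda>_. \<sigma>)"
  define T where "T = scale a n"
  have T: "0 < T" by (simp add: T_def scale_pos)
  define E0 where "E0 = exp (n * (q\<^sup>2 - k) * s\<^sup>2 / 2)"
  let ?ind = "\<lambda>x. (\<Prod>j\<in>{1..k}. indicator B (x j)) :: ennreal"
  let ?G = "\<lambda>x z. ennreal (exp (K * fine_cov n N (norm (x (fst z) - x (snd z)))))"
  have G_meas: "(\<lambda>x. ?G x z) \<in> borel_measurable ?P" if "z \<in> pairs k" for z
  proof -
    have z: "fst z \<in> {1..k}" "snd z \<in> {1..k}" using that unfolding pairs_def by auto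
    have [measurable]: "(\<lambda>x. x (fst z)) \<in> ?P \<rightarrow>\<^sub>M borel" "(\<lambda>x. x (snd z)) \<in> ?P \<rightarrow>\<^sub>M borel"
      by (rule PiM_component_borel[OF z(1)], rule PiM_component_borel[OF z(2)])
    show ?thesis by measurable
  qed
  have \<sigma>B: "emeasure \<sigma> B \<le> ennreal (cap_const * T ^ d)"
    unfolding T_def using B \<theta> diam1 by (rule emeasure_le_cap)
  \<comment> \<open>Where all points lie in B, the reference point and the points are within distance scale a n of each other.\<close>
  have pt: "?ind x * ennreal (exp (\<Sum>i\<le>N. (qform (q - k) n k i (x(0 := \<theta>)) - k * s\<^sup>2) / 2))
      \<le> ennreal (exp H * E0) * (?ind x + (\<Sum>z\<in>pairs k. ?ind x * ?G x z))" for x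
  proof (cases "\<forall>j\<in>{1..k}. x j \<in> B")
    case True
    define y where "y = x(0 := \<theta>)"
    have yB: "y j \<in> B" if "j \<in> {1..k}" for j using True that by (auto simp: y_def)
    have "norm (y j - y l) \<le> scale a n" if "j \<le> k" "l \<le> k" for j l
    proof -
      have "j = 0 \<or> j \<in> {1..k}" "l = 0 \<or> l \<in> {1..k}" using that by auto
      then consider "j = 0" "l = 0" | "j = 0" "l \<in> {1..k}" | "l = 0" "j \<in> {1..k}" | "j \<in> {1..k}" "l \<in> {1..k}"
        by blast
      then show ?thesis
      proof cases
        case 1 then show ?thesis using scale_pos[of a n] by simp
      next
        case 2 then show ?thesis using diam1[OF yB[of l]] by (simp add: y_def norm_minus_commute)
      next
        case 3 then show ?thesis using diam1[OF yB[of j]] by (simp add: y_def)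
      qed (use diam2 yB in auto)
    qed
    note eb = exponent_bounds[where k=k and x=y and c="q - k", OF n this]
    define F where "F z = fine_cov n N (norm (y (fst z) - y (snd z)))" for z
    have "(\<Sum>i\<le>N. (qform (q - k) n k i y - k * s\<^sup>2) / 2) \<le> H + n * (q\<^sup>2 - k) * s\<^sup>2 / 2 + sum F (pairs k) / 2"
      using eb unfolding H_def distortion_def F_def case_prod_unfold abs_le_iff by simp
    then have "exp (\<Sum>i\<le>N. (qform (q - k) n k i y - k * s\<^sup>2) / 2) \<le> exp H * E0 * exp (sum F (pairs k) / 2)"
      unfolding E0_def exp_add[symmetric] by (simp only: exp_le_cancel_iff)
    also have "\<dots> \<le> exp H * E0 * (1 + (\<Sum>z\<in>pairs k. exp (K * F z)))"
    proof (rule mult_left_mono)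
      show "exp (sum F (pairs k) / 2) \<le> 1 + (\<Sum>z\<in>pairs k. exp (K * F z))"
        using exp_sum_pairs_le[OF finite_pairs, of k F] fine_cov_nonneg unfolding card_pairs K_def F_def by simp
    qed (simp add: E0_def)
    finally have "ennreal (exp (\<Sum>i\<le>N. (qform (q - k) n k i y - k * s\<^sup>2) / 2)) \<le> ennreal (exp H * E0 * (1 + (\<Sum>z\<in>pairs k. exp (K * F z))))"
      by (rule ennreal_leI)
    also have "\<dots> = ennreal (exp H * E0) * (1 + (\<Sum>z\<in>pairs k. ennreal (exp (K * F z))))"
      by (simp add: E0_def ennreal_mult sum_nonneg sum_ennreal)
    also have "(\<Sum>z\<in>pairs k. ennreal (exp (K * F z))) = (\<Sum>z\<in>pairs k. ?G x z)"
      by (rule sum.cong) (auto simp: F_def y_def pairs_def)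
    finally show ?thesis
      unfolding indicator_prod[OF finite_atLeastAtMost] if_P[OF True] y_def by (simp only: mult_1_left)
  next
    case False
    then show ?thesis unfolding indicator_prod[OF finite_atLeastAtMost] if_not_P[OF False] by simp
  qed
  have "(\<integral>\<^sup>+\<omega>. ennreal (exp ((q - k) * coarse_field n \<theta> \<omega>)) * emass N B \<omega> ^ k \<partial>M)
      \<le> (\<integral>\<^sup>+x. ennreal (exp H * E0) * (?ind x + (\<Sum>z\<in>pairs k. ?ind x * ?G x z)) \<partial>?P)"
    unfolding moment_formula[OF B n] by (intro nn_integral_mono pt)
  also have "\<dots> = ennreal (exp H * E0) * ((\<integral>\<^sup>+x. ?ind x \<partial>?P) + (\<Sum>z\<in>pairs k. \<integral>\<^sup>+x. ?ind x * ?G x z \<partial>?P))"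
  proof -
    have i: "?ind \<in> borel_measurable ?P" by measurable
    have g: "(\<lambda>x. ?ind x * ?G x z) \<in> borel_measurable ?P" if "z \<in> pairs k" for z
      by (intro borel_measurable_times_ennreal i G_meas that)
    have "(\<integral>\<^sup>+x. (\<Sum>z\<in>pairs k. ?ind x * ?G x z) \<partial>?P) = (\<Sum>z\<in>pairs k. \<integral>\<^sup>+x. ?ind x * ?G x z \<partial>?P)"
      by (rule nn_integral_sum) (rule g)
    moreover have "(\<integral>\<^sup>+x. ?ind x + (\<Sum>z\<in>pairs k. ?ind x * ?G x z) \<partial>?P) = (\<integral>\<^sup>+x. ?ind x \<partial>?P) + (\<integral>\<^sup>+x. (\<Sum>z\<in>pairs k. ?ind x * ?G x z) \<partial>?P)"
      by (rule nn_integral_add[OF i]) (intro borel_measurable_sum g)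
    moreover have "(\<integral>\<^sup>+x. ennreal (exp H * E0) * (?ind x + (\<Sum>z\<in>pairs k. ?ind x * ?G x z)) \<partial>?P)
        = ennreal (exp H * E0) * (\<integral>\<^sup>+x. ?ind x + (\<Sum>z\<in>pairs k. ?ind x * ?G x z) \<partial>?P)"
      by (rule nn_integral_cmult) (intro borel_measurable_add i borel_measurable_sum g)
    ultimately show ?thesis by (simp only:)
  qed
  also have "\<dots> \<le> ennreal (exp H * E0) * (ennreal ((cap_const * T ^ d) ^ k) +
      (\<Sum>z\<in>pairs k. ennreal (D * T ^ d * (cap_const * T ^ d) ^ (k - 1))))"
  proof (intro mult_left_mono add_mono sum_mono)
    have "(\<integral>\<^sup>+x. ?ind x \<partial>?P) = emeasure \<sigma> B ^ k"
      by (subst P.product_nn_integral_prod) auto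
    also have "\<dots> \<le> ennreal (cap_const * T ^ d) ^ k" using \<sigma>B by (rule power_mono) simp
    finally show "(\<integral>\<^sup>+x. ?ind x \<partial>?P) \<le> ennreal ((cap_const * T ^ d) ^ k)"
      using cap_const_pos T by (simp add: ennreal_power)
  next
    fix z assume z: "z \<in> pairs k"
    have "(\<integral>\<^sup>+x. ?ind x * ?G x z \<partial>?P) \<le> ennreal (D * T ^ d) * emeasure \<sigma> B ^ (card {1..k} - 1)"
    proof (rule pair_integral[where g="\<lambda>x y. ennreal (exp (K * fine_cov n N (norm (x - y))))"])
      fix y assume y: "y \<in> B"
      show "(\<integral>\<^sup>+x. indicator B x * ennreal (exp (K * fine_cov n N (norm (x - y)))) \<partial>\<sigma>) \<le> ennreal (D * T ^ d)"
        using kernel_integral[OF K B norm_eq_1_of_mem_sets[OF B y] diam2[OF _ y], of N] unfolding D_def pair_const_def T_def K_def .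
      have [measurable]: "(\<lambda>x. x) \<in> \<sigma> \<rightarrow>\<^sub>M borel" by (rule measurable_sphere_measure_id)
      show "(\<lambda>x. ennreal (exp (K * fine_cov n N (norm (x - y))))) \<in> borel_measurable \<sigma>" by measurable
    qed (use z G_meas[OF z] in \<open>auto simp: pairs_def\<close>)
    also have "\<dots> \<le> ennreal (D * T ^ d) * ennreal (cap_const * T ^ d) ^ (k - 1)"
      using \<sigma>B by (intro mult_left_mono) (auto intro: power_mono)
    also have "\<dots> = ennreal (D * T ^ d * (cap_const * T ^ d) ^ (k - 1))"
      using cap_const_pos T D by (subst ennreal_power, simp, subst ennreal_mult[symmetric]) auto
    finally show "(\<integral>\<^sup>+x. ?ind x * ?G x z \<partial>?P) \<le> ennreal (D * T ^ d * (cap_const * T ^ d) ^ (k - 1))" .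
  qed simp_all
  also have "\<dots> = ennreal (exp H * E0 * ((cap_const * T ^ d) ^ k + real (k * (k - 1)) * (D * T ^ d * (cap_const * T ^ d) ^ (k - 1))))"
  proof -
    define u v where "u = (cap_const * T ^ d) ^ k" and "v = D * T ^ d * (cap_const * T ^ d) ^ (k - 1)"
    have uv: "0 \<le> u" "0 \<le> v" using cap_const_pos T D by (auto simp: u_def v_def)
    have "(\<Sum>z\<in>pairs k. ennreal v) = ennreal (real (k * (k - 1)) * v)"
      unfolding sum_constant card_pairs ennreal_of_nat_eq_real_of_nat
      by (rule ennreal_mult[symmetric]) (use uv in auto)
    then have "ennreal (exp H * E0) * (ennreal u + (\<Sum>z\<in>pairs k. ennreal v))
        = ennreal (exp H * E0) * ennreal (u + real (k * (k - 1)) * v)"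
      using uv by (simp only: ennreal_plus mult_nonneg_nonneg of_nat_0_le_iff)
    also have "\<dots> = ennreal (exp H * E0 * (u + real (k * (k - 1)) * v))"
      by (rule ennreal_mult[symmetric]) (use uv in \<open>auto simp: E0_def\<close>)
    finally show ?thesis unfolding u_def v_def .
  qed
  also have "exp H * E0 * ((cap_const * T ^ d) ^ k + real (k * (k - 1)) * (D * T ^ d * (cap_const * T ^ d) ^ (k - 1)))
      = moment_const a q k * exp (n * (q\<^sup>2 - k) * s\<^sup>2 / 2) * (1 / b ^ n) ^ (d * k)"
  proof -
    have Tk: "T ^ (d * k) = (b ^ a) ^ (d * k) * (1 / b ^ n) ^ (d * k)"
      by (simp add: T_def scale_def power_divide)
    have 1: "(cap_const * T ^ d) ^ k = cap_const ^ k * T ^ (d * k)" by (simp add: power_mult_distrib power_mult)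
    have 2: "real (k * (k - 1)) * (D * T ^ d * (cap_const * T ^ d) ^ (k - 1))
        = real (k * (k - 1)) * (D * cap_const ^ (k - 1)) * T ^ (d * k)"
    proof (cases k)
      case (Suc k')
      then show ?thesis by (simp add: power_mult_distrib power_mult[symmetric] power_add)
    qed simp
    have "exp H * E0 * ((cap_const * T ^ d) ^ k + real (k * (k - 1)) * (D * T ^ d * (cap_const * T ^ d) ^ (k - 1)))
      = exp H * E0 * ((cap_const ^ k + real (k * (k - 1)) * (D * cap_const ^ (k - 1))) * T ^ (d * k))"
      unfolding 1 2 by (simp only: distrib_right)
    then show ?thesis unfolding moment_const_def H_def D_def E0_def Tk by (simp only: mult_ac)
  qed
  finally show ?thesis .
qed

text \<open>
  A single point has no pairs, so only the coarse levels and their distortion remain.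
\<close>

lemma moment_lower:
  assumes n: "n \<le> Suc N" and cell: "small_cell a n \<theta> B"
  shows "ennreal (exp (- distortion a (q - 1) 1) * exp (n * (q\<^sup>2 - 1) * s\<^sup>2 / 2)) * emeasure \<sigma> B
    \<le> (\<integral>\<^sup>+\<omega>. ennreal (exp ((q - 1) * coarse_field n \<theta> \<omega>)) * emass N B \<omega> \<partial>M)"
proof -
  have B [measurable]: "B \<in> sets \<sigma>" and diam1: "\<And>x. x \<in> B \<Longrightarrow> norm (x - \<theta>) \<le> scale a n"
    using cell unfolding small_cell_def by blast+
  define H where "H = distortion a (q - 1) 1"
  interpret P: product_sigma_finite "\<lambda>_::nat. \<sigma>" by standard
  let ?P = "Pi\<^sub>M {1..1::nat} (\<lambda>_. \<sigma>)"
  let ?ind = "\<lambda>x. (\<Prod>j\<in>{1..1::nat}. indicator B (x j)) :: ennreal"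
  define e where "e = exp (- H) * exp (n * (q\<^sup>2 - 1) * s\<^sup>2 / 2)"
  have "ennreal e * emeasure \<sigma> B = (\<integral>\<^sup>+x. ennreal e * ?ind x \<partial>?P)"
    by (subst nn_integral_cmult, measurable) (subst P.product_nn_integral_prod, auto)
  also have "\<dots> \<le> (\<integral>\<^sup>+x. ?ind x * ennreal (exp (\<Sum>i\<le>N. (qform (q - 1) n 1 i (x(0 := \<theta>)) - real 1 * s\<^sup>2) / 2)) \<partial>?P)"
  proof (rule nn_integral_mono)
    fix x :: "nat \<Rightarrow> 'u"
    show "ennreal e * ?ind x \<le> ?ind x * ennreal (exp (\<Sum>i\<le>N. (qform (q - 1) n 1 i (x(0 := \<theta>)) - real 1 * s\<^sup>2) / 2))"
    proof (cases "x 1 \<in> B")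
      case True
      define y where "y = x(0 := \<theta>)"
      have "norm (y j - y l) \<le> scale a n" if "j \<le> 1" "l \<le> 1" for j l
      proof -
        have "j = 0 \<or> j = 1" "l = 0 \<or> l = 1" using that by auto
        then show ?thesis using diam1[OF True] scale_pos[of a n]
          by (auto simp: y_def norm_minus_commute)
      qed
      note eb = exponent_bounds[where k=1 and x=y and c="q - 1", OF n this]
      have "pairs 1 = {}" by (auto simp: pairs_def)
      then have "- H + n * (q\<^sup>2 - 1) * s\<^sup>2 / 2 \<le> (\<Sum>i\<le>N. (qform (q - 1) n 1 i y - real 1 * s\<^sup>2) / 2)"
        using eb unfolding H_def distortion_def abs_le_iff by simp
      then have "e \<le> exp (\<Sum>i\<le>N. (qform (q - 1) n 1 i y - real 1 * s\<^sup>2) / 2)"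
        unfolding e_def exp_add[symmetric] by (simp only: exp_le_cancel_iff)
      then show ?thesis using True unfolding y_def by (simp add: ennreal_leI)
    qed simp
  qed
  also have "\<dots> = (\<integral>\<^sup>+\<omega>. ennreal (exp ((q - 1) * coarse_field n \<theta> \<omega>)) * emass N B \<omega> ^ 1 \<partial>M)"
    by (rule moment_formula[OF B n, symmetric])
  finally show ?thesis unfolding e_def H_def by simp
qed

section \<open>Existence of the limiting measure\<close>

abbreviation "Path \<equiv> Pi\<^sub>M (UNIV :: 'u set) (\<lambda>_. borel :: real measure)"

text \<open>
  The fields of the levels in I, jointly as one random element.
\<close>

definition fields_on :: "nat set \<Rightarrow> 'w \<Rightarrow> nat \<Rightarrow> 'u \<Rightarrow> real" where
  "fields_on I \<omega> = (\<lambda>i\<in>I. \<lambda>u. X i u \<omega>)"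

definition Filt :: "nat \<Rightarrow> 'w measure" where
  "Filt n = vimage_algebra (space M) (fields_on {..n}) (Pi\<^sub>M {..n} (\<lambda>_. Path))"

lemma fields_on_meas: "fields_on I \<in> M \<rightarrow>\<^sub>M Pi\<^sub>M I (\<lambda>_. Path)"
  unfolding fields_on_def using indep_fields
  by (intro measurable_restrict) (auto simp: indep_vars_def)

lemma fields_on_Filt: "fields_on {..n} \<in> Filt n \<rightarrow>\<^sub>M Pi\<^sub>M {..n} (\<lambda>_. Path)"
  unfolding Filt_def by (rule measurable_vimage_algebra1) (use measurable_space[OF fields_on_meas] in blast)

lemma sets_Filt: "sets (Filt n) = {fields_on {..n} -` A \<inter> space M | A. A \<in> sets (Pi\<^sub>M {..n} (\<lambda>_. Path))}"
  unfolding Filt_def by (rule sets_vimage_algebra2) (use measurable_space[OF fields_on_meas] in blast)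

lemma space_Filt [simp]: "space (Filt n) = space M" by (simp add: Filt_def)

lemma subalgebra_Filt: "subalgebra M (Filt n)"
  unfolding subalgebra_def sets_Filt using measurable_sets[OF fields_on_meas] by auto

lemma Filt_mono: "m \<le> n \<Longrightarrow> sets (Filt m) \<subseteq> sets (Filt n)"
proof
  fix A assume mn: "m \<le> n" and "A \<in> sets (Filt m)"
  then obtain A' where A: "A = fields_on {..m} -` A' \<inter> space M" "A' \<in> sets (Pi\<^sub>M {..m} (\<lambda>_. Path))"
    unfolding sets_Filt by blast
  have "(\<lambda>f. restrict f {..m}) \<in> Pi\<^sub>M {..n} (\<lambda>_. Path) \<rightarrow>\<^sub>M Pi\<^sub>M {..m} (\<lambda>_. Path)"
    by (rule measurable_restrict_subset) (use mn in auto)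
  from measurable_compose[OF fields_on_Filt this] have "(\<lambda>\<omega>. restrict (fields_on {..n} \<omega>) {..m}) \<in> Filt n \<rightarrow>\<^sub>M Pi\<^sub>M {..m} (\<lambda>_. Path)" .
  moreover have "restrict (fields_on {..n} \<omega>) {..m} = fields_on {..m} \<omega>" for \<omega>
    using mn by (auto simp: fields_on_def restrict_def fun_eq_iff)
  ultimately have "fields_on {..m} \<in> Filt n \<rightarrow>\<^sub>M Pi\<^sub>M {..m} (\<lambda>_. Path)" by simp
  from measurable_sets[OF this A(2)] show "A \<in> sets (Filt n)" using A by simp
qed

definition path_dens :: "nat set \<Rightarrow> 'u \<Rightarrow> (nat \<Rightarrow> 'u \<Rightarrow> real) \<Rightarrow> real" where
  "path_dens I \<theta> f = exp (\<Sum>i\<in>I. f i (b ^ i *\<^sub>R \<theta>) - s\<^sup>2 / 2)"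

lemma path_dens_meas [measurable]:
  "path_dens I \<theta> \<in> borel_measurable (Pi\<^sub>M I (\<lambda>_. Path))"
proof -
  have [measurable]: "(\<lambda>f. f i u) \<in> borel_measurable (Pi\<^sub>M I (\<lambda>_. Path))" if "i \<in> I" for i u
    using measurable_compose[OF measurable_component_singleton[OF that, of "\<lambda>_. Path"]
      measurable_component_singleton[OF UNIV_I, of u "\<lambda>_. borel"]] by simp
  show ?thesis unfolding path_dens_def by measurable
qed

lemma dens_path: "dens n \<theta> \<omega> = path_dens {..n} \<theta> (fields_on {..n} \<omega>)"
  unfolding dens_def path_dens_def fields_on_def by (auto intro!: sum.cong)

lemma dens_Filt: "dens n \<theta> \<in> borel_measurable (Filt n)"
  unfolding dens_path[abs_def] by (rule measurable_compose[OF fields_on_Filt path_dens_meas])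

lemma dens_split: "n \<le> m \<Longrightarrow> dens m \<theta> \<omega> = dens n \<theta> \<omega> * path_dens {n<..m} \<theta> (fields_on {n<..m} \<omega>)"
proof -
  assume "n \<le> m"
  then have "{..m} = {..n} \<union> {n<..m}" by auto
  then have "(\<Sum>i\<le>m. X i (b ^ i *\<^sub>R \<theta>) \<omega> - s\<^sup>2 / 2) =
      (\<Sum>i\<le>n. X i (b ^ i *\<^sub>R \<theta>) \<omega> - s\<^sup>2 / 2) + (\<Sum>i\<in>{n<..m}. X i (b ^ i *\<^sub>R \<theta>) \<omega> - s\<^sup>2 / 2)"
    by (simp only:) (rule sum.union_disjoint, auto)
  then show ?thesis unfolding dens_def path_dens_def fields_on_def by (simp add: exp_add)
qed

lemma mean_future: "(\<integral>\<^sup>+\<omega>. ennreal (path_dens {n<..m} \<theta> (fields_on {n<..m} \<omega>)) \<partial>M) = 1"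
proof -
  define c where "c i = (if n < i then 1 else 0 :: real)" for i
  have eq: "(\<Sum>i\<in>{n<..m}. g i) = (\<Sum>i\<le>m. c i * g i)" for g :: "nat \<Rightarrow> real"
    by (rule sum.mono_neutral_cong_left) (auto simp: c_def)
  have "path_dens {n<..m} \<theta> (fields_on {n<..m} \<omega>)
      = exp (- (\<Sum>i\<le>m. c i * (s\<^sup>2 / 2))) * exp (\<Sum>i\<le>m. \<Sum>j\<in>{0::nat}. c i * X i (b ^ i *\<^sub>R \<theta>) \<omega>)" for \<omega>
  proof -
    have "(\<Sum>i\<in>{n<..m}. fields_on {n<..m} \<omega> i (b ^ i *\<^sub>R \<theta>) - s\<^sup>2 / 2) = (\<Sum>i\<in>{n<..m}. X i (b ^ i *\<^sub>R \<theta>) \<omega> - s\<^sup>2 / 2)"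
      by (rule sum.cong) (auto simp: fields_on_def)
    also have "\<dots> = (\<Sum>i\<le>m. c i * (X i (b ^ i *\<^sub>R \<theta>) \<omega> - s\<^sup>2 / 2))" by (rule eq)
    also have "\<dots> = - (\<Sum>i\<le>m. c i * (s\<^sup>2 / 2)) + (\<Sum>i\<le>m. \<Sum>j\<in>{0::nat}. c i * X i (b ^ i *\<^sub>R \<theta>) \<omega>)"
      by (simp add: right_diff_distrib sum_subtractf)
    finally show ?thesis unfolding path_dens_def by (simp only: exp_add)
  qed
  then have "(\<integral>\<^sup>+\<omega>. ennreal (path_dens {n<..m} \<theta> (fields_on {n<..m} \<omega>)) \<partial>M)
      = (\<integral>\<^sup>+\<omega>. ennreal (exp (- (\<Sum>i\<le>m. c i * (s\<^sup>2 / 2)))) * ennreal (exp (\<Sum>i\<le>m. \<Sum>j\<in>{0::nat}. c i * X i (b ^ i *\<^sub>R \<theta>) \<omega>)) \<partial>M)"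
    by (simp only: ennreal_mult exp_ge_zero)
  also have "\<dots> = ennreal (exp (- (\<Sum>i\<le>m. c i * (s\<^sup>2 / 2)))) * ennreal (exp (\<Sum>i\<le>m. c i * c i * r 0 / 2))"
    using exp_moment[of "{0::nat}" "\<lambda>i _. c i" "\<lambda>i _. b ^ i *\<^sub>R \<theta>" m] by (subst nn_integral_cmult) auto
  also have "\<dots> = ennreal (exp (- (\<Sum>i\<le>m. c i * (s\<^sup>2 / 2))) * exp (\<Sum>i\<le>m. c i * c i * r 0 / 2))"
    by (rule ennreal_mult[symmetric]) auto
  also have "(\<Sum>i\<le>m. c i * c i * r 0 / 2) = (\<Sum>i\<le>m. c i * (s\<^sup>2 / 2))"
    by (rule sum.cong) (auto simp: c_def r_0)
  finally show ?thesis by (simp add: exp_minus)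
qed

lemma indep_past_future:
  assumes [measurable]: "f \<in> borel_measurable (Pi\<^sub>M {..n} (\<lambda>_. Path))" "g \<in> borel_measurable (Pi\<^sub>M {n<..m} (\<lambda>_. Path))"
  shows "(\<integral>\<^sup>+\<omega>. f (fields_on {..n} \<omega>) * g (fields_on {n<..m} \<omega>) \<partial>M)
    = (\<integral>\<^sup>+\<omega>. f (fields_on {..n} \<omega>) \<partial>M) * (\<integral>\<^sup>+\<omega>. g (fields_on {n<..m} \<omega>) \<partial>M)"
proof -
  have "indep_var (Pi\<^sub>M {..n} (\<lambda>_. Path)) (fields_on {..n}) (Pi\<^sub>M {n<..m} (\<lambda>_. Path)) (fields_on {n<..m})"
    unfolding fields_on_def[abs_def] by (rule indep_var_restrict[OF indep_fields]) auto
  then have "indep_var borel (f \<circ> fields_on {..n}) borel (g \<circ> fields_on {n<..m})"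
    by (rule indep_var_compose) measurable
  moreover have "case_bool borel borel = (\<lambda>_::bool. borel :: ennreal measure)" by (auto split: bool.split)
  ultimately have "indep_vars (\<lambda>_. borel) (case_bool (f \<circ> fields_on {..n}) (g \<circ> fields_on {n<..m})) (UNIV :: bool set)"
    unfolding indep_var_def by simp
  from indep_vars_nn_integral[OF _ this] show ?thesis by (simp add: UNIV_bool mult.commute comp_def)
qed

text \<open>
  The levels after n are independent of the event A and of dens n, and their contribution to the
  density has mean 1.
\<close>

lemma dens_martingale:
  assumes nm: "n \<le> m" and A: "A \<in> sets (Filt n)"
  shows "(\<integral>\<^sup>+\<omega>. ennreal (dens m \<theta> \<omega>) * indicator A \<omega> \<partial>M) = (\<integral>\<^sup>+\<omega>. ennreal (dens n \<theta> \<omega>) * indicator A \<omega> \<partial>M)"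
proof -
  obtain A' where A': "A = fields_on {..n} -` A' \<inter> space M" "A' \<in> sets (Pi\<^sub>M {..n} (\<lambda>_. Path))"
    using A unfolding sets_Filt by blast
  note [measurable] = A'(2)
  define f where "f = (\<lambda>h. ennreal (path_dens {..n} \<theta> h) * indicator A' h)"
  define g where "g = (\<lambda>h. ennreal (path_dens {n<..m} \<theta> h))"
  have [measurable]: "f \<in> borel_measurable (Pi\<^sub>M {..n} (\<lambda>_. Path))" unfolding f_def by measurable
  have [measurable]: "g \<in> borel_measurable (Pi\<^sub>M {n<..m} (\<lambda>_. Path))" unfolding g_def by measurable
  have f: "f (fields_on {..n} \<omega>) = ennreal (dens n \<theta> \<omega>) * indicator A \<omega>" if "\<omega> \<in> space M" for \<omega>
    using that by (auto simp: f_def A' dens_path indicator_def)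
  have "(\<integral>\<^sup>+\<omega>. ennreal (dens m \<theta> \<omega>) * indicator A \<omega> \<partial>M) = (\<integral>\<^sup>+\<omega>. f (fields_on {..n} \<omega>) * g (fields_on {n<..m} \<omega>) \<partial>M)"
  proof (rule nn_integral_cong)
    fix \<omega> assume \<omega>: "\<omega> \<in> space M"
    have "ennreal (dens m \<theta> \<omega>) = ennreal (dens n \<theta> \<omega>) * g (fields_on {n<..m} \<omega>)"
      unfolding dens_split[OF nm] g_def by (rule ennreal_mult) (simp_all add: dens_def path_dens_def)
    then show "ennreal (dens m \<theta> \<omega>) * indicator A \<omega> = f (fields_on {..n} \<omega>) * g (fields_on {n<..m} \<omega>)"
      by (simp only: f[OF \<omega>] mult_ac)
  qed
  also have "\<dots> = (\<integral>\<^sup>+\<omega>. f (fields_on {..n} \<omega>) \<partial>M) * 1"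
    by (subst indep_past_future) (auto simp: mean_future g_def)
  also have "\<dots> = (\<integral>\<^sup>+\<omega>. ennreal (dens n \<theta> \<omega>) * indicator A \<omega> \<partial>M)"
    by (simp, rule nn_integral_cong) (simp add: f)
  finally show ?thesis .
qed

lemma emass_weighted:
  assumes [measurable]: "B \<in> sets \<sigma>" "G \<in> borel_measurable M"
  shows "(\<integral>\<^sup>+\<omega>. emass n B \<omega> * G \<omega> \<partial>M) = (\<integral>\<^sup>+\<theta>. indicator B \<theta> * (\<integral>\<^sup>+\<omega>. ennreal (dens n \<theta> \<omega>) * G \<omega> \<partial>M) \<partial>\<sigma>)"
proof -
  have "(\<integral>\<^sup>+\<omega>. emass n B \<omega> * G \<omega> \<partial>M) = (\<integral>\<^sup>+\<omega>. \<integral>\<^sup>+\<theta>. ennreal (dens n \<theta> \<omega>) * indicator B \<theta> * G \<omega> \<partial>\<sigma> \<partial>M)"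
    unfolding emass_def by (intro nn_integral_cong, subst nn_integral_multc) auto
  also have "\<dots> = (\<integral>\<^sup>+\<theta>. \<integral>\<^sup>+\<omega>. ennreal (dens n \<theta> \<omega>) * indicator B \<theta> * G \<omega> \<partial>M \<partial>\<sigma>)"
    by (rule Fubini_sphere) measurable
  also have "\<dots> = (\<integral>\<^sup>+\<theta>. indicator B \<theta> * (\<integral>\<^sup>+\<omega>. ennreal (dens n \<theta> \<omega>) * G \<omega> \<partial>M) \<partial>\<sigma>)"
    by (intro nn_integral_cong, subst nn_integral_cmult[symmetric]) (auto simp: mult_ac)
  finally show ?thesis .
qed

lemma emass_martingale:
  assumes B: "B \<in> sets \<sigma>" and nm: "n \<le> m" and A: "A \<in> sets (Filt n)"
  shows "(\<integral>\<^sup>+\<omega>. emass m B \<omega> * indicator A \<omega> \<partial>M) = (\<integral>\<^sup>+\<omega>. emass n B \<omega> * indicator A \<omega> \<partial>M)"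
proof -
  have "A \<in> sets M" using A subalgebra_Filt[of n] by (auto simp: subalgebra_def)
  then show ?thesis using B dens_martingale[OF nm A] by (simp add: emass_weighted)
qed

lemma emass_mean:
  assumes B: "B \<in> sets \<sigma>"
  shows "(\<integral>\<^sup>+\<omega>. emass n B \<omega> \<partial>M) = emeasure \<sigma> B"
proof -
  have "(\<integral>\<^sup>+\<omega>. ennreal (dens n \<theta> \<omega>) \<partial>M) = 1" for \<theta>
  proof -
    have "(\<integral>\<^sup>+\<omega>. ennreal (dens n \<theta> \<omega>) \<partial>M) = (\<integral>\<^sup>+\<omega>. ennreal (dens 0 \<theta> \<omega>) \<partial>M)"
      using dens_martingale[of 0 n "space M" \<theta>] sets.top[of "Filt 0"] by (simp cong: nn_integral_cong_simp)
    also have "\<dots> = (\<integral>\<^sup>+\<omega>. ennreal (exp (- s\<^sup>2 / 2)) * ennreal (exp (\<Sum>j\<in>{0::nat}. 1 * X 0 \<theta> \<omega>)) \<partial>M)"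
      by (rule nn_integral_cong) (simp add: dens_def ennreal_mult[symmetric] exp_add[symmetric])
    also have "\<dots> = ennreal (exp (- s\<^sup>2 / 2)) * ennreal (exp (r 0 / 2))"
      using exp_moment_single[of "{0::nat}" "\<lambda>_. 1" 0 "\<lambda>_. \<theta>"] by (subst nn_integral_cmult) auto
    also have "\<dots> = 1" by (simp add: ennreal_mult[symmetric] exp_add[symmetric] r_0)
    finally show ?thesis .
  qed
  then show ?thesis using emass_weighted[OF B, of "\<lambda>_. 1" n] B by simp
qed

lemma AE_emass_finite:
  assumes B: "B \<in> sets \<sigma>"
  shows "AE \<omega> in M. emass n B \<omega> \<noteq> \<infinity>"
proof (rule nn_integral_noteq_infinite)
  show "emass n B \<in> borel_measurable M" using B by (rule emass_meas)
  show "(\<integral>\<^sup>+\<omega>. emass n B \<omega> \<partial>M) \<noteq> \<infinity>"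
    using emass_mean[OF B, of n] \<sigma>.emeasure_finite[of B] by simp
qed

lemma emass_eq_emeasure: "\<omega> \<in> space M \<Longrightarrow> B \<in> sets \<sigma> \<Longrightarrow> emass n B \<omega> = emeasure (approx_measure M b X n \<omega>) B"
  by (simp add: emass_def emeasure_approx)

lemma AE_emass_mass:
  assumes B: "B \<in> sets \<sigma>"
  shows "AE \<omega> in M. emass n B \<omega> = ennreal (mass n B \<omega>)"
  using AE_emass_finite[OF B, of n] AE_space
  by eventually_elim (auto simp: emass_eq_emeasure[OF _ B] mass_def measure_def less_top)

text \<open>
  The mass is an integral over points of the density, which is jointly measurable in the point and
  the outcome, but nothing says that it is measurable jointly with respect to Filt n. It is so up
  to a null set: for every event A, conditioning A on Filt n can be moved
  between the factors of the integral of emass times the indicator of A, because each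
  dens n \<theta> is measurable with respect to Filt n. Hence the mass and its
  conditional expectation have the same integrals over all events.
\<close>

lemma emass_adapted:
  assumes B [measurable]: "B \<in> sets \<sigma>"
  shows "AE \<omega> in M. emass n B \<omega> = nn_cond_exp M (Filt n) (emass n B) \<omega>"
proof -
  interpret F: finite_measure_subalgebra M "Filt n"
    by (intro finite_measure_subalgebra.intro finite_measure_subalgebra_axioms.intro
        finite_measure_axioms subalgebra_Filt)
  have [measurable]: "dens n \<theta> \<in> borel_measurable (Filt n)" for \<theta> by (rule dens_Filt)
  show ?thesis
  proof (rule density_unique_finite_measure)
    fix A assume [measurable]: "A \<in> sets M"
    let ?G = "nn_cond_exp M (Filt n) (indicator A)"
    have "(\<integral>\<^sup>+\<omega>. ennreal (dens n \<theta> \<omega>) * indicator A \<omega> \<partial>M) = (\<integral>\<^sup>+\<omega>. ennreal (dens n \<theta> \<omega>) * ?G \<omega> \<partial>M)" for \<theta>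
      by (rule F.nn_cond_exp_intg[symmetric]) measurable
    then have "(\<integral>\<^sup>+\<omega>. emass n B \<omega> * indicator A \<omega> \<partial>M) = (\<integral>\<^sup>+\<omega>. emass n B \<omega> * ?G \<omega> \<partial>M)"
      by (subst (1 2) emass_weighted) auto
    also have "\<dots> = (\<integral>\<^sup>+\<omega>. ?G \<omega> * emass n B \<omega> \<partial>M)" by (simp add: mult.commute)
    also have "\<dots> = (\<integral>\<^sup>+\<omega>. ?G \<omega> * nn_cond_exp M (Filt n) (emass n B) \<omega> \<partial>M)"
      by (rule F.nn_cond_exp_intg[symmetric]) measurable
    also have "\<dots> = (\<integral>\<^sup>+\<omega>. nn_cond_exp M (Filt n) (emass n B) \<omega> * ?G \<omega> \<partial>M)" by (simp add: mult.commute)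
    also have "\<dots> = (\<integral>\<^sup>+\<omega>. nn_cond_exp M (Filt n) (emass n B) \<omega> * indicator A \<omega> \<partial>M)"
      by (rule F.nn_cond_exp_intg) measurable
    finally show "(\<integral>\<^sup>+\<omega>. emass n B \<omega> * indicator A \<omega> \<partial>M) = (\<integral>\<^sup>+\<omega>. nn_cond_exp M (Filt n) (emass n B) \<omega> * indicator A \<omega> \<partial>M)" .
  qed auto
qed

text \<open>
  The case n = 0 of the moment bound, in which the whole sphere counts as a small cell.
\<close>

lemma emass_moment_bounded:
  obtains C where "\<And>N B. B \<in> sets \<sigma> \<Longrightarrow> (\<integral>\<^sup>+\<omega>. emass N B \<omega> ^ p \<partial>M) \<le> ennreal C"
proof -
  obtain a where a: "2 < b ^ a" using real_arch_pow[OF b] by blast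
  obtain \<theta> :: 'u where \<theta>: "norm \<theta> = 1" using vector_choose_size[of 1] by auto
  show ?thesis
  proof (rule that[of "moment_const a (real p) p"])
    fix N B assume B: "B \<in> sets \<sigma>"
    have "norm (x - y) \<le> scale a 0" if "norm x = 1" "norm y = 1" for x y :: 'u
      using norm_triangle_ineq4[of x y] a that by (simp add: scale_def)
    then have cell: "small_cell a 0 \<theta> B"
      using B \<theta> norm_eq_1_of_mem_sets[OF B] by (simp add: small_cell_def)
    show "(\<integral>\<^sup>+\<omega>. emass N B \<omega> ^ p \<partial>M) \<le> ennreal (moment_const a (real p) p)"
      using moment_upper[OF order_refl _ cell, of N "real p"] by simp
  qed
qed

text \<open>
  The martingale theorem is applied to the version of the masses that is measurable with respect
  to the filtration.
\<close>

lemma mass_limit: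
  assumes B [measurable]: "B \<in> sets \<sigma>"
  obtains Y where "Y \<in> borel_measurable M" "\<And>\<omega>. 0 \<le> Y \<omega>" "AE \<omega> in M. (\<lambda>n. mass n B \<omega>) \<longlonglongrightarrow> Y \<omega>"
    "(\<lambda>n. \<integral>\<^sup>+\<omega>. ennreal (\<bar>mass n B \<omega> - Y \<omega>\<bar> ^ p) \<partial>M) \<longlonglongrightarrow> 0"
    "(\<integral>\<^sup>+\<omega>. ennreal (Y \<omega>) \<partial>M) = emeasure \<sigma> B"
proof -
  define S where "S n \<omega> = enn2real (nn_cond_exp M (Filt n) (emass n B) \<omega>)" for n \<omega>
  obtain C where C: "\<And>N B. B \<in> sets \<sigma> \<Longrightarrow> (\<integral>\<^sup>+\<omega>. emass N B \<omega> ^ p \<partial>M) \<le> ennreal C"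
    using emass_moment_bounded by blast
  have S_emass: "AE \<omega> in M. ennreal (S n \<omega>) = emass n B \<omega>" for n
    using emass_adapted[OF B, of n] AE_emass_finite[OF B, of n]
    by eventually_elim (simp add: S_def less_top)
  have S_mass: "AE \<omega> in M. S n \<omega> = mass n B \<omega>" for n
    using S_emass[of n] AE_emass_mass[OF B, of n]
    by eventually_elim (use mass_nonneg in \<open>simp add: S_def\<close>)
  interpret S: Lp_martingale M Filt S p C
  proof
    show "subalgebra M (Filt n)" for n by (rule subalgebra_Filt)
    show "sets (Filt m) \<subseteq> sets (Filt n)" if "m \<le> n" for m n using that by (rule Filt_mono)
    show "S n \<in> borel_measurable (Filt n)" for n unfolding S_def by measurable
    show "0 \<le> S n \<omega>" for n \<omega> by (simp add: S_def)
    show "2 \<le> p" by (rule p)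
    show "(\<integral>\<^sup>+\<omega>. ennreal (S m \<omega>) * indicator A \<omega> \<partial>M) = (\<integral>\<^sup>+\<omega>. ennreal (S n \<omega>) * indicator A \<omega> \<partial>M)"
      if "n \<le> m" "A \<in> sets (Filt n)" for n m A
    proof -
      have "(\<integral>\<^sup>+\<omega>. ennreal (S k \<omega>) * indicator A \<omega> \<partial>M) = (\<integral>\<^sup>+\<omega>. emass k B \<omega> * indicator A \<omega> \<partial>M)" for k
        by (rule nn_integral_cong_AE, use S_emass[of k] in eventually_elim) simp
      then show ?thesis using emass_martingale[OF B that] by simp
    qed
    show "(\<integral>\<^sup>+\<omega>. ennreal (S n \<omega> ^ p) \<partial>M) \<le> ennreal C" for n
    proof -
      have "(\<integral>\<^sup>+\<omega>. ennreal (S n \<omega> ^ p) \<partial>M) = (\<integral>\<^sup>+\<omega>. emass n B \<omega> ^ p \<partial>M)"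
      proof (rule nn_integral_cong_AE, use S_emass[of n] in eventually_elim)
        fix \<omega> assume "ennreal (S n \<omega>) = emass n B \<omega>"
        then show "ennreal (S n \<omega> ^ p) = emass n B \<omega> ^ p"
          by (simp add: S_def ennreal_power[symmetric])
      qed
      then show ?thesis using C[OF B, of n] by simp
    qed
  qed
  obtain Y where Y: "Y \<in> borel_measurable M" "\<And>\<omega>. 0 \<le> Y \<omega>" "AE \<omega> in M. (\<lambda>n. S n \<omega>) \<longlonglongrightarrow> Y \<omega>"
    "(\<lambda>n. \<integral>\<^sup>+\<omega>. ennreal (\<bar>S n \<omega> - Y \<omega>\<bar> ^ p) \<partial>M) \<longlonglongrightarrow> 0"
    "(\<integral>\<^sup>+\<omega>. ennreal (Y \<omega>) \<partial>M) = (\<integral>\<^sup>+\<omega>. ennreal (S 0 \<omega>) \<partial>M)"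
    using S.Lp_martingale_convergence by blast
  have all: "AE \<omega> in M. \<forall>n. S n \<omega> = mass n B \<omega>" using S_mass by (simp add: AE_all_countable)
  show ?thesis
  proof (rule that[of Y])
    show "AE \<omega> in M. (\<lambda>n. mass n B \<omega>) \<longlonglongrightarrow> Y \<omega>" using all Y(3) by eventually_elim simp
    have "(\<integral>\<^sup>+\<omega>. ennreal (\<bar>mass n B \<omega> - Y \<omega>\<bar> ^ p) \<partial>M) = (\<integral>\<^sup>+\<omega>. ennreal (\<bar>S n \<omega> - Y \<omega>\<bar> ^ p) \<partial>M)" for n
      by (rule nn_integral_cong_AE, use S_mass[of n] in eventually_elim) simp
    then show "(\<lambda>n. \<integral>\<^sup>+\<omega>. ennreal (\<bar>mass n B \<omega> - Y \<omega>\<bar> ^ p) \<partial>M) \<longlonglongrightarrow> 0" using Y(4) by simp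
    have "(\<integral>\<^sup>+\<omega>. ennreal (S 0 \<omega>) \<partial>M) = (\<integral>\<^sup>+\<omega>. emass 0 B \<omega> \<partial>M)"
      by (rule nn_integral_cong_AE) (rule S_emass)
    then show "(\<integral>\<^sup>+\<omega>. ennreal (Y \<omega>) \<partial>M) = emeasure \<sigma> B" using Y(5) emass_mean[OF B] by simp
  qed (use Y in auto)
qed

text \<open>
  The limits for the individual sets are almost surely additive because the masses are, so they
  have a regular version.
\<close>

theorem limiting_measure_exists: "\<exists>\<mu>. limiting_measure M b X p \<mu>"
proof -
  define P where "P = (\<lambda>B Y. Y \<in> borel_measurable M \<and> (\<forall>\<omega>. 0 \<le> Y \<omega>) \<and> (AE \<omega> in M. (\<lambda>n. mass n B \<omega>) \<longlonglongrightarrow> Y \<omega>) \<and>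
    (\<lambda>n. \<integral>\<^sup>+\<omega>. ennreal (\<bar>mass n B \<omega> - Y \<omega>\<bar> ^ p) \<partial>M) \<longlonglongrightarrow> 0 \<and>
    (\<integral>\<^sup>+\<omega>. ennreal (Y \<omega>) \<partial>M) = emeasure \<sigma> B)"
  have "\<exists>Y. P B Y" if B: "B \<in> sets \<sigma>" for B
    by (rule mass_limit[OF B]) (auto simp: P_def)
  then have "\<forall>B\<in>sets \<sigma>. \<exists>Y. P B Y" by blast
  from bchoice[OF this] obtain Y where Y: "\<And>B. B \<in> sets \<sigma> \<Longrightarrow> P B (Y B)" by blast
  have "random_set_function M \<sigma> Y"
  proof (intro random_set_function.intro random_set_function_axioms.intro)
    show "prob_space M" by (rule prob_space_axioms)
    show "finite_measure \<sigma>" by (rule \<sigma>.finite_measure_axioms)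
    fix A assume A: "A \<in> sets \<sigma>"
    show "Y A \<in> borel_measurable M" "AE \<omega> in M. 0 \<le> Y A \<omega>" "(\<integral>\<^sup>+\<omega>. ennreal (Y A \<omega>) \<partial>M) = emeasure \<sigma> A"
      using Y[OF A] by (auto simp: P_def)
    fix B assume B: "B \<in> sets \<sigma>" and AB: "A \<inter> B = {}"
    have U: "A \<union> B \<in> sets \<sigma>" using A B by blast
    have lims: "AE \<omega> in M. (\<lambda>n. mass n A \<omega>) \<longlonglongrightarrow> Y A \<omega>" "AE \<omega> in M. (\<lambda>n. mass n B \<omega>) \<longlonglongrightarrow> Y B \<omega>"
      "AE \<omega> in M. (\<lambda>n. mass n (A \<union> B) \<omega>) \<longlonglongrightarrow> Y (A \<union> B) \<omega>"
      using Y[OF A] Y[OF B] Y[OF U] by (auto simp: P_def)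
    have "AE \<omega> in M. \<forall>n. mass n (A \<union> B) \<omega> = mass n A \<omega> + mass n B \<omega>"
      unfolding AE_all_countable
    proof
      fix n
      show "AE \<omega> in M. mass n (A \<union> B) \<omega> = mass n A \<omega> + mass n B \<omega>"
        using AE_emass_finite[OF A, of n] AE_emass_finite[OF B, of n] AE_space
      proof eventually_elim
        case (elim \<omega>)
        have "sets (approx_measure M b X n \<omega>) = sets \<sigma>" by (simp add: approx_measure_def)
        then show ?case unfolding mass_def
          using elim A B AB by (intro measure_Union) (auto simp: emass_eq_emeasure)
      qed
    qed
    with lims show "AE \<omega> in M. Y (A \<union> B) \<omega> = Y A \<omega> + Y B \<omega>"
    proof eventually_elim
      case (elim \<omega>)
      have "(\<lambda>n. mass n A \<omega> + mass n B \<omega>) \<longlonglongrightarrow> Y A \<omega> + Y B \<omega>" by (intro tendsto_add elim)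
      then show ?case using elim(3,4) LIMSEQ_unique by simp
    qed
  qed
  then obtain \<mu> where \<mu>: "\<And>\<omega>. sets (\<mu> \<omega>) = sets \<sigma>" "\<And>\<omega>. finite_measure (\<mu> \<omega>)"
    "\<And>A. A \<in> sets \<sigma> \<Longrightarrow> (\<lambda>\<omega>. measure (\<mu> \<omega>) A) \<in> borel_measurable M"
    "\<And>A. A \<in> sets \<sigma> \<Longrightarrow> AE \<omega> in M. measure (\<mu> \<omega>) A = Y A \<omega>"
    by (rule regular_version[OF _ sets_sphere_measure]) auto
  have "limiting_measure M b X p \<mu>"
    unfolding limiting_measure_def random_measure_def mass_def[symmetric]
  proof (intro conjI ballI)
    fix B assume B: "B \<in> sets \<sigma>"
    show "(\<lambda>\<omega>. measure (\<mu> \<omega>) B) \<in> borel_measurable M" using \<mu>(3)[OF B] .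
    have "AE \<omega> in M. (\<lambda>n. mass n B \<omega>) \<longlonglongrightarrow> Y B \<omega>" using Y[OF B] by (simp add: P_def)
    then show "AE \<omega> in M. (\<lambda>n. mass n B \<omega>) \<longlonglongrightarrow> measure (\<mu> \<omega>) B"
      using \<mu>(4)[OF B] by eventually_elim simp
    have "(\<integral>\<^sup>+\<omega>. ennreal (\<bar>mass n B \<omega> - measure (\<mu> \<omega>) B\<bar> ^ p) \<partial>M) = (\<integral>\<^sup>+\<omega>. ennreal (\<bar>mass n B \<omega> - Y B \<omega>\<bar> ^ p) \<partial>M)" for n
      by (rule nn_integral_cong_AE, use \<mu>(4)[OF B] in eventually_elim) simp
    then show "(\<lambda>n. \<integral>\<^sup>+\<omega>. ennreal (\<bar>mass n B \<omega> - measure (\<mu> \<omega>) B\<bar> ^ p) \<partial>M) \<longlonglongrightarrow> 0"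
      using Y[OF B] by (simp add: P_def)
  qed (use \<mu> in auto)
  then show ?thesis by blast
qed

end

section \<open>Moments of real order\<close>

lemma nonneg_power_le_1_plus:
  assumes "0 \<le> z" "0 \<le> q" "q \<le> real p"
  shows "nonneg_power z q \<le> 1 + z ^ p"
proof (cases "z \<le> 1")
  case True
  then have "nonneg_power z q \<le> 1" using assms by (auto simp: nonneg_power_def powr_le1)
  then show ?thesis using assms by (simp add: add_increasing2)
next
  case False
  then have "nonneg_power z q = z powr q" by (auto simp: nonneg_power_def)
  also have "\<dots> \<le> z powr real p" using False assms by (intro powr_mono) auto
  also have "\<dots> = z ^ p" using False by (simp add: powr_realpow)
  finally show ?thesis by simp
qed

text \<open>
  With x = \<kappa> (z - \<epsilon>), the parabola 2 x - x^2 is at most 1, and at most 0 for z below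
  \<epsilon>. So moments of order 0, 1 and 2 bound moments of every real order from below.
\<close>

lemma nonneg_power_ge_parabola:
  assumes "0 \<le> z" "0 \<le> q" "0 < \<epsilon>" "0 < \<kappa>"
  shows "\<epsilon> powr q * (2 * (\<kappa> * (z - \<epsilon>)) - (\<kappa> * (z - \<epsilon>))\<^sup>2) \<le> nonneg_power z q"
proof (cases "\<epsilon> \<le> z")
  case True
  define x where "x = \<kappa> * (z - \<epsilon>)"
  have "0 \<le> (x - 1)\<^sup>2" by simp
  then have "2 * x - x\<^sup>2 \<le> 1" by (simp add: power2_eq_square algebra_simps)
  then have "\<epsilon> powr q * (2 * x - x\<^sup>2) \<le> \<epsilon> powr q * 1" by (intro mult_left_mono) auto
  also have "\<dots> \<le> z powr q" using True assms by (simp add: powr_mono2)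
  also have "\<dots> \<le> nonneg_power z q" using True assms by (auto simp: nonneg_power_def)
  finally show ?thesis unfolding x_def .
next
  case False
  define x where "x = \<kappa> * (z - \<epsilon>)"
  have "x \<le> 0" using False assms by (simp add: x_def mult_nonneg_nonpos)
  then have "2 * x - x\<^sup>2 \<le> 0" by (smt (verit) zero_le_power2)
  then have "\<epsilon> powr q * (2 * x - x\<^sup>2) \<le> 0" by (simp add: mult_nonneg_nonpos)
  also have "0 \<le> nonneg_power z q" by (simp add: nonneg_power_def)
  finally show ?thesis unfolding x_def .
qed

lemma nonneg_power_mult:
  assumes "0 < u" "0 \<le> z"
  shows "nonneg_power (u * z) q = u powr q * nonneg_power z q"
  using assms by (simp add: nonneg_power_def powr_mult)

lemma nonneg_power_meas [measurable]: "(\<lambda>x. nonneg_power x q) \<in> borel_measurable borel"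
  unfolding nonneg_power_def by measurable

text \<open>
  Under the probability measure with density proportional to exp (q A), the variable
  z = m exp (- A) / \<rho> has moments of order one for the exponents 1, 2 and p. Its moment of order
  q is then bounded above through z^q \<le> 1 + z^p and below through a parabola. Since m^q is
  \<rho>^q exp (q A) z^q, this determines the order of the moment of m without knowing the law
  of z.
\<close>

lemma (in prob_space) tilted_moment_bounds:
  fixes A m :: "'a \<Rightarrow> real"
  assumes [measurable]: "A \<in> borel_measurable M" "m \<in> borel_measurable M"
    and m: "\<And>\<omega>. 0 \<le> m \<omega>" and q: "0 \<le> q" "q \<le> real p"
    and pos: "0 < \<rho>" "0 < E0" "0 < C0" "0 < c1" "0 < C2" "0 < Cp"
    and M0: "(\<integral>\<^sup>+\<omega>. ennreal (exp (q * A \<omega>)) \<partial>M) \<le> ennreal (C0 * E0)"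
    and M1: "ennreal (c1 * E0 * \<rho>) \<le> (\<integral>\<^sup>+\<omega>. ennreal (exp ((q - 1) * A \<omega>) * m \<omega>) \<partial>M)"
    and M2: "(\<integral>\<^sup>+\<omega>. ennreal (exp ((q - 2) * A \<omega>) * m \<omega> ^ 2) \<partial>M) \<le> ennreal (C2 * E0 * \<rho> ^ 2)"
    and Mp: "(\<integral>\<^sup>+\<omega>. ennreal (exp ((q - p) * A \<omega>) * m \<omega> ^ p) \<partial>M) \<le> ennreal (Cp * E0 * \<rho> ^ p)"
  defines "\<epsilon> \<equiv> c1 / (2 * C0)"
  defines "\<kappa> \<equiv> c1 / (2 * (C2 + \<epsilon>\<^sup>2 * C0))"
  shows "expectation (\<lambda>\<omega>. nonneg_power (m \<omega>) q) \<le> (C0 + Cp) * (\<rho> powr q * E0)"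
    and "\<epsilon> powr q * (\<kappa> * c1 / 2) * (\<rho> powr q * E0) \<le> expectation (\<lambda>\<omega>. nonneg_power (m \<omega>) q)"
proof -
  define z where "z \<omega> = exp (- A \<omega>) * m \<omega> / \<rho>" for \<omega>
  have z_nn: "0 \<le> z \<omega>" for \<omega> using m pos by (simp add: z_def)
  have [measurable]: "z \<in> borel_measurable M" unfolding z_def by measurable
  have zk: "exp (q * A \<omega>) * z \<omega> ^ k = exp ((q - k) * A \<omega>) * m \<omega> ^ k / \<rho> ^ k" for \<omega> k
  proof -
    have "exp (q * A \<omega>) * exp (- A \<omega>) ^ k = exp ((q - k) * A \<omega>)"
      by (simp add: exp_of_nat_mult[symmetric] exp_add[symmetric] algebra_simps)
    then show ?thesis by (simp add: z_def power_mult_distrib power_divide mult.assoc[symmetric])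
  qed
  have U: "integrable M (\<lambda>\<omega>. exp (q * A \<omega>) * z \<omega> ^ k)" "expectation (\<lambda>\<omega>. exp (q * A \<omega>) * z \<omega> ^ k) \<le> C * E0"
    if b: "(\<integral>\<^sup>+\<omega>. ennreal (exp ((q - k) * A \<omega>) * m \<omega> ^ k) \<partial>M) \<le> ennreal (C * E0 * \<rho> ^ k)" and "0 < C" for k C
  proof -
    have int: "integrable M (\<lambda>\<omega>. exp ((q - k) * A \<omega>) * m \<omega> ^ k)"
      by (rule integrableI_nonneg) (use b m in \<open>auto intro: le_less_trans\<close>)
    have "ennreal (expectation (\<lambda>\<omega>. exp ((q - k) * A \<omega>) * m \<omega> ^ k)) \<le> ennreal (C * E0 * \<rho> ^ k)"
      using b nn_integral_eq_integral[OF int] m by simp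
    then have le: "expectation (\<lambda>\<omega>. exp ((q - k) * A \<omega>) * m \<omega> ^ k) \<le> C * E0 * \<rho> ^ k"
      using pos that by (subst (asm) ennreal_le_iff) auto
    show "integrable M (\<lambda>\<omega>. exp (q * A \<omega>) * z \<omega> ^ k)" unfolding zk using int by simp
    show "expectation (\<lambda>\<omega>. exp (q * A \<omega>) * z \<omega> ^ k) \<le> C * E0"
      unfolding zk using le pos by (simp add: divide_le_eq)
  qed
  have U0: "integrable M (\<lambda>\<omega>. exp (q * A \<omega>))" "expectation (\<lambda>\<omega>. exp (q * A \<omega>)) \<le> C0 * E0"
    using U[of 0 C0] M0 pos by auto
  have U2: "integrable M (\<lambda>\<omega>. exp (q * A \<omega>) * z \<omega> ^ 2)" "expectation (\<lambda>\<omega>. exp (q * A \<omega>) * z \<omega> ^ 2) \<le> C2 * E0"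
    using U[of 2 C2] M2 pos by auto
  have Up: "integrable M (\<lambda>\<omega>. exp (q * A \<omega>) * z \<omega> ^ p)" "expectation (\<lambda>\<omega>. exp (q * A \<omega>) * z \<omega> ^ p) \<le> Cp * E0"
    using U[of p Cp] Mp pos by auto
  have U1_int: "integrable M (\<lambda>\<omega>. exp (q * A \<omega>) * z \<omega>)"
  proof (rule Bochner_Integration.integrable_bound)
    show "integrable M (\<lambda>\<omega>. exp (q * A \<omega>) + exp (q * A \<omega>) * z \<omega> ^ 2)" using U0 U2 by simp
    have "z \<omega> \<le> 1 + z \<omega> ^ 2" for \<omega>
      using sum_squares_bound[of "z \<omega>" 1] z_nn[of \<omega>] by simp
    then have "exp (q * A \<omega>) * z \<omega> \<le> exp (q * A \<omega>) * (1 + z \<omega> ^ 2)" for \<omega> by (rule mult_left_mono) simp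
    then show "AE \<omega> in M. norm (exp (q * A \<omega>) * z \<omega>) \<le> norm (exp (q * A \<omega>) + exp (q * A \<omega>) * z \<omega> ^ 2)"
      using z_nn by (simp add: distrib_left)
  qed measurable
  have U1: "c1 * E0 \<le> expectation (\<lambda>\<omega>. exp (q * A \<omega>) * z \<omega>)"
  proof -
    have eq: "exp ((q - 1) * A \<omega>) * m \<omega> = \<rho> * (exp (q * A \<omega>) * z \<omega>)" for \<omega>
      using zk[of \<omega> 1] pos by simp
    have "ennreal (c1 * E0 * \<rho>) \<le> (\<integral>\<^sup>+\<omega>. ennreal (\<rho> * (exp (q * A \<omega>) * z \<omega>)) \<partial>M)"
      using M1 unfolding eq .
    also have "\<dots> = ennreal (\<rho> * expectation (\<lambda>\<omega>. exp (q * A \<omega>) * z \<omega>))"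
      using U1_int z_nn pos by (subst nn_integral_eq_integral) auto
    finally have "c1 * E0 * \<rho> \<le> \<rho> * expectation (\<lambda>\<omega>. exp (q * A \<omega>) * z \<omega>)"
      using z_nn pos by (subst (asm) ennreal_le_iff) (auto intro!: mult_nonneg_nonneg integral_nonneg_AE)
    then show ?thesis using pos by (simp add: mult.commute)
  qed
  have m_eq: "nonneg_power (m \<omega>) q = \<rho> powr q * (exp (q * A \<omega>) * nonneg_power (z \<omega>) q)" for \<omega>
  proof -
    have "m \<omega> = (\<rho> * exp (A \<omega>)) * z \<omega>" using pos by (simp add: z_def exp_minus)
    then have "nonneg_power (m \<omega>) q = (\<rho> * exp (A \<omega>)) powr q * nonneg_power (z \<omega>) q"
      using nonneg_power_mult[of "\<rho> * exp (A \<omega>)" "z \<omega>" q] pos z_nn by simp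
    also have "(\<rho> * exp (A \<omega>)) powr q = \<rho> powr q * exp (q * A \<omega>)"
      using pos by (simp add: powr_mult exp_powr_real mult.commute)
    finally show ?thesis by (simp add: mult.assoc)
  qed
  have z_le: "exp (q * A \<omega>) * nonneg_power (z \<omega>) q \<le> exp (q * A \<omega>) + exp (q * A \<omega>) * z \<omega> ^ p" for \<omega>
    using mult_left_mono[OF nonneg_power_le_1_plus[OF z_nn[of \<omega>] q], of "exp (q * A \<omega>)"] by (simp add: distrib_left)
  have np_nn: "0 \<le> nonneg_power x q" for x by (simp add: nonneg_power_def)
  have int: "integrable M (\<lambda>\<omega>. exp (q * A \<omega>) * nonneg_power (z \<omega>) q)"
  proof (rule Bochner_Integration.integrable_bound)
    show "integrable M (\<lambda>\<omega>. exp (q * A \<omega>) + exp (q * A \<omega>) * z \<omega> ^ p)" using U0 Up by simp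
    show "AE \<omega> in M. norm (exp (q * A \<omega>) * nonneg_power (z \<omega>) q) \<le> norm (exp (q * A \<omega>) + exp (q * A \<omega>) * z \<omega> ^ p)"
      using z_le z_nn np_nn by (auto simp: abs_mult intro: order_trans)
  qed measurable
  have E_eq: "expectation (\<lambda>\<omega>. nonneg_power (m \<omega>) q) = \<rho> powr q * expectation (\<lambda>\<omega>. exp (q * A \<omega>) * nonneg_power (z \<omega>) q)"
    unfolding m_eq by simp
  have "expectation (\<lambda>\<omega>. exp (q * A \<omega>) * nonneg_power (z \<omega>) q) \<le> expectation (\<lambda>\<omega>. exp (q * A \<omega>) + exp (q * A \<omega>) * z \<omega> ^ p)"
    by (rule integral_mono[OF int _ z_le]) (use U0 Up in simp)
  also have "\<dots> \<le> (C0 + Cp) * E0" using U0 Up by (simp add: distrib_right)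
  finally have "\<rho> powr q * expectation (\<lambda>\<omega>. exp (q * A \<omega>) * nonneg_power (z \<omega>) q) \<le> \<rho> powr q * ((C0 + Cp) * E0)"
    by (rule mult_left_mono) simp
  then show "expectation (\<lambda>\<omega>. nonneg_power (m \<omega>) q) \<le> (C0 + Cp) * (\<rho> powr q * E0)"
    unfolding E_eq by (simp add: mult_ac)
  have \<epsilon>: "0 < \<epsilon>" and \<kappa>: "0 < \<kappa>" using pos by (auto simp: \<epsilon>_def \<kappa>_def intro!: divide_pos_pos add_pos_nonneg)
  define u where "u = (\<lambda>\<omega>. exp (q * A \<omega>))"
  \<comment> \<open>The tilted parabola, with the favourable term 2 \<kappa>^2 \<epsilon> z dropped.\<close>
  define L where "L \<omega> = 2 * \<kappa> * (u \<omega> * z \<omega>) - (2 * \<kappa> * \<epsilon> + \<kappa>\<^sup>2 * \<epsilon>\<^sup>2) * u \<omega> - \<kappa>\<^sup>2 * (u \<omega> * z \<omega> ^ 2)" for \<omega>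
  have L_int: "integrable M L" unfolding L_def u_def using U0 U1_int U2 by simp
  have "\<kappa> * c1 / 2 * E0 \<le> expectation L"
  proof -
    have "expectation L = 2 * \<kappa> * expectation (\<lambda>\<omega>. u \<omega> * z \<omega>) - (2 * \<kappa> * \<epsilon> + \<kappa>\<^sup>2 * \<epsilon>\<^sup>2) * expectation u
        - \<kappa>\<^sup>2 * expectation (\<lambda>\<omega>. u \<omega> * z \<omega> ^ 2)"
      unfolding L_def u_def using U0 U1_int U2 by simp
    also have "\<dots> \<ge> 2 * \<kappa> * (c1 * E0) - (2 * \<kappa> * \<epsilon> + \<kappa>\<^sup>2 * \<epsilon>\<^sup>2) * (C0 * E0) - \<kappa>\<^sup>2 * (C2 * E0)"
      unfolding u_def using U0 U1 U2 \<kappa> \<epsilon> by (intro diff_mono mult_left_mono) auto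
    also have "2 * \<kappa> * (c1 * E0) - (2 * \<kappa> * \<epsilon> + \<kappa>\<^sup>2 * \<epsilon>\<^sup>2) * (C0 * E0) - \<kappa>\<^sup>2 * (C2 * E0)
        = (2 * \<kappa> * c1 - \<kappa> * (2 * \<epsilon> * C0) - \<kappa> * (\<kappa> * (C2 + \<epsilon>\<^sup>2 * C0))) * E0"
      by (simp add: algebra_simps power2_eq_square)
    also have "2 * \<epsilon> * C0 = c1" using pos by (simp add: \<epsilon>_def)
    also have "\<kappa> * (C2 + \<epsilon>\<^sup>2 * C0) = c1 / 2"
    proof -
      define D where "D = C2 + \<epsilon>\<^sup>2 * C0"
      have "0 < D" using pos by (auto simp: D_def intro!: add_pos_nonneg)
      then show ?thesis unfolding \<kappa>_def D_def[symmetric] by simp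
    qed
    finally show ?thesis by (simp add: algebra_simps)
  qed
  then have "\<epsilon> powr q * (\<kappa> * c1 / 2 * E0) \<le> \<epsilon> powr q * expectation L" by (rule mult_left_mono) simp
  also have "\<dots> = expectation (\<lambda>\<omega>. \<epsilon> powr q * L \<omega>)" by simp
  also have "\<dots> \<le> expectation (\<lambda>\<omega>. exp (q * A \<omega>) * nonneg_power (z \<omega>) q)"
  proof (rule integral_mono[OF _ int])
    fix \<omega>
    have "0 \<le> 2 * \<kappa>\<^sup>2 * \<epsilon> * z \<omega>" using \<epsilon> z_nn by simp
    then have "2 * \<kappa> * z \<omega> - (2 * \<kappa> * \<epsilon> + \<kappa>\<^sup>2 * \<epsilon>\<^sup>2) - \<kappa>\<^sup>2 * z \<omega> ^ 2 \<le> 2 * (\<kappa> * (z \<omega> - \<epsilon>)) - (\<kappa> * (z \<omega> - \<epsilon>))\<^sup>2"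
      by (simp add: power2_eq_square algebra_simps)
    then have "\<epsilon> powr q * (2 * \<kappa> * z \<omega> - (2 * \<kappa> * \<epsilon> + \<kappa>\<^sup>2 * \<epsilon>\<^sup>2) - \<kappa>\<^sup>2 * z \<omega> ^ 2) \<le> nonneg_power (z \<omega>) q"
      using nonneg_power_ge_parabola[OF z_nn[of \<omega>] q(1) \<epsilon> \<kappa>]
      by (meson mult_left_mono order_trans powr_ge_zero)
    then have "u \<omega> * (\<epsilon> powr q * (2 * \<kappa> * z \<omega> - (2 * \<kappa> * \<epsilon> + \<kappa>\<^sup>2 * \<epsilon>\<^sup>2) - \<kappa>\<^sup>2 * z \<omega> ^ 2)) \<le> u \<omega> * nonneg_power (z \<omega>) q"
      by (rule mult_left_mono) (simp add: u_def)
    then show "\<epsilon> powr q * L \<omega> \<le> exp (q * A \<omega>) * nonneg_power (z \<omega>) q"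
      unfolding L_def fun_cong[OF u_def, symmetric] by (simp add: algebra_simps)
  qed (use L_int in simp)
  finally have "\<rho> powr q * (\<epsilon> powr q * (\<kappa> * c1 / 2 * E0)) \<le> \<rho> powr q * expectation (\<lambda>\<omega>. exp (q * A \<omega>) * nonneg_power (z \<omega>) q)"
    by (rule mult_left_mono) simp
  then show "\<epsilon> powr q * (\<kappa> * c1 / 2) * (\<rho> powr q * E0) \<le> expectation (\<lambda>\<omega>. nonneg_power (m \<omega>) q)"
    unfolding E_eq by (simp add: mult_ac)
qed

text \<open>
  Young's inequality, made to show that convergence in L_p for some p \<ge> 2 implies convergence of
  integrals against a weight W with finite second moment.
\<close>

lemma weighted_diff_le:
  fixes W x \<epsilon> :: real
  assumes "0 \<le> W" "0 \<le> x" "0 < \<epsilon>" "2 \<le> p"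
  shows "W * x \<le> \<epsilon> * (W\<^sup>2 + 1) + x ^ p / \<epsilon> ^ (p - 1)"
proof -
  obtain k where k: "p = Suc (Suc k)" using assms(4) by (metis Suc_le_D numeral_2_eq_2 Suc_le_mono)
  have "W * x \<le> \<epsilon> * W\<^sup>2 + x\<^sup>2 / \<epsilon>"
  proof -
    have "2 * (\<epsilon> * W) * x \<le> (\<epsilon> * W)\<^sup>2 + x\<^sup>2" by (rule sum_squares_bound)
    moreover have "0 \<le> \<epsilon> * W * x" using assms by simp
    ultimately have "\<epsilon> * W * x \<le> (\<epsilon> * W)\<^sup>2 + x\<^sup>2" by linarith
    also have "\<dots> = \<epsilon> * (\<epsilon> * W\<^sup>2 + x\<^sup>2 / \<epsilon>)"
      using assms by (simp add: distrib_left power2_eq_square)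
    finally have "\<epsilon> * (W * x) \<le> \<epsilon> * (\<epsilon> * W\<^sup>2 + x\<^sup>2 / \<epsilon>)" by (simp add: mult.assoc)
    then show ?thesis using assms by simp
  qed
  moreover have "x\<^sup>2 / \<epsilon> \<le> \<epsilon> + x ^ p / \<epsilon> ^ (p - 1)"
  proof (cases "x \<le> \<epsilon>")
    case True
    then have "x\<^sup>2 \<le> \<epsilon> * \<epsilon>" using assms by (simp add: power2_eq_square mult_mono)
    then have "x\<^sup>2 / \<epsilon> \<le> \<epsilon>" using assms by (simp add: divide_le_eq)
    then show ?thesis using assms by (simp add: add_increasing2)
  next
    case False
    then have "\<epsilon> ^ k \<le> x ^ k" using assms by (intro power_mono) auto
    then have "x\<^sup>2 * \<epsilon> ^ k \<le> x\<^sup>2 * x ^ k" by (rule mult_left_mono) simp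
    then have "x\<^sup>2 / \<epsilon> \<le> x ^ p / \<epsilon> ^ (p - 1)"
      using assms by (simp add: k field_simps power2_eq_square)
    then show ?thesis using assms by simp
  qed
  ultimately show ?thesis by (simp add: distrib_left)
qed

lemma tendsto_affine_ratio:
  fixes x y :: "nat \<Rightarrow> real"
  assumes x: "\<And>l. \<bar>x l - real l * \<alpha>\<bar> \<le> K" and y: "\<forall>\<^sub>F l in sequentially. \<bar>y l - real l * \<beta>\<bar> \<le> K'" and \<beta>: "\<beta> \<noteq> 0"
  shows "(\<lambda>l. x l / y l) \<longlonglongrightarrow> \<alpha> / \<beta>"
proof -
  have *: "(\<lambda>l. z l / real l) \<longlonglongrightarrow> \<gamma>" if z: "\<forall>\<^sub>F l in sequentially. \<bar>z l - real l * \<gamma>\<bar> \<le> K" for z :: "nat \<Rightarrow> real" and \<gamma> K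
  proof (rule LIM_zero_cancel, rule tendsto_0_le[where K=1])
    show "(\<lambda>l. K / real l) \<longlonglongrightarrow> 0" by (rule lim_const_over_n)
    show "\<forall>\<^sub>F l in sequentially. norm (z l / real l - \<gamma>) \<le> norm (K / real l) * 1"
      using z eventually_gt_at_top[of 0]
    proof eventually_elim
      case (elim l)
      have "z l / real l - \<gamma> = (z l - real l * \<gamma>) / real l" using elim by (simp add: diff_divide_distrib)
      then show ?case using elim by (auto simp: abs_div intro!: divide_right_mono)
    qed
  qed
  have "(\<lambda>l. (x l / real l) / (y l / real l)) \<longlonglongrightarrow> \<alpha> / \<beta>"
    by (intro tendsto_divide *[OF y] *[OF always_eventually] \<beta>) (use x in blast)
  moreover have "\<forall>\<^sub>F l in sequentially. (x l / real l) / (y l / real l) = x l / y l"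
    using eventually_gt_at_top[of 0] by eventually_elim simp
  ultimately show ?thesis by (rule Lim_transform_eventually)
qed

section \<open>The limiting measure and its Renyi function\<close>

context gaussian_cascade
begin

context
  fixes \<mu> :: "'w \<Rightarrow> 'u measure"
  assumes lim: "limiting_measure M b X p \<mu>"
begin

abbreviation lmass :: "'u set \<Rightarrow> 'w \<Rightarrow> real" where "lmass B \<omega> \<equiv> measure (\<mu> \<omega>) B"

lemma lmass_meas [measurable]: "B \<in> sets \<sigma> \<Longrightarrow> lmass B \<in> borel_measurable M"
  using lim by (auto simp: limiting_measure_def random_measure_def)

lemma lmass_AE: "B \<in> sets \<sigma> \<Longrightarrow> AE \<omega> in M. (\<lambda>n. mass n B \<omega>) \<longlonglongrightarrow> lmass B \<omega>"
  using lim by (auto simp: limiting_measure_def mass_def)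

lemma lmass_Lp: "B \<in> sets \<sigma> \<Longrightarrow> (\<lambda>n. \<integral>\<^sup>+\<omega>. ennreal (\<bar>mass n B \<omega> - lmass B \<omega>\<bar> ^ p) \<partial>M) \<longlonglongrightarrow> 0"
  using lim by (auto simp: limiting_measure_def mass_def)

text \<open>
  Bounds that are uniform in N survive the almost sure limit, by Fatou's lemma.
\<close>

lemma limit_moment_upper:
  assumes B [measurable]: "B \<in> sets \<sigma>" and [measurable]: "W \<in> borel_measurable M" and W: "\<And>\<omega>. 0 \<le> W \<omega>"
    and D: "\<And>N. n \<le> Suc N \<Longrightarrow> (\<integral>\<^sup>+\<omega>. ennreal (W \<omega>) * emass N B \<omega> ^ k \<partial>M) \<le> D"
  shows "(\<integral>\<^sup>+\<omega>. ennreal (W \<omega> * lmass B \<omega> ^ k) \<partial>M) \<le> D"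
proof -
  have "AE \<omega> in M. \<forall>N. emass N B \<omega> = ennreal (mass N B \<omega>)"
    using AE_emass_mass[OF B] by (simp add: AE_all_countable)
  with lmass_AE[OF B] have "AE \<omega> in M. ennreal (W \<omega> * lmass B \<omega> ^ k) = liminf (\<lambda>N. ennreal (W \<omega>) * emass N B \<omega> ^ k)"
  proof eventually_elim
    case (elim \<omega>)
    have "(\<lambda>N. ennreal (W \<omega> * mass N B \<omega> ^ k)) \<longlonglongrightarrow> ennreal (W \<omega> * lmass B \<omega> ^ k)"
      by (intro tendsto_intros elim)
    moreover have "ennreal (W \<omega> * mass N B \<omega> ^ k) = ennreal (W \<omega>) * emass N B \<omega> ^ k" for N
      using W mass_nonneg elim by (simp add: ennreal_mult ennreal_power)
    ultimately show ?case by (simp add: lim_imp_Liminf)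
  qed
  then have "(\<integral>\<^sup>+\<omega>. ennreal (W \<omega> * lmass B \<omega> ^ k) \<partial>M) = (\<integral>\<^sup>+\<omega>. liminf (\<lambda>N. ennreal (W \<omega>) * emass N B \<omega> ^ k) \<partial>M)"
    by (rule nn_integral_cong_AE)
  also have "\<dots> \<le> liminf (\<lambda>N. \<integral>\<^sup>+\<omega>. ennreal (W \<omega>) * emass N B \<omega> ^ k \<partial>M)"
    by (rule nn_integral_liminf) measurable
  also have "\<dots> \<le> limsup (\<lambda>N. \<integral>\<^sup>+\<omega>. ennreal (W \<omega>) * emass N B \<omega> ^ k \<partial>M)"
    by (rule Liminf_le_Limsup) simp
  also have "\<dots> \<le> D"
    by (rule Limsup_bounded, unfold eventually_sequentially, rule exI[of _ n]) (auto intro: D)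
  finally show ?thesis .
qed

text \<open>
  Fatou's lemma goes the wrong way here; the convergence in L_p is used instead.
\<close>

lemma limit_moment_lower:
  assumes B [measurable]: "B \<in> sets \<sigma>" and [measurable]: "W \<in> borel_measurable M" and W: "\<And>\<omega>. 0 \<le> W \<omega>"
    and W2: "(\<integral>\<^sup>+\<omega>. ennreal ((W \<omega>)\<^sup>2) \<partial>M) < \<infinity>"
    and L: "\<And>N. n \<le> Suc N \<Longrightarrow> L \<le> (\<integral>\<^sup>+\<omega>. ennreal (W \<omega>) * emass N B \<omega> \<partial>M)"
  shows "L \<le> (\<integral>\<^sup>+\<omega>. ennreal (W \<omega> * lmass B \<omega>) \<partial>M)"
proof -
  define D where "D = enn2real ((\<integral>\<^sup>+\<omega>. ennreal ((W \<omega>)\<^sup>2) \<partial>M) + 1)"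
  have D: "ennreal D = (\<integral>\<^sup>+\<omega>. ennreal ((W \<omega>)\<^sup>2) \<partial>M) + 1"
    unfolding D_def using W2 by (intro ennreal_enn2real) (simp add: ennreal_add_eq_top less_top)
  have "1 \<le> ennreal D" unfolding D by simp
  then have D1: "1 \<le> D" by simp
  have "L \<le> (\<integral>\<^sup>+\<omega>. ennreal (W \<omega> * lmass B \<omega>) \<partial>M) + ennreal e" if e: "0 < e" for e :: real
  proof -
    define \<epsilon> where "\<epsilon> = e / D"
    have \<epsilon>: "0 < \<epsilon>" using e D1 by (simp add: \<epsilon>_def)
    let ?r = "\<lambda>N. \<integral>\<^sup>+\<omega>. ennreal (\<bar>mass N B \<omega> - lmass B \<omega>\<bar> ^ p) \<partial>M"
    have bnd: "L \<le> (\<integral>\<^sup>+\<omega>. ennreal (W \<omega> * lmass B \<omega>) \<partial>M) + ennreal e + ennreal (1 / \<epsilon> ^ (p - 1)) * ?r N"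
      if N: "n \<le> Suc N" for N
    proof -
      have "L \<le> (\<integral>\<^sup>+\<omega>. ennreal (W \<omega>) * emass N B \<omega> \<partial>M)" by (rule L[OF N])
      also have "\<dots> = (\<integral>\<^sup>+\<omega>. ennreal (W \<omega> * mass N B \<omega>) \<partial>M)"
        by (rule nn_integral_cong_AE, use AE_emass_mass[OF B, of N] in eventually_elim)
          (use W mass_nonneg in \<open>simp add: ennreal_mult\<close>)
      also have "\<dots> \<le> (\<integral>\<^sup>+\<omega>. ennreal (W \<omega> * lmass B \<omega>) + (ennreal \<epsilon> * (ennreal ((W \<omega>)\<^sup>2) + 1)
          + ennreal (1 / \<epsilon> ^ (p - 1)) * ennreal (\<bar>mass N B \<omega> - lmass B \<omega>\<bar> ^ p)) \<partial>M)"
      proof (rule nn_integral_mono)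
        fix \<omega>
        define x where "x = \<bar>mass N B \<omega> - lmass B \<omega>\<bar>"
        have "W \<omega> * mass N B \<omega> \<le> W \<omega> * (lmass B \<omega> + x)" using W by (intro mult_left_mono) (auto simp: x_def)
        also have "\<dots> \<le> W \<omega> * lmass B \<omega> + (\<epsilon> * ((W \<omega>)\<^sup>2 + 1) + 1 / \<epsilon> ^ (p - 1) * x ^ p)"
          using weighted_diff_le[OF W[of \<omega>] _ \<epsilon> p, of x] by (simp add: x_def distrib_left)
        finally have "ennreal (W \<omega> * mass N B \<omega>) \<le> ennreal (W \<omega> * lmass B \<omega> + (\<epsilon> * ((W \<omega>)\<^sup>2 + 1) + 1 / \<epsilon> ^ (p - 1) * x ^ p))"
          by (rule ennreal_leI)
        also have "\<dots> = ennreal (W \<omega> * lmass B \<omega>) + (ennreal (\<epsilon> * ((W \<omega>)\<^sup>2 + 1)) + ennreal (1 / \<epsilon> ^ (p - 1) * x ^ p))"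
          using W \<epsilon> by (simp add: x_def)
        also have "ennreal (\<epsilon> * ((W \<omega>)\<^sup>2 + 1)) = ennreal \<epsilon> * (ennreal ((W \<omega>)\<^sup>2) + 1)"
          using \<epsilon> by (simp add: ennreal_mult)
        also have "ennreal (1 / \<epsilon> ^ (p - 1) * x ^ p) = ennreal (1 / \<epsilon> ^ (p - 1)) * ennreal (x ^ p)"
          using \<epsilon> by (intro ennreal_mult) (auto simp: x_def)
        finally show "ennreal (W \<omega> * mass N B \<omega>) \<le> ennreal (W \<omega> * lmass B \<omega>) + (ennreal \<epsilon> * (ennreal ((W \<omega>)\<^sup>2) + 1)
          + ennreal (1 / \<epsilon> ^ (p - 1)) * ennreal (\<bar>mass N B \<omega> - lmass B \<omega>\<bar> ^ p))"
          unfolding x_def .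
      qed
      also have "\<dots> = (\<integral>\<^sup>+\<omega>. ennreal (W \<omega> * lmass B \<omega>) \<partial>M) + (ennreal \<epsilon> * ennreal D + ennreal (1 / \<epsilon> ^ (p - 1)) * ?r N)"
        unfolding D by (simp add: nn_integral_add nn_integral_cmult emeasure_space_1)
      also have "ennreal \<epsilon> * ennreal D = ennreal e"
        using \<epsilon> D1 by (simp add: ennreal_mult[symmetric]) (simp add: \<epsilon>_def)
      finally show ?thesis by (simp add: add.assoc)
    qed
    have "(\<lambda>N. (\<integral>\<^sup>+\<omega>. ennreal (W \<omega> * lmass B \<omega>) \<partial>M) + ennreal e + ennreal (1 / \<epsilon> ^ (p - 1)) * ?r N)
        \<longlonglongrightarrow> (\<integral>\<^sup>+\<omega>. ennreal (W \<omega> * lmass B \<omega>) \<partial>M) + ennreal e + ennreal (1 / \<epsilon> ^ (p - 1)) * 0"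
      by (intro tendsto_add tendsto_const ennreal_tendsto_cmult lmass_Lp B) simp
    then have "L \<le> (\<integral>\<^sup>+\<omega>. ennreal (W \<omega> * lmass B \<omega>) \<partial>M) + ennreal e + ennreal (1 / \<epsilon> ^ (p - 1)) * 0"
      by (rule LIMSEQ_le_const) (use bnd in \<open>auto intro!: exI[of _ n]\<close>)
    then show ?thesis by simp
  qed
  then show ?thesis by (rule ennreal_le_epsilon)
qed

lemma lmass_integrable:
  assumes B: "B \<in> sets \<sigma>"
  shows "integrable M (\<lambda>\<omega>. lmass B \<omega> ^ p)"
proof -
  obtain C where C: "\<And>N B. B \<in> sets \<sigma> \<Longrightarrow> (\<integral>\<^sup>+\<omega>. emass N B \<omega> ^ p \<partial>M) \<le> ennreal C"
    using emass_moment_bounded by blast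
  have "(\<integral>\<^sup>+\<omega>. ennreal (1 * lmass B \<omega> ^ p) \<partial>M) \<le> ennreal C"
    by (rule limit_moment_upper[OF B, of _ 0]) (use C[OF B] in auto)
  then show ?thesis using lmass_meas[OF B]
    by (intro integrableI_nonneg) (auto intro: le_less_trans)
qed

text \<open>
  The masses have mean equal to the surface measure at every level, and it does not drop
  in the limit.
\<close>

lemma limiting_nondegenerate: "nondegenerate M \<mu>"
  unfolding nondegenerate_def
proof
  assume null: "AE \<omega> in M. \<mu> \<omega> = null_measure (\<mu> \<omega>)"
  have "emeasure \<sigma> (sphere 0 1) \<le> (\<integral>\<^sup>+\<omega>. ennreal (1 * lmass (sphere 0 1) \<omega>) \<partial>M)"
    by (rule limit_moment_lower[OF sphere_sets, of _ 0])
      (use emass_mean[OF sphere_sets] in \<open>auto simp: emeasure_space_1\<close>)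
  also have "\<dots> = (\<integral>\<^sup>+\<omega>. 0 \<partial>M)"
  proof (rule nn_integral_cong_AE, use null in eventually_elim)
    fix \<omega> assume "\<mu> \<omega> = null_measure (\<mu> \<omega>)"
    then have "lmass (sphere 0 1) \<omega> = measure (null_measure (\<mu> \<omega>)) (sphere 0 1)" by simp
    then show "ennreal (1 * lmass (sphere 0 1) \<omega>) = 0" by (simp add: measure_def)
  qed
  finally have z: "emeasure \<sigma> (sphere 0 1) = 0" by simp
  obtain \<theta> :: 'u where \<theta>: "norm \<theta> = 1" using vector_choose_size[of 1] by auto
  have "0 < ennreal (unit_ball_vol (Suc d) / 8 ^ Suc d * 1 ^ d)" by simp
  also have "\<dots> \<le> emeasure \<sigma> {x \<in> sphere 0 1. norm (x - \<theta>) \<le> 1}" by (rule emeasure_cap_ge[OF \<theta>]) auto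
  also have "\<dots> \<le> emeasure \<sigma> (sphere 0 1)" by (rule emeasure_mono[OF _ sphere_sets]) auto
  finally show False using z by simp
qed

text \<open>
  The factor b^(-n d) exp (- n s^2 / 2) is the volume of the cell times the normalisation of the
  coarse levels, and exp (n q^2 s^2 / 2) is the mean of exp (q A) for the coarse field A.
\<close>

lemma cell_moment_bounds:
  assumes q: "0 \<le> q" "q \<le> real p" and v: "0 < v"
  obtains c C where "0 < c" "0 < C" "\<And>n B \<theta>. small_cell a n \<theta> B \<Longrightarrow>
    ennreal (v * (1 / b ^ n) ^ d) \<le> emeasure \<sigma> B \<Longrightarrow>
    expectation (\<lambda>\<omega>. nonneg_power (lmass B \<omega>) q) \<le> C * (((1 / b ^ n) ^ d * exp (- (n * s\<^sup>2 / 2))) powr q * exp (n * q\<^sup>2 * s\<^sup>2 / 2)) \<and>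
    c * (((1 / b ^ n) ^ d * exp (- (n * s\<^sup>2 / 2))) powr q * exp (n * q\<^sup>2 * s\<^sup>2 / 2)) \<le> expectation (\<lambda>\<omega>. nonneg_power (lmass B \<omega>) q)"
proof -
  define C0 C2 Cp where "C0 = moment_const a q 0" and "C2 = moment_const a q 2" and "Cp = moment_const a q p"
  define c1 where "c1 = exp (- distortion a (q - 1) 1) * v"
  define \<epsilon> where "\<epsilon> = c1 / (2 * C0)"
  define \<kappa> where "\<kappa> = c1 / (2 * (C2 + \<epsilon>\<^sup>2 * C0))"
  have pos: "0 < c1" "0 < C0" "0 < C2" "0 < Cp"
    using v p by (auto simp: c1_def C0_def C2_def Cp_def intro: moment_const_pos)
  have \<epsilon>\<kappa>: "0 < \<epsilon>" "0 < \<kappa>" using pos by (auto simp: \<epsilon>_def \<kappa>_def intro!: divide_pos_pos add_pos_nonneg)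
  show ?thesis
  proof (rule that[of "\<epsilon> powr q * (\<kappa> * c1 / 2)" "C0 + Cp"])
    show "0 < \<epsilon> powr q * (\<kappa> * c1 / 2)" "0 < C0 + Cp" using pos \<epsilon>\<kappa> by auto
    fix n B \<theta>
    assume cell: "small_cell a n \<theta> B" and vol: "ennreal (v * (1 / b ^ n) ^ d) \<le> emeasure \<sigma> B"
    have B [measurable]: "B \<in> sets \<sigma>" using cell by (simp add: small_cell_def)
    define \<rho> where "\<rho> = (1 / b ^ n) ^ d * exp (- (n * s\<^sup>2 / 2))"
    define E0 where "E0 = exp (n * q\<^sup>2 * s\<^sup>2 / 2)"
    have \<rho>: "0 < \<rho>" and E0: "0 < E0" using b by (auto simp: \<rho>_def E0_def)
    have lam: "exp (n * (q\<^sup>2 - k) * s\<^sup>2 / 2) * (1 / b ^ n) ^ (d * k) = E0 * \<rho> ^ k" for k :: nat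
    proof -
      have "exp (- (n * s\<^sup>2 / 2)) ^ k = exp (- (real k * (n * s\<^sup>2 / 2)))"
        by (simp add: exp_of_nat_mult[symmetric])
      then have "E0 * exp (- (n * s\<^sup>2 / 2)) ^ k = exp (n * (q\<^sup>2 - k) * s\<^sup>2 / 2)"
        by (simp add: E0_def exp_add[symmetric] algebra_simps diff_divide_distrib)
      moreover have "\<rho> ^ k = (1 / b ^ n) ^ (d * k) * exp (- (n * s\<^sup>2 / 2)) ^ k"
        unfolding \<rho>_def power_mult_distrib power_mult ..
      ultimately show ?thesis by (simp add: mult_ac)
    qed
    have up: "(\<integral>\<^sup>+\<omega>. ennreal (exp ((q - k) * coarse_field n \<theta> \<omega>) * lmass B \<omega> ^ k) \<partial>M) \<le> ennreal (moment_const a q k * E0 * \<rho> ^ k)"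
      if k: "k \<le> p" for k
    proof (rule limit_moment_upper[OF B, where n=n])
      fix N assume "n \<le> Suc N"
      then have "(\<integral>\<^sup>+\<omega>. ennreal (exp ((q - k) * coarse_field n \<theta> \<omega>)) * emass N B \<omega> ^ k \<partial>M)
        \<le> ennreal (moment_const a q k * exp (n * (q\<^sup>2 - k) * s\<^sup>2 / 2) * (1 / b ^ n) ^ (d * k))"
        by (rule moment_upper[OF k _ cell])
      also have "moment_const a q k * exp (n * (q\<^sup>2 - k) * s\<^sup>2 / 2) * (1 / b ^ n) ^ (d * k) = moment_const a q k * E0 * \<rho> ^ k"
        using lam[of k] by (simp only: mult.assoc)
      finally show "(\<integral>\<^sup>+\<omega>. ennreal (exp ((q - k) * coarse_field n \<theta> \<omega>)) * emass N B \<omega> ^ k \<partial>M) \<le> ennreal (moment_const a q k * E0 * \<rho> ^ k)" .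
    qed auto
    have M0: "(\<integral>\<^sup>+\<omega>. ennreal (exp (q * coarse_field n \<theta> \<omega>)) \<partial>M) \<le> ennreal (C0 * E0)" using up[of 0] by (simp add: C0_def)
    have M2: "(\<integral>\<^sup>+\<omega>. ennreal (exp ((q - 2) * coarse_field n \<theta> \<omega>) * lmass B \<omega> ^ 2) \<partial>M) \<le> ennreal (C2 * E0 * \<rho> ^ 2)" using up[of 2] p by (simp add: C2_def)
    have Mp: "(\<integral>\<^sup>+\<omega>. ennreal (exp ((q - p) * coarse_field n \<theta> \<omega>) * lmass B \<omega> ^ p) \<partial>M) \<le> ennreal (Cp * E0 * \<rho> ^ p)" unfolding Cp_def by (rule up) simp
    have M1: "ennreal (c1 * E0 * \<rho>) \<le> (\<integral>\<^sup>+\<omega>. ennreal (exp ((q - 1) * coarse_field n \<theta> \<omega>) * lmass B \<omega>) \<partial>M)"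
    proof (rule limit_moment_lower[OF B, where n=n])
      have "(\<integral>\<^sup>+\<omega>. ennreal ((exp ((q - 1) * coarse_field n \<theta> \<omega>))\<^sup>2) \<partial>M)
          = (\<integral>\<^sup>+\<omega>. ennreal (exp ((2 * (q - 1) - real 0) * coarse_field n \<theta> \<omega>)) * emass n B \<omega> ^ 0 \<partial>M)"
        by (simp add: power2_eq_square exp_add[symmetric] algebra_simps)
      also have "\<dots> \<le> ennreal (moment_const a (2 * (q - 1)) 0 * exp (n * ((2 * (q - 1))\<^sup>2 - real 0) * s\<^sup>2 / 2) * (1 / b ^ n) ^ (d * 0))"
        by (rule moment_upper[OF _ _ cell]) auto
      also have "\<dots> < \<infinity>" by simp
      finally show "(\<integral>\<^sup>+\<omega>. ennreal ((exp ((q - 1) * coarse_field n \<theta> \<omega>))\<^sup>2) \<partial>M) < \<infinity>" .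
    next
      fix N assume N: "n \<le> Suc N"
      define e where "e = exp (- distortion a (q - 1) 1) * exp (n * (q\<^sup>2 - 1) * s\<^sup>2 / 2)"
      have eq: "c1 * E0 * \<rho> = e * (v * (1 / b ^ n) ^ d)"
        using lam[of 1] by (simp add: c1_def e_def mult_ac)
      have "ennreal (c1 * E0 * \<rho>) = ennreal e * ennreal (v * (1 / b ^ n) ^ d)"
        unfolding eq using v b by (intro ennreal_mult) (auto simp: e_def)
      also have "\<dots> \<le> ennreal e * emeasure \<sigma> B" by (rule mult_left_mono[OF vol]) simp
      also have "\<dots> \<le> (\<integral>\<^sup>+\<omega>. ennreal (exp ((q - 1) * coarse_field n \<theta> \<omega>)) * emass N B \<omega> \<partial>M)"
        unfolding e_def by (rule moment_lower[OF N cell])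
      finally show "ennreal (c1 * E0 * \<rho>) \<le> (\<integral>\<^sup>+\<omega>. ennreal (exp ((q - 1) * coarse_field n \<theta> \<omega>)) * emass N B \<omega> \<partial>M)" .
    qed auto
    note fin = tilted_moment_bounds[OF coarse_field_meas lmass_meas[OF B] measure_nonneg q \<rho> E0 pos(2,1,3,4) M0 M1 M2 Mp]
    show "expectation (\<lambda>\<omega>. nonneg_power (lmass B \<omega>) q) \<le> (C0 + Cp) * (((1 / b ^ n) ^ d * exp (- (n * s\<^sup>2 / 2))) powr q * exp (n * q\<^sup>2 * s\<^sup>2 / 2)) \<and>
      \<epsilon> powr q * (\<kappa> * c1 / 2) * (((1 / b ^ n) ^ d * exp (- (n * s\<^sup>2 / 2))) powr q * exp (n * q\<^sup>2 * s\<^sup>2 / 2)) \<le> expectation (\<lambda>\<omega>. nonneg_power (lmass B \<omega>) q)"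
      using fin unfolding \<rho>_def[symmetric] E0_def[symmetric] \<epsilon>_def[symmetric] \<kappa>_def[symmetric] by blast
  qed
qed

end

lemma scale_index:
  obtains n where "b ^ n \<le> 2 ^ l" "(2::real) ^ l \<le> b * b ^ n" "\<bar>real n - real l * (ln 2 / ln b)\<bar> \<le> 1"
proof -
  have lb: "0 < ln b" using b by simp
  define n where "n = nat \<lfloor>real l * (ln 2 / ln b)\<rfloor>"
  have n: "real n \<le> real l * (ln 2 / ln b)" "real l * (ln 2 / ln b) < real n + 1"
    using lb unfolding n_def by (auto simp: of_nat_nat)
  have "real n * ln b \<le> real l * ln 2" "real l * ln 2 < (real n + 1) * ln b"
    using n lb by (simp_all add: field_simps)
  moreover have "ln (b ^ k) = real k * ln b" for k by (rule ln_realpow)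
  moreover have "ln ((2::real) ^ l) = real l * ln 2" by (rule ln_realpow)
  ultimately have "ln (b ^ n) \<le> ln (2 ^ l)" "ln (2 ^ l) \<le> ln (b ^ Suc n)"
    by (simp_all del: power_Suc add: add.commute)
  then have "b ^ n \<le> 2 ^ l" "2 ^ l \<le> b ^ Suc n"
    using b by (simp_all only: ln_le_cancel_iff zero_less_power zero_less_numeral b_pow_pos)
  then show ?thesis using n by (intro that[of n]) auto
qed

context
  fixes \<mu> :: "'w \<Rightarrow> 'u measure"
  assumes lim: "limiting_measure M b X p \<mu>"
begin

text \<open>
  At mesh level l the coarse levels number about l ln 2 / ln b. The cells are caps up to constants,
  so there are about 2^(l d) of them, each with a q-th moment \<Lambda> l up to constants. All three
  logarithms are linear in l up to bounded errors, and the value is the quotient of the slopes.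
\<close>

theorem renyi_function_limiting_measure:
  assumes mesh: "dyadic_mesh N \<Delta>" and q: "0 \<le> q" "q \<le> real p"
  shows "renyi_function M N \<Delta> \<mu> q =
    ereal (- (s\<^sup>2 / (2 * real d * ln b)) * q\<^sup>2 + (s\<^sup>2 / (2 * real d * ln b) + 1) * q - 1)"
proof -
  have lb: "0 < ln b" using b by simp
  have partition: "(\<Union>m<N l. \<Delta> l m) = sphere 0 1" "disjoint_family_on (\<Delta> l) {..<N l}" for l
    using mesh by (auto simp: dyadic_mesh_def)
  have \<Delta>: "\<Delta> l m \<in> sets \<sigma>" if "m < N l" for l m
    using mesh that partition(1)[of l] by (intro borel_subset_sphere_in_sets) (auto simp: dyadic_mesh_def)
  obtain c0 C0 where c0: "0 < c0" and C0: "0 < C0" and cells: "\<And>l m. m < N l \<Longrightarrow>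
      \<exists>\<theta>\<in>\<Delta> l m. sphere_ball (c0 / 2 ^ l) \<theta> \<subseteq> \<Delta> l m \<and> \<Delta> l m \<subseteq> sphere_ball (C0 / 2 ^ l) \<theta>"
    using mesh unfolding dyadic_mesh_def by blast
  \<comment> \<open>The factor 2 makes the diameter of a cell, and not only its radius, at most scale a n.\<close>
  obtain a where a: "2 * C0 < b ^ a" using real_arch_pow[OF b] by blast
  have "\<forall>l. \<exists>n. b ^ n \<le> 2 ^ l \<and> (2::real) ^ l \<le> b * b ^ n \<and> \<bar>real n - real l * (ln 2 / ln b)\<bar> \<le> 1"
    using scale_index by metis
  then obtain n where n: "\<And>l. b ^ n l \<le> 2 ^ l" "\<And>l. (2::real) ^ l \<le> b * b ^ n l"
      "\<And>l. \<bar>real (n l) - real l * (ln 2 / ln b)\<bar> \<le> 1" by metis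
  define u where "u = min (c0 / 2) 1"
  have u: "0 < u" "u \<le> 1" "u \<le> c0 / 2" using c0 by (auto simp: u_def)
  define v0 where "v0 = unit_ball_vol (Suc d) / 8 ^ Suc d"
  have v0: "0 < v0" by (simp add: v0_def)
  define v where "v = v0 * (u / b) ^ d"
  have v: "0 < v" using v0 u b by (simp add: v_def)
  define t :: "nat \<Rightarrow> real" where "t l = (1 / 2 ^ l) ^ d" for l
  have t: "0 < t l" for l by (simp add: t_def)
  have ln_t: "ln (t l) = - (real l * (real d * ln 2))" for l
    by (simp add: t_def ln_realpow ln_div)
  define A1 where "A1 = v0 * u ^ d"
  define A2 where "A2 = cap_const * C0 ^ d"
  have A: "0 < A1" "0 < A2" using v0 u C0 cap_const_pos by (auto simp: A1_def A2_def)
  have cell: "\<exists>\<theta>. norm \<theta> = 1 \<and> (\<forall>x\<in>\<Delta> l m. norm (x - \<theta>) \<le> C0 / 2 ^ l) \<and>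
      ennreal (A1 * t l) \<le> emeasure \<sigma> (\<Delta> l m) \<and> emeasure \<sigma> (\<Delta> l m) \<le> ennreal (A2 * t l)"
    if m: "m < N l" for l m
  proof -
    obtain \<theta> where \<theta>: "\<theta> \<in> \<Delta> l m" "sphere_ball (c0 / 2 ^ l) \<theta> \<subseteq> \<Delta> l m" "\<Delta> l m \<subseteq> sphere_ball (C0 / 2 ^ l) \<theta>"
      using cells[OF m] by blast
    have n\<theta>: "norm \<theta> = 1" by (rule norm_eq_1_of_mem_sets[OF \<Delta>[OF m] \<theta>(1)])
    have outer: "\<Delta> l m \<subseteq> {x \<in> sphere 0 1. norm (x - \<theta>) \<le> C0 / 2 ^ l}"
      using \<theta>(3) sphere_ball_subset_cap[OF n\<theta>] by blast
    have "{x \<in> sphere 0 1. norm (x - \<theta>) \<le> u / 2 ^ l} \<subseteq> {x \<in> sphere 0 1. norm (x - \<theta>) \<le> (c0 / 2 ^ l) / 2}"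
    proof -
      have "u / 2 ^ l \<le> (c0 / 2) / 2 ^ l" using u by (intro divide_right_mono) auto
      then show ?thesis by (auto simp: mult.commute)
    qed
    then have inner: "{x \<in> sphere 0 1. norm (x - \<theta>) \<le> u / 2 ^ l} \<subseteq> \<Delta> l m"
      using \<theta>(2) cap_subset_sphere_ball[OF n\<theta>, of "c0 / 2 ^ l"] by blast
    have "u / 2 ^ l \<le> 1 / 1" using u by (intro frac_le) auto
    then have "ennreal (v0 * (u / 2 ^ l) ^ d) \<le> emeasure \<sigma> {x \<in> sphere 0 1. norm (x - \<theta>) \<le> u / 2 ^ l}"
      unfolding v0_def using u by (intro emeasure_cap_ge n\<theta>) auto
    also have "\<dots> \<le> emeasure \<sigma> (\<Delta> l m)" by (rule emeasure_mono[OF inner \<Delta>[OF m]])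
    finally have 1: "ennreal (A1 * t l) \<le> emeasure \<sigma> (\<Delta> l m)"
      by (simp add: A1_def t_def power_divide)
    have "emeasure \<sigma> (\<Delta> l m) \<le> emeasure \<sigma> {x \<in> sphere 0 1. norm (x - \<theta>) \<le> C0 / 2 ^ l}"
      by (rule emeasure_mono[OF outer cap_sets])
    also have "\<dots> \<le> ennreal (cap_const * (C0 / 2 ^ l) ^ d)" using C0 by (intro cap_le n\<theta>) simp
    finally have 2: "emeasure \<sigma> (\<Delta> l m) \<le> ennreal (A2 * t l)"
      by (simp add: A2_def t_def power_divide)
    show ?thesis using n\<theta> outer 1 2 by blast
  qed
  have vol: "A1 * t l \<le> measure \<sigma> (\<Delta> l m)" "measure \<sigma> (\<Delta> l m) \<le> A2 * t l" if "m < N l" for l m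
    using cell[OF that] A t[of l] unfolding \<sigma>.emeasure_eq_measure by (auto simp: ennreal_le_iff)
  obtain c C where c: "0 < c" and C: "0 < C" and bounds: "\<And>n B \<theta>. small_cell a n \<theta> B \<Longrightarrow>
    ennreal (v * (1 / b ^ n) ^ d) \<le> emeasure \<sigma> B \<Longrightarrow>
    expectation (\<lambda>\<omega>. nonneg_power (measure (\<mu> \<omega>) B) q) \<le> C * (((1 / b ^ n) ^ d * exp (- (n * s\<^sup>2 / 2))) powr q * exp (n * q\<^sup>2 * s\<^sup>2 / 2)) \<and>
    c * (((1 / b ^ n) ^ d * exp (- (n * s\<^sup>2 / 2))) powr q * exp (n * q\<^sup>2 * s\<^sup>2 / 2)) \<le> expectation (\<lambda>\<omega>. nonneg_power (measure (\<mu> \<omega>) B) q)"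
    by (rule cell_moment_bounds[OF lim q v, where a=a]) blast
  define \<Lambda> where "\<Lambda> l = ((1 / b ^ n l) ^ d * exp (- (n l * s\<^sup>2 / 2))) powr q * exp (n l * q\<^sup>2 * s\<^sup>2 / 2)" for l
  have \<Lambda>: "0 < \<Lambda> l" for l using b by (simp add: \<Lambda>_def)
  define \<kappa> where "\<kappa> = q\<^sup>2 * s\<^sup>2 / 2 - q * s\<^sup>2 / 2 - q * (d * ln b)"
  have ln_\<Lambda>: "ln (\<Lambda> l) = n l * \<kappa>" for l
  proof -
    have "ln (\<Lambda> l) = q * ln ((1 / b ^ n l) ^ d * exp (- (n l * s\<^sup>2 / 2))) + n l * q\<^sup>2 * s\<^sup>2 / 2"
      using b unfolding \<Lambda>_def by (subst ln_mult) (auto simp: ln_powr)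
    also have "ln ((1 / b ^ n l) ^ d * exp (- (n l * s\<^sup>2 / 2))) = - (d * (n l * ln b)) - n l * s\<^sup>2 / 2"
      using b by (subst ln_mult) (auto simp: ln_realpow ln_div)
    finally show ?thesis by (simp add: \<kappa>_def algebra_simps)
  qed
  have mom: "c * \<Lambda> l \<le> expectation (\<lambda>\<omega>. nonneg_power (measure (\<mu> \<omega>) (\<Delta> l m)) q)"
    "expectation (\<lambda>\<omega>. nonneg_power (measure (\<mu> \<omega>) (\<Delta> l m)) q) \<le> C * \<Lambda> l" if m: "m < N l" for l m
  proof -
    obtain \<theta> where \<theta>: "norm \<theta> = 1" and diam: "\<And>x. x \<in> \<Delta> l m \<Longrightarrow> norm (x - \<theta>) \<le> C0 / 2 ^ l"
      and vol_ge: "ennreal (A1 * t l) \<le> emeasure \<sigma> (\<Delta> l m)" using cell[OF m] by blast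
    have sc: "2 * (C0 / 2 ^ l) \<le> scale a (n l)"
    proof -
      have "2 * (C0 / 2 ^ l) = 2 * C0 / 2 ^ l" by simp
      also have "\<dots> \<le> b ^ a / b ^ n l" using a n(1)[of l] C0 b by (intro frac_le) auto
      finally show ?thesis by (simp add: scale_def)
    qed
    have d1: "norm (x - \<theta>) \<le> scale a (n l)" if "x \<in> \<Delta> l m" for x
    proof -
      have "0 \<le> C0 / 2 ^ l" using C0 by simp
      then show ?thesis using diam[OF that] sc by linarith
    qed
    have d2: "norm (x - y) \<le> scale a (n l)" if "x \<in> \<Delta> l m" "y \<in> \<Delta> l m" for x y
      using norm_triangle_ineq4[of "x - \<theta>" "y - \<theta>"] diam[OF that(1)] diam[OF that(2)] sc by simp
    have "v * (1 / b ^ n l) ^ d = v0 * (u / (b * b ^ n l)) ^ d"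
      unfolding v_def by (simp add: power_divide power_mult_distrib)
    also have "\<dots> \<le> v0 * (u / 2 ^ l) ^ d"
      using n(2)[of l] u v0 b by (intro mult_left_mono power_mono frac_le) auto
    also have "\<dots> = A1 * t l" by (simp add: A1_def t_def power_divide)
    finally have "ennreal (v * (1 / b ^ n l) ^ d) \<le> emeasure \<sigma> (\<Delta> l m)"
      using vol_ge by (meson ennreal_leI order_trans)
    moreover have "small_cell a (n l) \<theta> (\<Delta> l m)"
      unfolding small_cell_def using \<Delta>[OF m] \<theta> d1 d2 by blast
    ultimately have "expectation (\<lambda>\<omega>. nonneg_power (measure (\<mu> \<omega>) (\<Delta> l m)) q) \<le> C * \<Lambda> l \<and>
        c * \<Lambda> l \<le> expectation (\<lambda>\<omega>. nonneg_power (measure (\<mu> \<omega>) (\<Delta> l m)) q)"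
      unfolding \<Lambda>_def by (intro bounds)
    then
    show "c * \<Lambda> l \<le> expectation (\<lambda>\<omega>. nonneg_power (measure (\<mu> \<omega>) (\<Delta> l m)) q)"
      "expectation (\<lambda>\<omega>. nonneg_power (measure (\<mu> \<omega>) (\<Delta> l m)) q) \<le> C * \<Lambda> l"
      by blast+
  qed
  define Sg where "Sg = measure \<sigma> (sphere 0 1)"
  have Sg_eq: "Sg = (\<Sum>m<N l. measure \<sigma> (\<Delta> l m))" for l
    unfolding Sg_def partition(1)[of l, symmetric]
    by (rule \<sigma>.finite_measure_finite_Union) (use \<Delta> partition(2) in auto)
  have N_pos: "0 < N l" for l
  proof (rule ccontr)
    assume "\<not> 0 < N l"
    then have "sphere 0 1 = ({} :: 'u set)" using partition(1)[of l] by simp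
    moreover obtain \<theta> :: 'u where "norm \<theta> = 1" using vector_choose_size[of 1] by auto
    ultimately show False by auto
  qed
  have Sg_le: "Sg \<le> N l * (A2 * t l)" for l
    unfolding Sg_eq[of l] using sum_bounded_above[of "{..<N l}" "\<lambda>m. measure \<sigma> (\<Delta> l m)" "A2 * t l"] vol by simp
  have Sg_ge: "N l * (A1 * t l) \<le> Sg" for l
    unfolding Sg_eq[of l] using sum_bounded_below[of "{..<N l}" "A1 * t l" "\<lambda>m. measure \<sigma> (\<Delta> l m)"] vol by simp
  have Sg: "0 < Sg"
  proof -
    have "0 < N 0 * (A1 * t 0)" using N_pos A t by simp
    then show ?thesis using Sg_ge[of 0] by linarith
  qed
  \<comment> \<open>The cells exhaust the sphere, whose total measure does not depend on l.\<close>
  have ln_N: "\<bar>ln (N l) - real l * (real d * ln 2)\<bar> \<le> \<bar>ln Sg - ln A1\<bar> + \<bar>ln Sg - ln A2\<bar>" for l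
  proof -
    have "ln Sg \<le> ln (N l * (A2 * t l))" using Sg_le[of l] Sg N_pos[of l] A t[of l] by (subst ln_le_cancel_iff) auto
    also have "\<dots> = ln (N l) + (ln A2 + ln (t l))" using N_pos[of l] A t[of l] by (simp add: ln_mult)
    finally have 1: "ln Sg - ln A2 \<le> ln (N l) - real l * (real d * ln 2)" unfolding ln_t by linarith
    have "ln (N l * (A1 * t l)) \<le> ln Sg" using Sg_ge[of l] Sg N_pos[of l] A t[of l] by (subst ln_le_cancel_iff) auto
    moreover have "ln (N l * (A1 * t l)) = ln (N l) + (ln A1 + ln (t l))" using N_pos[of l] A t[of l] by (simp add: ln_mult)
    ultimately have 2: "ln (N l) - real l * (real d * ln 2) \<le> ln Sg - ln A1" unfolding ln_t by linarith
    show ?thesis using 1 2 by linarith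
  qed
  define x where "x l = ln (\<Sum>m<N l. expectation (\<lambda>\<omega>. nonneg_power (measure (\<mu> \<omega>) (\<Delta> l m)) q))" for l
  define y where "y l = ln (measure \<sigma> (\<Delta> l 0))" for l
  define \<alpha> where "\<alpha> = real d * ln 2 + ln 2 / ln b * \<kappa>"
  have x: "\<bar>x l - real l * \<alpha>\<bar> \<le> \<bar>ln Sg - ln A1\<bar> + \<bar>ln Sg - ln A2\<bar> + \<bar>\<kappa>\<bar> + \<bar>ln c\<bar> + \<bar>ln C\<bar>" for l
  proof -
    let ?S = "\<Sum>m<N l. expectation (\<lambda>\<omega>. nonneg_power (measure (\<mu> \<omega>) (\<Delta> l m)) q)"
    have lo: "N l * (c * \<Lambda> l) \<le> ?S"
      using sum_bounded_below[of "{..<N l}" "c * \<Lambda> l"] mom(1) by simp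
    have hi: "?S \<le> N l * (C * \<Lambda> l)"
      using sum_bounded_above[of "{..<N l}" _ "C * \<Lambda> l"] mom(2) by simp
    have pos: "0 < N l * (c * \<Lambda> l)" using N_pos[of l] c \<Lambda>[of l] by simp
    have "ln (N l * (c * \<Lambda> l)) \<le> x l" "x l \<le> ln (N l * (C * \<Lambda> l))"
      unfolding x_def using lo hi pos by (auto intro!: ln_mono)
    moreover have "ln (N l * (c * \<Lambda> l)) = ln (N l) + (ln c + n l * \<kappa>)" "ln (N l * (C * \<Lambda> l)) = ln (N l) + (ln C + n l * \<kappa>)"
      using N_pos[of l] c C \<Lambda>[of l] by (simp_all add: ln_mult ln_\<Lambda>)
    ultimately have x1: "ln (N l) + (ln c + n l * \<kappa>) \<le> x l" "x l \<le> ln (N l) + (ln C + n l * \<kappa>)" by linarith+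
    have "\<bar>n l * \<kappa> - real l * (ln 2 / ln b) * \<kappa>\<bar> = \<bar>real (n l) - real l * (ln 2 / ln b)\<bar> * \<bar>\<kappa>\<bar>"
      by (simp add: abs_mult[symmetric] left_diff_distrib)
    also have "\<dots> \<le> 1 * \<bar>\<kappa>\<bar>" using n(3)[of l] by (rule mult_right_mono) simp
    finally have x2: "\<bar>n l * \<kappa> - real l * (ln 2 / ln b) * \<kappa>\<bar> \<le> \<bar>\<kappa>\<bar>" by simp
    have "real l * \<alpha> = real l * (real d * ln 2) + real l * (ln 2 / ln b) * \<kappa>" by (simp add: \<alpha>_def distrib_left)
    then show ?thesis using x1 x2 ln_N[of l] by linarith
  qed
  have y: "\<bar>y l - real l * (- (real d * ln 2))\<bar> \<le> \<bar>ln A1\<bar> + \<bar>ln A2\<bar>" for l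
  proof -
    note V = vol[OF N_pos[of l]]
    have "0 < A1 * t l" using A t by simp
    then have "ln (A1 * t l) \<le> y l" "y l \<le> ln (A2 * t l)" unfolding y_def using V by (auto intro!: ln_mono)
    moreover have "ln (A1 * t l) = ln A1 - real l * (real d * ln 2)" "ln (A2 * t l) = ln A2 - real l * (real d * ln 2)"
      using A t[of l] by (simp_all add: ln_mult ln_t)
    ultimately show ?thesis by linarith
  qed
  have "(\<lambda>l. x l / y l) \<longlonglongrightarrow> \<alpha> / (- (real d * ln 2))"
    by (rule tendsto_affine_ratio[OF x always_eventually]) (use y d in auto)
  then have "(\<lambda>l. ereal (x l / y l)) \<longlonglongrightarrow> ereal (\<alpha> / (- (real d * ln 2)))" by simp
  then have "renyi_function M N \<Delta> \<mu> q = ereal (\<alpha> / (- (real d * ln 2)))"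
    unfolding renyi_function_def x_def y_def by (rule lim_imp_Liminf[OF sequentially_bot])
  also have "\<alpha> / (- (real d * ln 2)) = - (s\<^sup>2 / (2 * real d * ln b)) * q\<^sup>2 + (s\<^sup>2 / (2 * real d * ln b) + 1) * q - 1"
  proof -
    have "0 < ln (2::real)" by simp
    then have "\<alpha> / (- (real d * ln 2)) = - 1 - \<kappa> / (real d * ln b)"
      using lb d by (simp add: \<alpha>_def field_simps)
    also have "\<dots> = - (s\<^sup>2 / (2 * real d * ln b)) * q\<^sup>2 + (s\<^sup>2 / (2 * real d * ln b) + 1) * q - 1"
      using lb d by (simp add: \<kappa>_def field_simps)
    finally show ?thesis .
  qed
  finally show ?thesis .
qed

end

end

theorem corollary3:
  fixes M :: "'w measure"
    and X :: "nat \<Rightarrow> real ^ 'n \<Rightarrow> 'w \<Rightarrow> real"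
    and r :: "real \<Rightarrow> real"
    and b s :: real
    and d p :: nat
  assumes "prob_space M"
    and "d \<ge> 1" and "CARD('n) = d + 1"
    and "\<And>i. (\<lambda>(u, \<omega>). X i u \<omega>) \<in> borel_measurable (borel \<Otimes>\<^sub>M M)"
    and "iid_fields M X"
    and "\<And>i. gaussian_field M (X i)"
    and "\<And>i. homogeneous_isotropic M (X i)"
    and "\<And>i u. prob_space.expectation M (X i u) = 0"
    and "\<And>i u. prob_space.variance M (X i u) = s\<^sup>2" and "s\<^sup>2 > 0"
    and "\<And>i u1 u2. prob_space.expectation M (\<lambda>\<omega>. X i u1 \<omega> * X i u2 \<omega>) = r (norm (u1 - u2))"
    and "b > 1"
    and "antimono_on {0..} r"
    and "p \<ge> 2"
    and "b > exp (real p * (real p - 1) * s\<^sup>2 / (2 * real d))"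
    and "summable (\<lambda>i. r (b ^ i))"
    and "summable (\<lambda>i. s\<^sup>2 - r (b powi (- int i)))"
  shows "(\<exists>\<mu>. limiting_measure M b X p \<mu>) \<and>
    (\<forall>\<mu>. limiting_measure M b X p \<mu> \<longrightarrow>
       (\<forall>B\<in>sets sphere_measure. integrable M (\<lambda>\<omega>. measure (\<mu> \<omega>) B ^ p)) \<and>
       nondegenerate M \<mu> \<and>
       (\<forall>N \<Delta>. dyadic_mesh N \<Delta> \<longrightarrow>
          (\<forall>q\<in>{0..real p}. renyi_function M N \<Delta> \<mu> q =
             ereal (- (s\<^sup>2 / (2 * real d * ln b)) * q\<^sup>2 + (s\<^sup>2 / (2 * real d * ln b) + 1) * q - 1))))"
proof -
  interpret gaussian_cascade M X r b s d p
  proof (intro gaussian_cascade.intro gaussian_cascade_axioms.intro)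
    show "DIM(real ^ 'n) = Suc d" using assms(3) by simp
    show "integrable M (\<lambda>\<omega>. (X i u \<omega>)\<^sup>2)" for i u
      using assms(7)[of i] by (simp add: homogeneous_isotropic_def)
  qed (fact assms)+
  show ?thesis
    using limiting_measure_exists lmass_integrable limiting_nondegenerate renyi_function_limiting_measure
    by (auto simp del: ereal.inject)
qed

end
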